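(* For integers $h\ge 1$ and $n\ge 1$ define \[g_h(n)=\frac14\sum_{\substack{\alpha\in\mathbb{Z}[i]\\ N(\alpha)=n}}\left(\frac{\alpha}{|\alpha|}\right)^h\qquad\text{and}\qquad f_h(n)=|g_h(n)|.\] Then for any fixed $\varepsilon>0$, \[\sum_{p<N}f_h(N-p)\ll_{\varepsilon}N(\log N)^{-5/4+\varepsilon},\] uniformly for positive integers $N$ and integers $h$ with $1\le h\le\log N$. The sum runs over primes $p<N$, and the implied constant depends only on $\varepsilon$.
   Context: For $\alpha=m+in\in\mathbb{Z}[i]$ with $m,n\in\mathbb{Z}$, $N(\alpha)=m^2+n^2$ is the norm and $|\alpha|=\sqrt{m^2+n^2}$ is the complex absolute value. The symbol $N$ without an argument denotes a positive integer. *)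

theory Defs
  imports Complex_Main "HOL-Computational_Algebra.Primes"
begin

text \<open>The ring of Gaussian integers is represented as a subset of the complex numbers.\<close>

definition gauss_ints :: "complex set" where
  "gauss_ints = {Complex (of_int m) (of_int n) | m n :: int. True}"

definition gauss_norm :: "complex \<Rightarrow> real" where
  "gauss_norm \<alpha> = (Re \<alpha>)\<^sup>2 + (Im \<alpha>)\<^sup>2"

definition g :: "nat \<Rightarrow> nat \<Rightarrow> complex" where
  "g h n = 1 / 4 * (\<Sum>\<alpha> | \<alpha> \<in> gauss_ints \<and> gauss_norm \<alpha> = of_nat n.
                       (\<alpha> / of_real (cmod \<alpha>)) ^ h)"

definition f :: "nat \<Rightarrow> nat \<Rightarrow> real" where
  "f h n = cmod (g h n)"

text \<open>The index set of the sum defining \<^const>\<open>g\<close> is finite, so that sum is not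
  the default value of a sum over an infinite set.\<close>

lemma finite_gauss_norm_eq: "finite {\<alpha>. \<alpha> \<in> gauss_ints \<and> gauss_norm \<alpha> = of_nat n}"
proof (rule finite_subset)
  let ?I = "{- int n..int n}"
  show "finite ((\<lambda>(a, b). Complex (of_int a) (of_int b)) ` (?I \<times> ?I))"
    by simp
  have bound: "a \<in> ?I" if "a\<^sup>2 \<le> int n" for a :: int
  proof -
    have "\<bar>a\<bar> \<le> \<bar>a\<bar> * \<bar>a\<bar>"
      by (cases "a = 0") (auto intro: mult_right_mono[of 1 "\<bar>a\<bar>" "\<bar>a\<bar>", simplified])
    also have "\<dots> = a\<^sup>2"
      by (simp add: power2_eq_square)
    finally show ?thesis
      using that by auto
  qed
  show "{\<alpha>. \<alpha> \<in> gauss_ints \<and> gauss_norm \<alpha> = of_nat n}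
          \<subseteq> (\<lambda>(a, b). Complex (of_int a) (of_int b)) ` (?I \<times> ?I)"
  proof
    fix \<alpha> assume "\<alpha> \<in> {\<alpha>. \<alpha> \<in> gauss_ints \<and> gauss_norm \<alpha> = of_nat n}"
    then obtain a b :: int where ab: "\<alpha> = Complex (of_int a) (of_int b)"
      and "(real_of_int a)\<^sup>2 + (real_of_int b)\<^sup>2 = real n"
      by (auto simp: gauss_ints_def gauss_norm_def)
    then have "real_of_int (a\<^sup>2 + b\<^sup>2) = real_of_int (int n)"
      by simp
    then have "a\<^sup>2 + b\<^sup>2 = int n"
      by (simp only: of_int_eq_iff)
    then have "a\<^sup>2 \<le> int n" "b\<^sup>2 \<le> int n"
      using zero_le_power2[of a] zero_le_power2[of b] by linarith+
    then have "(a, b) \<in> ?I \<times> ?I"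
      using bound by blast
    then show "\<alpha> \<in> (\<lambda>(a, b). Complex (of_int a) (of_int b)) ` (?I \<times> ?I)"
      using ab by force
  qed
qed

end

theory Submission
  imports Defs "HOL-Analysis.Analysis" "HOL-Real_Asymp.Real_Asymp"
begin

text \<open>
  If 4 does not divide \<open>h\<close>, multiplication by \<open>\<i>\<close> permutes the Gaussian integers of norm \<open>n\<close>
  and multiplies the sum defining \<open>g h n\<close> by \<open>\<i> ^ h \<noteq> 1\<close>; so \<open>g h n = 0\<close>. Let 4 divide \<open>h\<close>.
  Then \<open>\<alpha> \<mapsto> (\<alpha> / \<bar>\<alpha>\<bar>) ^ h\<close> does not see units, and unique factorisation in
  \<open>\<int>[\<i>]\<close> gives a Hecke relation (\<open>hecke_params_cases\<close>) from which \<open>f h\<close> is multiplicative with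
  \<open>f h (p ^ j) \<le> j + 1\<close>. An integer \<open>n = N - p\<close> should behave like a random integer subject to
  one more sieve condition, which suggests a bound of size
  \<open>N (log N)\<^sup>-\<^sup>2 exp (\<Sum>p\<le>N. f h p / p)\<close>.

  The exponent \<open>-5/4\<close> is \<open>-2 + 3/4\<close>, where \<open>3/4\<close> comes from the sum over primes. For a prime
  \<open>p\<close> that is the norm of \<open>\<pi>\<close> with argument \<open>\<theta>\<close>, the inequality
  \<open>2\<bar>cos h\<theta>\<bar> \<le> 1 + cos\<^sup>2 h\<theta>\<close> says \<open>f h p \<le> 3/4 g 0 p + 1/4 g (2h) p\<close> (\<open>f_prime_le\<close>). The sums
  of \<open>g 0 p / p\<close> and \<open>g (2h) p / p\<close> up to \<open>y\<close> are bounded above, up to \<open>O(1)\<close>, by the logarithms of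
  the moduli of the L-series \<open>\<Sum>n. g k n n\<^sup>-\<^sup>\<sigma>\<close> at \<open>\<sigma> = 1 + 1 / log y\<close>, for \<open>k = 0\<close> and \<open>k = 2h\<close>; this is the
  Euler product, obtained here by removing one prime after the other (\<open>infsum_rough_insert\<close>).
  For \<open>k = 0\<close> the series is \<open>O(1 / (\<sigma> - 1))\<close>. For \<open>k > 0\<close> it is only \<open>O(1 + log k)\<close>
  (\<open>L_series_bound\<close>): on the boundary of the square of half side \<open>m\<close> the values
  \<open>(\<alpha> / \<bar>\<alpha>\<bar>) ^ k\<close> change from one lattice point to the next by about
  \<open>\<i> k m \<bar>\<alpha>\<bar>\<^sup>-\<^sup>2 (\<alpha> / \<bar>\<alpha>\<bar>) ^ k\<close>, and these changes add up to zero around the square. Since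
  \<open>h \<le> log N\<close>, the factor \<open>1 + log (2h)\<close> is absorbed by \<open>(log N) ^ \<epsilon>\<close>.

  To make the heuristic rigorous, take \<open>y = exp (log N / (D log log N))\<close> with a small multiple \<open>D\<close>
  of \<open>\<epsilon>\<close> and write \<open>N - p = a b\<close>, where \<open>a\<close> has only prime factors up to \<open>y\<close> and \<open>b\<close> only
  larger ones (\<open>sum_shifted_primes_le\<close>). There are three ranges.

  \<^item> The primes \<open>p \<le> y\<close> contribute little, since \<open>f h n = O(\<surd>n)\<close>.

  \<^item> If \<open>a > \<surd>N\<close>, the primality of \<open>p\<close> is dropped. Rankin's trick shows that so large a smooth
    part is rare: it saves any prescribed power of \<open>log N\<close>.

  \<^item> If \<open>a \<le> \<surd>N\<close>, then \<open>b\<close> has at most \<open>log N / log y\<close> prime factors, whence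
    \<open>f h b \<le> (log N) ^ (O(D))\<close>. For fixed \<open>a\<close> the number of \<open>b\<close> is bounded by a sieve that removes
    for each prime \<open>q \<le> y\<close> the two classes \<open>b \<equiv> 0\<close> and \<open>a b \<equiv> N\<close> (\<open>card_sieved_le\<close>); it saves
    \<open>(log y)\<^sup>2\<close>, up to factors depending on the primes that divide \<open>a N\<close>. Summing \<open>f h a / a\<close> over
    smooth \<open>a\<close> then produces \<open>exp (\<Sum>p\<le>y. f h p / p)\<close>.
\<close>

section \<open>Arithmetic of the Gaussian integers and the Hecke relation\<close>

lemma gauss_ints_iff: "z \<in> gauss_ints \<longleftrightarrow> Re z \<in> \<int> \<and> Im z \<in> \<int>"
proof
  assume "Re z \<in> \<int> \<and> Im z \<in> \<int>"
  then obtain a b :: int where "Re z = of_int a" "Im z = of_int b"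
    by (auto elim!: Ints_cases)
  then have "z = Complex (of_int a) (of_int b)"
    by (simp add: complex_eq_iff)
  then show "z \<in> gauss_ints"
    by (auto simp: gauss_ints_def)
qed (auto simp: gauss_ints_def)

lemma gauss_ints_closed:
  assumes "a \<in> gauss_ints" "b \<in> gauss_ints"
  shows "a + b \<in> gauss_ints" "a - b \<in> gauss_ints" "a * b \<in> gauss_ints" "cnj a \<in> gauss_ints"
  using assms by (auto simp: gauss_ints_iff)

lemma gauss_ints_basic [simp]:
  "0 \<in> gauss_ints" "1 \<in> gauss_ints" "\<i> \<in> gauss_ints" "of_nat n \<in> gauss_ints"
  by (auto simp: gauss_ints_iff)

lemma gauss_norm_nat:
  assumes "z \<in> gauss_ints"
  obtains n :: nat where "(cmod z)\<^sup>2 = of_nat n"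
proof -
  from assms obtain a b :: int where "z = Complex (of_int a) (of_int b)"
    by (auto simp: gauss_ints_def)
  then have "(cmod z)\<^sup>2 = of_int (a\<^sup>2 + b\<^sup>2)"
    by (simp add: cmod_power2)
  also have "\<dots> = of_nat (nat (a\<^sup>2 + b\<^sup>2))"
    by simp
  finally show ?thesis
    by (rule that)
qed

lemma gauss_division:
  assumes "a \<in> gauss_ints" "b \<in> gauss_ints" "b \<noteq> 0"
  obtains q where "q \<in> gauss_ints" "cmod (a - q * b) < cmod b"
proof
  define w where "w = a / b"
  define q where "q = Complex (of_int (round (Re w))) (of_int (round (Im w)))"
  show "q \<in> gauss_ints"
    by (auto simp: q_def gauss_ints_def)
  have "\<bar>Re (w - q)\<bar> \<le> 1/2" "\<bar>Im (w - q)\<bar> \<le> 1/2"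
    using of_int_round_abs_le[of "Re w"] of_int_round_abs_le[of "Im w"]
    by (auto simp: q_def abs_minus_commute)
  then have "(Re (w - q))\<^sup>2 \<le> (1/2)\<^sup>2" "(Im (w - q))\<^sup>2 \<le> (1/2)\<^sup>2"
    by (metis abs_le_square_iff abs_of_nonneg zero_le_divide_1_iff zero_le_numeral)+
  then have "(cmod (w - q))\<^sup>2 < 1\<^sup>2"
    unfolding cmod_power2 by (simp add: power2_eq_square)
  then have "cmod (w - q) < 1"
    by (rule power2_less_imp_less) simp
  moreover have "a - q * b = (w - q) * b"
    using assms by (simp add: w_def algebra_simps)
  ultimately show "cmod (a - q * b) < cmod b"
    using assms by (simp add: norm_mult)
qed

definition gauss_dvd :: "complex \<Rightarrow> complex \<Rightarrow> bool" where
  "gauss_dvd d a \<longleftrightarrow> (\<exists>c \<in> gauss_ints. a = d * c)"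

text \<open>
  The Euclidean algorithm: the norm of the second argument decreases.
\<close>

lemma gauss_bezout:
  assumes "a \<in> gauss_ints" "b \<in> gauss_ints"
  shows "\<exists>x \<in> gauss_ints. \<exists>y \<in> gauss_ints. x * a + y * b \<in> gauss_ints \<and>
           gauss_dvd (x * a + y * b) a \<and> gauss_dvd (x * a + y * b) b"
proof -
  obtain n :: nat where "(cmod b)\<^sup>2 = of_nat n"
    using gauss_norm_nat assms by blast
  then show ?thesis
    using assms
  proof (induction n arbitrary: a b rule: less_induct)
    case (less n)
    show ?case
    proof (cases "b = 0")
      case True
      then show ?thesis
        using less.prems by (intro bexI[of _ 1] bexI[of _ 0]) (auto simp: gauss_dvd_def intro: bexI[of _ 1] bexI[of _ 0])
    next
      case False
      obtain q where q: "q \<in> gauss_ints" "cmod (a - q * b) < cmod b"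
        using gauss_division less.prems False by blast
      define r where "r = a - q * b"
      have r: "r \<in> gauss_ints"
        using less.prems q by (auto simp: r_def intro: gauss_ints_closed)
      then obtain m :: nat where m: "(cmod r)\<^sup>2 = of_nat m"
        using gauss_norm_nat by blast
      have "(cmod r)\<^sup>2 < (cmod b)\<^sup>2"
        using q by (intro power_strict_mono) (auto simp: r_def)
      then have "m < n"
        using m less.prems by simp
      from less.IH[OF this m less.prems(3) r] obtain x y where xy: "x \<in> gauss_ints" "y \<in> gauss_ints"
         "x * b + y * r \<in> gauss_ints" "gauss_dvd (x * b + y * r) b" "gauss_dvd (x * b + y * r) r"
        by blast
      define d where "d = x * b + y * r"
      have d: "d = y * a + (x - y * q) * b"
        by (simp add: d_def r_def algebra_simps)
      obtain c1 c2 where c: "c1 \<in> gauss_ints" "c2 \<in> gauss_ints" "b = d * c1" "r = d * c2"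
        using xy unfolding d_def[symmetric] gauss_dvd_def by blast
      have "a = q * b + r" by (simp add: r_def)
      also have "\<dots> = q * (d * c1) + d * c2" using c(3,4) by metis
      also have "\<dots> = d * (q * c1 + c2)"
        by (simp add: algebra_simps)
      finally have "gauss_dvd d a"
        using c q unfolding gauss_dvd_def by (blast intro: gauss_ints_closed)
      moreover have "d \<in> gauss_ints" "gauss_dvd d b"
        using xy by (auto simp: d_def)
      moreover have "x - y * q \<in> gauss_ints"
        using xy q by (auto intro: gauss_ints_closed)
      ultimately show ?thesis
        using xy(2) unfolding d by blast
    qed
  qed
qed

definition gauss_irreducible :: "complex \<Rightarrow> bool" where
  "gauss_irreducible q \<longleftrightarrow> q \<in> gauss_ints \<and>
     (\<forall>d \<in> gauss_ints. \<forall>e \<in> gauss_ints. q = d * e \<longrightarrow> cmod d = 1 \<or> cmod e = 1)"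

lemma norm_not_minus_one: "cmod z = -1 \<Longrightarrow> False"
  using norm_ge_zero[of z] by linarith

lemma gauss_unit_inverse: "cmod u = 1 \<Longrightarrow> u * cnj u = 1"
  by (simp add: complex_norm_square[symmetric])

text \<open>
  Write a greatest common divisor of \<open>q\<close> and \<open>a\<close> as a linear combination. It is a unit
  or an associate of \<open>q\<close>; in the first case multiply the combination by \<open>b\<close>.
\<close>

lemma gauss_irreducible_imp_prime:
  assumes "gauss_irreducible q" "a \<in> gauss_ints" "b \<in> gauss_ints" "gauss_dvd q (a * b)"
  shows "gauss_dvd q a \<or> gauss_dvd q b"
proof -
  have q: "q \<in> gauss_ints"
    using assms(1) by (simp add: gauss_irreducible_def)
  obtain x y where xy: "x \<in> gauss_ints" "y \<in> gauss_ints"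
    "x * q + y * a \<in> gauss_ints" "gauss_dvd (x * q + y * a) q" "gauss_dvd (x * q + y * a) a"
    using gauss_bezout[OF q assms(2)] by blast
  define d where "d = x * q + y * a"
  obtain e s where es: "e \<in> gauss_ints" "s \<in> gauss_ints" "q = d * e" "a = d * s"
    using xy unfolding d_def[symmetric] gauss_dvd_def by blast
  obtain t where t: "t \<in> gauss_ints" "a * b = q * t"
    using assms(4) by (auto simp: gauss_dvd_def)
  consider "cmod d = 1" | "cmod e = 1"
    using assms(1) xy es unfolding gauss_irreducible_def d_def by blast
  then show ?thesis
  proof cases
    case 1
    have "b = (d * cnj d) * b"
      using gauss_unit_inverse[OF 1] by simp
    also have "\<dots> = cnj d * x * b * q + cnj d * y * (a * b)"
      unfolding d_def by (simp add: algebra_simps)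
    also have "\<dots> = q * (cnj d * x * b + cnj d * y * t)"
      unfolding t(2) by (simp add: algebra_simps)
    finally have "gauss_dvd q b"
      using assms xy t unfolding gauss_dvd_def d_def[symmetric]
      by (blast intro: gauss_ints_closed)
    then show ?thesis ..
  next
    case 2
    have "a = q * (cnj e * s)"
      using es gauss_unit_inverse[OF 2] by (metis mult.assoc mult_1_right)
    then have "gauss_dvd q a"
      unfolding gauss_dvd_def using es by (blast intro: gauss_ints_closed)
    then show ?thesis ..
  qed
qed

definition gauss_of_norm :: "nat \<Rightarrow> complex set" where
  "gauss_of_norm n = {a. a \<in> gauss_ints \<and> (cmod a)\<^sup>2 = of_nat n}"

lemma finite_gauss_of_norm [simp]: "finite (gauss_of_norm n)"
  using finite_gauss_norm_eq[of n] by (simp add: gauss_of_norm_def gauss_norm_def cmod_power2)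

lemma g_eq_sum_sgn: "g k n = (\<Sum>a\<in>gauss_of_norm n. sgn a ^ k) / 4"
  by (simp add: g_def gauss_of_norm_def gauss_norm_def cmod_power2 sgn_eq)

lemma gauss_unit_cases:
  assumes "u \<in> gauss_ints" "cmod u = 1"
  shows "u = 1 \<or> u = -1 \<or> u = \<i> \<or> u = -\<i>"
proof -
  from assms obtain a b :: int where u: "u = Complex (of_int a) (of_int b)"
    by (auto simp: gauss_ints_def)
  have "(cmod u)\<^sup>2 = 1"
    using assms by simp
  then have "real_of_int (a\<^sup>2 + b\<^sup>2) = of_int 1"
    by (simp add: u cmod_power2)
  then have ab: "a\<^sup>2 + b\<^sup>2 = 1"
    by (simp only: of_int_eq_iff)
  then have "a\<^sup>2 \<le> 1" "b\<^sup>2 \<le> 1"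
    using zero_le_power2[of a] zero_le_power2[of b] by linarith+
  then have "\<bar>a\<bar> \<le> 1" "\<bar>b\<bar> \<le> 1"
    by (simp_all add: abs_square_le_1)
  then have "a \<in> {-1,0,1}" "b \<in> {-1,0,1}" by auto
  then show ?thesis
    using ab by (auto simp: u complex_eq_iff)
qed

text \<open>
  The local Euler factor at \<open>p\<close> is \<open>1 / ((1 - a X) (1 - b X))\<close>, as for the Fourier
  coefficients of a Hecke eigenform.
\<close>

definition hecke_params :: "nat \<Rightarrow> nat \<Rightarrow> complex \<Rightarrow> complex \<Rightarrow> bool" where
  "hecke_params k p a b \<longleftrightarrow> cmod a \<le> 1 \<and> cmod b \<le> 1 \<and>
     (\<forall>n>0. g k (p * n) = (a + b) * g k n - a * b * (if p dvd n then g k (n div p) else 0))"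

lemma gauss_dvd_cnj: "gauss_dvd a b \<Longrightarrow> gauss_dvd (cnj a) (cnj b)"
  by (auto simp: gauss_dvd_def gauss_ints_closed)

lemma gauss_of_norm_mult_iff:
  assumes "q \<in> gauss_ints" "(cmod q)\<^sup>2 = of_nat m" "m > 0"
  shows "{a \<in> gauss_of_norm (m * n). gauss_dvd q a} = (*) q ` gauss_of_norm n"
  using assms by (auto simp: gauss_of_norm_def gauss_dvd_def norm_mult power_mult_distrib
      intro: gauss_ints_closed)

lemma sum_sgn_mult_image:
  fixes q :: complex and A :: "complex set" and k :: nat
  assumes "q \<noteq> 0"
  shows "(\<Sum>a\<in>(*) q ` A. sgn a ^ k) = sgn q ^ k * (\<Sum>a\<in>A. sgn a ^ k)"
proof -
  have "inj_on ((*) q) A"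
    using assms by (simp add: inj_on_def)
  then show ?thesis
    by (simp add: sum.reindex sgn_mult power_mult_distrib sum_distrib_left)
qed

lemma gauss_irreducible_of_prime_norm:
  assumes "q \<in> gauss_ints" "(cmod q)\<^sup>2 = of_nat p" "prime p"
  shows "gauss_irreducible q"
  unfolding gauss_irreducible_def
proof (intro conjI ballI impI)
  fix d e assume de: "d \<in> gauss_ints" "e \<in> gauss_ints" "q = d * e"
  obtain m n :: nat where mn: "(cmod d)\<^sup>2 = of_nat m" "(cmod e)\<^sup>2 = of_nat n"
    using gauss_norm_nat de by metis
  then have "real (m * n) = of_nat p"
    using assms(2) de by (simp add: norm_mult power_mult_distrib)
  then have "m * n = p" by (simp only: of_nat_eq_iff)
  then have "m = 1 \<or> n = 1"
    using assms(3) prime_product by blast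
  then show "cmod d = 1 \<or> cmod e = 1"
    using mn by (auto simp: power2_eq_1_iff dest: norm_not_minus_one)
qed (rule assms)

text \<open>
  A proper divisor of a rational prime \<open>p\<close> would have norm \<open>p\<close>.
\<close>

lemma gauss_irreducible_of_inert:
  assumes "prime p" "gauss_of_norm p = {}"
  shows "gauss_irreducible (of_nat p)"
  unfolding gauss_irreducible_def
proof (intro conjI ballI impI)
  fix d e assume de: "d \<in> gauss_ints" "e \<in> gauss_ints" "of_nat p = d * e"
  obtain m n :: nat where mn: "(cmod d)\<^sup>2 = of_nat m" "(cmod e)\<^sup>2 = of_nat n"
    using gauss_norm_nat de by metis
  have "(cmod (of_nat p))\<^sup>2 = real (p\<^sup>2)"
    by simp
  then have "real (m * n) = of_nat (p\<^sup>2)"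
    unfolding de using mn by (simp add: norm_mult power_mult_distrib)
  then have mnp: "m * n = p\<^sup>2" by (simp only: of_nat_eq_iff)
  then have "m dvd p\<^sup>2"
    by (metis dvd_triv_left)
  then obtain i where i: "i \<le> 2" "m = p ^ i"
    using assms(1) divides_primepow_nat by blast
  have "i \<noteq> 1"
    using i mn de assms(2) by (auto simp: gauss_of_norm_def)
  with i have "i = 0 \<or> i = 2" by auto
  then have "m = 1 \<or> n = 1"
    using i mnp assms(1) by (auto simp: prime_gt_0_nat)
  then show "cmod d = 1 \<or> cmod e = 1"
    using mn by (auto simp: power2_eq_1_iff dest: norm_not_minus_one)
qed simp

lemma dvd_of_gauss_dvd_of_norm:
  assumes "prime p" "a \<in> gauss_of_norm (p * n)" "gauss_dvd (of_nat p) a"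
  shows "p dvd n"
proof -
  obtain c where c: "c \<in> gauss_ints" "a = of_nat p * c"
    using assms by (auto simp: gauss_dvd_def)
  obtain m :: nat where m: "(cmod c)\<^sup>2 = of_nat m"
    using gauss_norm_nat c by metis
  have "real (p * n) = (cmod a)\<^sup>2"
    using assms(2) by (simp add: gauss_of_norm_def)
  also have "\<dots> = real (p * (p * m))"
    using c m by (simp add: norm_mult power_mult_distrib power2_eq_square[of "real p"])
  finally have "real (p * n) = real (p * (p * m))" .
  then have "p * n = p * (p * m)" by (simp only: of_nat_eq_iff)
  then show ?thesis
    using assms(1) by (auto simp: prime_gt_0_nat)
qed

lemma sum_gauss_dvd_prime:
  assumes "prime p" "n > 0"
  shows "(\<Sum>a\<in>{a \<in> gauss_of_norm (p * n). gauss_dvd (of_nat p) a}. sgn a ^ k) / 4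
           = (if p dvd n then g k (n div p) else 0)"
proof (cases "p dvd n")
  case True
  then obtain m where m: "n = p * m" by auto
  have p0: "p > 0" using assms prime_gt_0_nat by blast
  have "{a \<in> gauss_of_norm (p * n). gauss_dvd (of_nat p) a} = (*) (of_nat p) ` gauss_of_norm m"
    using gauss_of_norm_mult_iff[of "of_nat p" "p\<^sup>2" m] p0
    by (simp add: m power2_eq_square mult.assoc)
  moreover have "sgn (of_nat p :: complex) = 1"
    using p0 by (simp add: sgn_eq)
  ultimately show ?thesis
    using p0 by (simp add: m sum_sgn_mult_image g_eq_sum_sgn)
next
  case False
  then have "{a \<in> gauss_of_norm (p * n). gauss_dvd (of_nat p) a} = {}"
    using dvd_of_gauss_dvd_of_norm[OF assms(1)] by blast
  then show ?thesis using False by (simp only: if_False) simp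
qed

text \<open>
  An element of norm \<open>p n\<close> is divisible by a prime above \<open>p\<close>. In the split case there
  are two classes of such primes, \<open>\<pi>\<close> and its conjugate, and inclusion-exclusion over them
  subtracts the multiples of \<open>p\<close>. In the inert case \<open>p\<close> itself divides the element. In
  the ramified case \<open>\<pi>\<close> is associated to its conjugate, which forces
  \<open>\<pi> / \<bar>\<pi>\<bar>\<close> to be an eighth root of unity. The same
  \<open>w = \<pi> / \<bar>\<pi>\<bar>\<close> serves for all \<open>k\<close>; this is what relates
  \<open>g h p\<close> to \<open>g (2 * h) p\<close> later.
\<close>

lemma hecke_params_cases:
  assumes p: "prime p"
  obtains (split) w where "cmod w = 1" "\<And>k. hecke_params k p (w ^ k) (cnj w ^ k)"
    | (ramified) w where "cmod w = 1" "w ^ 8 = 1" "\<And>k. hecke_params k p (w ^ k) 0"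
    | (inert) "\<And>k. hecke_params k p 1 (-1)"
proof (cases "gauss_of_norm p = {}")
  case True
  have "gauss_of_norm (p * n) = {a \<in> gauss_of_norm (p * n). gauss_dvd (of_nat p) a}" for n
  proof (intro equalityI subsetI CollectI conjI)
    fix a assume a: "a \<in> gauss_of_norm (p * n)"
    then have ai: "a \<in> gauss_ints" by (simp add: gauss_of_norm_def)
    have "a * cnj a = of_nat p * of_nat n"
      using a by (simp add: gauss_of_norm_def complex_norm_square[symmetric] flip: of_real_power)
    then have "gauss_dvd (of_nat p) (a * cnj a)"
      unfolding gauss_dvd_def by (intro bexI[of _ "of_nat n"]) simp_all
    then have "gauss_dvd (of_nat p) a \<or> gauss_dvd (of_nat p) (cnj a)"
      using gauss_irreducible_imp_prime[OF gauss_irreducible_of_inert[OF p True]] ai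
      by (simp add: gauss_ints_closed)
    then show "gauss_dvd (of_nat p) a"
      using gauss_dvd_cnj[of "of_nat p" "cnj a"] by auto
  qed auto
  then have "g k (p * n) = (if p dvd n then g k (n div p) else 0)" if "n > 0" for k n
    using sum_gauss_dvd_prime[OF p that, of k] by (simp add: g_eq_sum_sgn)
  then have "hecke_params k p 1 (-1)" for k
    by (simp add: hecke_params_def)
  then show ?thesis by (rule inert)
next
  case False
  then obtain q where q: "q \<in> gauss_ints" "(cmod q)\<^sup>2 = of_nat p"
    by (auto simp: gauss_of_norm_def)
  have p0: "p > 0" using p prime_gt_0_nat by blast
  then have q0: "q \<noteq> 0" using q by auto
  have cq: "cnj q \<in> gauss_ints" "(cmod (cnj q))\<^sup>2 = of_nat p"
    using q by (auto simp: gauss_ints_closed)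
  have irr: "gauss_irreducible q" "gauss_irreducible (cnj q)"
    using gauss_irreducible_of_prime_norm q cq p by blast+
  have qq: "q * cnj q = of_nat p"
    using q by (simp add: complex_norm_square[symmetric] flip: of_real_power)
  define w where "w = sgn q"
  have w: "cmod w = 1" "sgn (cnj q) = cnj w"
    using q0 by (simp_all add: w_def norm_sgn) (simp add: sgn_eq)
  have cover: "gauss_of_norm (p * n) = (*) q ` gauss_of_norm n \<union> (*) (cnj q) ` gauss_of_norm n" for n
  proof -
    have "gauss_dvd q a \<or> gauss_dvd (cnj q) a" if a: "a \<in> gauss_of_norm (p * n)" for a
    proof -
      have ai: "a \<in> gauss_ints" using a by (simp add: gauss_of_norm_def)
      have "a * cnj a = of_nat p * of_nat n"
        using a by (simp add: gauss_of_norm_def complex_norm_square[symmetric] flip: of_real_power)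
      also have "\<dots> = q * (cnj q * of_nat n)"
        by (simp flip: qq)
      finally have "gauss_dvd q (a * cnj a)"
        unfolding gauss_dvd_def using cq by (blast intro: gauss_ints_closed gauss_ints_basic)
      then have "gauss_dvd q a \<or> gauss_dvd q (cnj a)"
        using gauss_irreducible_imp_prime[OF irr(1)] ai by (simp add: gauss_ints_closed)
      then show ?thesis
        using gauss_dvd_cnj[of q "cnj a"] by auto
    qed
    then have "gauss_of_norm (p * n) = {a \<in> gauss_of_norm (p * n). gauss_dvd q a}
        \<union> {a \<in> gauss_of_norm (p * n). gauss_dvd (cnj q) a}"
      by blast
    then show ?thesis
      unfolding gauss_of_norm_mult_iff[OF q p0] gauss_of_norm_mult_iff[OF cq p0] .
  qed
  show ?thesis
  proof (cases "gauss_dvd (cnj q) q")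
    case True
    then obtain u where u: "u \<in> gauss_ints" "q = cnj q * u"
      by (auto simp: gauss_dvd_def)
    have "cmod q = cmod q * cmod u"
      by (subst u(2)) (simp add: norm_mult)
    then have u1: "cmod u = 1" using q0 by simp
    have "u ^ 4 = 1"
      using gauss_unit_cases[OF u(1) u1] by (auto simp: power4_eq_xxxx)
    have "sgn u = u" using u1 by (simp add: sgn_eq)
    then have "w = cnj w * u"
      using w(2) unfolding w_def by (metis u(2) sgn_mult)
    then have "w ^ 2 = u"
      using gauss_unit_inverse[OF w(1)] by (metis mult.assoc mult.left_commute mult_1_right power2_eq_square)
    then have "w ^ 8 = u ^ 4"
      by (metis numeral_times_numeral power_mult semiring_norm(12) semiring_norm(13))
    then have w8: "w ^ 8 = 1"
      using \<open>u ^ 4 = 1\<close> by simp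
    have "(*) (cnj q) ` gauss_of_norm n \<subseteq> (*) q ` gauss_of_norm n" for n
    proof
      fix a assume "a \<in> (*) (cnj q) ` gauss_of_norm n"
      then obtain c where c: "c \<in> gauss_of_norm n" "a = cnj q * c" by auto
      have "a = q * (cnj u * c)"
        using c(2) u(2) gauss_unit_inverse[OF u1]
        by (metis mult.assoc mult.commute mult_1_right)
      moreover have "cnj u * c \<in> gauss_of_norm n"
        using c u u1 by (auto simp: gauss_of_norm_def norm_mult gauss_ints_closed)
      ultimately show "a \<in> (*) q ` gauss_of_norm n" by blast
    qed
    then have "gauss_of_norm (p * n) = (*) q ` gauss_of_norm n" for n
      using cover by blast
    then have "g k (p * n) = w ^ k * g k n" for k n
      by (simp add: g_eq_sum_sgn sum_sgn_mult_image[OF q0] w_def)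
    then have "hecke_params k p (w ^ k) 0" for k
      using w by (simp add: hecke_params_def norm_power)
    then show ?thesis using ramified w w8 by blast
  next
    case False
    have inter: "(*) q ` gauss_of_norm n \<inter> (*) (cnj q) ` gauss_of_norm n
        = {a \<in> gauss_of_norm (p * n). gauss_dvd (of_nat p) a}" for n
    proof -
      have "gauss_dvd q a \<and> gauss_dvd (cnj q) a \<longleftrightarrow> gauss_dvd (of_nat p) a" if "a \<in> gauss_ints" for a
      proof
        assume A: "gauss_dvd q a \<and> gauss_dvd (cnj q) a"
        then obtain c where c: "c \<in> gauss_ints" "a = q * c" by (auto simp: gauss_dvd_def)
        have "gauss_dvd (cnj q) q \<or> gauss_dvd (cnj q) c"
          using gauss_irreducible_imp_prime[OF irr(2) q(1) c(1)] A c by auto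
        with False obtain d where "d \<in> gauss_ints" "c = cnj q * d" by (auto simp: gauss_dvd_def)
        then have "a = of_nat p * d" using c by (simp flip: qq)
        then show "gauss_dvd (of_nat p) a" using \<open>d \<in> gauss_ints\<close> by (auto simp: gauss_dvd_def)
      next
        assume "gauss_dvd (of_nat p) a"
        then obtain c where c: "c \<in> gauss_ints" "a = of_nat p * c" by (auto simp: gauss_dvd_def)
        have "a = q * (cnj q * c)" "a = cnj q * (q * c)"
          using c by (auto simp flip: qq)
        then show "gauss_dvd q a \<and> gauss_dvd (cnj q) a"
          unfolding gauss_dvd_def using c q cq by (blast intro: gauss_ints_closed)
      qed
      then show ?thesis
        unfolding gauss_of_norm_mult_iff[OF q p0, symmetric] gauss_of_norm_mult_iff[OF cq p0, symmetric]
        by (auto simp: gauss_of_norm_def)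
    qed
    have "g k (p * n) = (w ^ k + cnj w ^ k) * g k n - (if p dvd n then g k (n div p) else 0)"
      if "n > 0" for k n
    proof -
      have "(\<Sum>a\<in>gauss_of_norm (p * n). sgn a ^ k) =
          (\<Sum>a\<in>(*) q ` gauss_of_norm n. sgn a ^ k) + (\<Sum>a\<in>(*) (cnj q) ` gauss_of_norm n. sgn a ^ k)
          - (\<Sum>a\<in>{a \<in> gauss_of_norm (p * n). gauss_dvd (of_nat p) a}. sgn a ^ k)"
        using sum_Un[of "(*) q ` gauss_of_norm n" "(*) (cnj q) ` gauss_of_norm n" "\<lambda>a. sgn a ^ k"]
        unfolding inter[of n] cover[of n, symmetric] by simp
      also have "(\<Sum>a\<in>(*) q ` gauss_of_norm n. sgn a ^ k) = 4 * (w ^ k * g k n)"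
        using q0 by (simp add: sum_sgn_mult_image g_eq_sum_sgn w_def)
      also have "(\<Sum>a\<in>(*) (cnj q) ` gauss_of_norm n. sgn a ^ k) = 4 * (cnj w ^ k * g k n)"
        using q0 w by (simp add: sum_sgn_mult_image g_eq_sum_sgn)
      also have "(\<Sum>a\<in>{a \<in> gauss_of_norm (p * n). gauss_dvd (of_nat p) a}. sgn a ^ k)
          = 4 * (if p dvd n then g k (n div p) else 0)"
        using sum_gauss_dvd_prime[OF p that, of k] by simp
      finally show ?thesis
        unfolding g_eq_sum_sgn[of k "p * n"] by (simp add: field_simps)
    qed
    moreover have "w ^ k * cnj w ^ k = 1" for k
      using gauss_unit_inverse[OF w(1)] by (simp flip: power_mult_distrib)
    ultimately have "hecke_params k p (w ^ k) (cnj w ^ k)" for k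
      using w by (simp add: hecke_params_def norm_power)
    then show ?thesis using split w by blast
  qed
qed

text \<open>
  Multiplication by \<open>\<i>\<close> permutes the elements of norm \<open>n\<close>.
\<close>

lemma g_eq_0:
  assumes "\<not> 4 dvd h"
  shows "g h n = 0"
proof -
  have "(*) \<i> ` gauss_of_norm n = gauss_of_norm n"
  proof (intro equalityI subsetI)
    fix a assume "a \<in> gauss_of_norm n"
    then have "-\<i> * a \<in> gauss_of_norm n"
      by (auto simp: gauss_of_norm_def norm_mult gauss_ints_iff)
    moreover have "a = \<i> * (-\<i> * a)" by simp
    ultimately show "a \<in> (*) \<i> ` gauss_of_norm n" by blast
  qed (auto simp: gauss_of_norm_def norm_mult gauss_ints_closed)
  then have "g h n = \<i> ^ h * g h n"
    using sum_sgn_mult_image[of \<i> h "gauss_of_norm n"] by (simp add: g_eq_sum_sgn sgn_eq)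
  moreover have "\<i> ^ h \<noteq> 1"
  proof -
    have "h = 4 * (h div 4) + h mod 4" by simp
    then have "\<i> ^ h = (\<i> ^ 4) ^ (h div 4) * \<i> ^ (h mod 4)"
      by (metis power_add power_mult)
    also have "\<i> ^ 4 = 1" by (simp add: power4_eq_xxxx)
    finally have e: "\<i> ^ h = \<i> ^ (h mod 4)" by simp
    have "h mod 4 \<noteq> 0" using assms by presburger
    moreover have "h mod 4 < 4" by simp
    ultimately have "h mod 4 = 1 \<or> h mod 4 = 2 \<or> h mod 4 = 3" by linarith
    then show ?thesis
      unfolding e by (auto simp: power3_eq_cube complex_eq_iff)
  qed
  ultimately show ?thesis by simp
qed

lemma i_power_4_dvd: "4 dvd k \<Longrightarrow> \<i> ^ k = 1"
  by (auto simp: power_mult power4_eq_xxxx)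

lemma gauss_of_norm_1: "gauss_of_norm 1 = {1, -1, \<i>, -\<i>}"
proof -
  have "cmod u = 1 \<longleftrightarrow> (cmod u)\<^sup>2 = 1" for u
    using norm_not_minus_one[of u] by (auto simp: power2_eq_1_iff)
  then show ?thesis
    using gauss_unit_cases by (auto simp: gauss_of_norm_def gauss_ints_iff)
qed

lemma g_1:
  assumes "4 dvd k"
  shows "g k (Suc 0) = 1"
proof -
  have k: "even k" using assms by presburger
  have "sgn \<i> = \<i>" by (simp add: sgn_eq)
  have "even (k div 2)" using assms by presburger
  then have "(- 1 :: complex) ^ (k div 2) = 1" by simp
  have "(\<Sum>a\<in>gauss_of_norm 1. sgn a ^ k) = 4"
    unfolding gauss_of_norm_1 using \<open>sgn \<i> = \<i>\<close> k assms \<open>(- 1 :: complex) ^ (k div 2) = 1\<close>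
    by (simp add: complex_eq_iff[of 1] complex_eq_iff[of "-1"] complex_eq_iff[of "\<i>"] sgn_minus i_power_4_dvd)
  then show ?thesis by (simp add: g_eq_sum_sgn)
qed

lemma hecke_params_ex:
  assumes "prime p"
  obtains a b where "hecke_params k p a b"
  using assms by (elim hecke_params_cases) blast+

lemma hecke_relation:
  assumes "hecke_params k p a b" "n > 0"
  shows "g k (p * n) = (a + b) * g k n - a * b * (if p dvd n then g k (n div p) else 0)"
  using assms by (simp add: hecke_params_def)

lemma hecke_relation_Suc_Suc:
  assumes "hecke_params k p a b" "m > 0" "p > 0"
  shows "g k (p ^ Suc (Suc j) * m) = (a + b) * g k (p ^ Suc j * m) - a * b * g k (p ^ j * m)"
proof -
  have "g k (p * (p * (p ^ j * m))) = (a + b) * g k (p * (p ^ j * m)) - a * b * g k (p ^ j * m)"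
    by (subst hecke_relation[OF assms(1)]) (use assms in auto)
  then show ?thesis by (simp add: mult.assoc)
qed

lemma hecke_relation_coprime:
  assumes "hecke_params k p a b" "m > 0" "\<not> p dvd m"
  shows "g k (p * m) = (a + b) * g k m"
  using hecke_relation[OF assms(1,2)] assms(3) by simp

lemma g_prime_eq:
  assumes "hecke_params k p a b" "4 dvd k" "prime p"
  shows "g k p = a + b"
proof -
  have "\<not> p dvd 1" using prime_gt_1_nat[OF assms(3)] by simp
  then show ?thesis
    using hecke_relation_coprime[OF assms(1), of 1] g_1[OF assms(2)] by simp
qed

text \<open>
  Both sides satisfy the same two-term recurrence in \<open>j\<close>.
\<close>

lemma g_prime_power_mult:
  assumes "prime p" "4 dvd k" "m > 0" "\<not> p dvd m"
  shows "g k (p ^ j * m) = g k (p ^ j) * g k m"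
proof -
  obtain a b where h: "hecke_params k p a b"
    using hecke_params_ex assms(1) by blast
  have p0: "p > 0" using assms(1) prime_gt_0_nat by blast
  have "g k (p ^ j * m) = g k (p ^ j) * g k m \<and> g k (p ^ Suc j * m) = g k (p ^ Suc j) * g k m"
  proof (induction j)
    case 0
    then show ?case
      using g_1[OF assms(2)] hecke_relation_coprime[OF h assms(3,4)] g_prime_eq[OF h assms(2,1)] by simp
  next
    case (Suc j)
    have "g k (p ^ Suc (Suc j) * m) = ((a + b) * g k (p ^ Suc j) - a * b * g k (p ^ j)) * g k m"
      using Suc.IH by (subst hecke_relation_Suc_Suc[OF h assms(3) p0]) (simp add: algebra_simps)
    then show ?case
      using Suc.IH hecke_relation_Suc_Suc[OF h _ p0, of 1] by simp
  qed
  then show ?thesis ..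
qed

text \<open>
  The recurrence is solved by \<open>g k (p ^ j) = (\<Sum>i\<le>j. a ^ i * b ^ (j - i))\<close>, a sum of
  \<open>j + 1\<close> terms of modulus at most 1.
\<close>

lemma g_prime_power_bound:
  assumes "prime p" "4 dvd k"
  shows "cmod (g k (p ^ j)) \<le> real (Suc j)"
proof -
  obtain a b where h: "hecke_params k p a b"
    using hecke_params_ex assms(1) by blast
  have ab: "cmod a \<le> 1" "cmod b \<le> 1" using h by (auto simp: hecke_params_def)
  have p0: "p > 0" using assms(1) prime_gt_0_nat by blast
  have rec: "g k (p ^ Suc j) = a * g k (p ^ j) + b ^ Suc j" for j
  proof (induction j)
    case 0
    then show ?case using g_1[OF assms(2)] g_prime_eq[OF h assms(2,1)] by simp
  next
    case (Suc j)
    have "g k (p ^ Suc (Suc j)) = (a + b) * g k (p ^ Suc j) - a * b * g k (p ^ j)"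
      using hecke_relation_Suc_Suc[OF h _ p0, of 1 j] by simp
    also have "\<dots> = a * g k (p ^ Suc j) + b * (g k (p ^ Suc j) - a * g k (p ^ j))"
      by (simp add: algebra_simps)
    also have "\<dots> = a * g k (p ^ Suc j) + b ^ Suc (Suc j)"
      unfolding Suc.IH by (simp add: algebra_simps)
    finally show ?case .
  qed
  show ?thesis
  proof (induction j)
    case 0
    then show ?case using g_1[OF assms(2)] by simp
  next
    case (Suc j)
    have "cmod (g k (p ^ Suc j)) \<le> cmod a * cmod (g k (p ^ j)) + cmod (b ^ Suc j)"
      unfolding rec norm_mult[symmetric] by (rule norm_triangle_ineq)
    also have "\<dots> \<le> 1 * real (Suc j) + 1"
      using Suc.IH ab by (intro add_mono mult_mono) (auto simp: norm_power simp del: power_Suc intro!: power_le_one)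
    finally show ?case by simp
  qed
qed

lemma g_mult_coprime:
  assumes "4 dvd k" "coprime m n" "m > 0" "n > 0"
  shows "g k (m * n) = g k m * g k n"
  using assms(2,3)
proof (induction m rule: less_induct)
  case (less m)
  show ?case
  proof (cases "m = 1")
    case True
    then show ?thesis using g_1[OF assms(1)] by simp
  next
    case False
    then obtain p where p: "prime p" "p dvd m"
      using prime_factor_nat by blast
    define j where "j = multiplicity p m"
    obtain m' where m': "m = p ^ j * m'" "\<not> p dvd m'"
      using multiplicity_decompose'[of m p] p less.prems
      by (metis j_def neq0_conv not_prime_unit)
    have "m' > 0" using less.prems m' by (cases m') auto
    have "j > 0" using m' p by (cases j) auto
    have "m' < m"
      using m'(1) \<open>m' > 0\<close> \<open>j > 0\<close> prime_gt_1_nat[OF p(1)]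
      by (metis mult_less_cancel2 mult_1 one_less_power)
    have "coprime m' n" "coprime p n"
      using less.prems(1) \<open>j > 0\<close> unfolding m'(1) by (simp_all)
    then have "\<not> p dvd m' * n"
      using m'(2) p(1) by (simp add: coprime_dvd_mult_left_iff)
    then have "g k (p ^ j * (m' * n)) = g k (p ^ j) * g k (m' * n)"
      using p(1) assms \<open>m' > 0\<close> by (intro g_prime_power_mult) auto
    also have "g k (m' * n) = g k m' * g k n"
      by (rule less.IH) fact+
    also have "g k (p ^ j) * (g k m' * g k n) = g k m * g k n"
      using g_prime_power_mult[OF p(1) assms(1) \<open>m' > 0\<close> m'(2), of j] m'(1) by simp
    finally show ?thesis by (simp add: m'(1) mult.assoc)
  qed
qed

text \<open>
  In the split case \<open>f h p = 2\<bar>x\<bar>\<close> and \<open>g (2 * h) p = 2 (2 x\<^sup>2 - 1)\<close>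
  with \<open>x = cos (h \<theta>)\<close>, and the claim is \<open>2\<bar>x\<bar> \<le> 1 + x\<^sup>2\<close>.
  On the right only the mean value \<open>3/4 g 0 p\<close> survives summation over \<open>p\<close>.
\<close>

lemma f_prime_le:
  assumes "prime p" "4 dvd h"
  shows "f h p \<le> 3/4 * Re (g 0 p) + 1/4 * Re (g (2 * h) p)"
proof -
  have h2: "4 dvd 2 * h" using assms(2) by simp
  from assms(1) show ?thesis
  proof (cases rule: hecke_params_cases)
    case (split w)
    define x where "x = Re (w ^ h)"
    define y where "y = Im (w ^ h)"
    have xy: "x\<^sup>2 + y\<^sup>2 = 1"
      using split(1) by (simp add: x_def y_def norm_power flip: cmod_power2)
    have w: "w ^ h = Complex x y" by (simp add: x_def y_def)
    have 1: "g h p = of_real (2 * x)"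
      using g_prime_eq[OF split(2) assms(2,1)] w by (simp add: complex_eq_iff flip: complex_cnj_power)
    have 2: "g 0 p = 2"
      using g_prime_eq[OF split(2) _ assms(1), of 0] by simp
    have "w ^ (2 * h) = Complex x y ^ 2"
      by (simp add: power_mult mult.commute[of 2] w)
    then have 3: "Re (g (2 * h) p) = 2 * (x\<^sup>2 - y\<^sup>2)"
      using g_prime_eq[OF split(2) h2 assms(1)] by (simp add: power2_eq_square flip: complex_cnj_power)
    have "2 * \<bar>x\<bar> \<le> 1 + x\<^sup>2"
      using zero_le_power2[of "\<bar>x\<bar> - 1"] by (simp add: power2_eq_square algebra_simps)
    then show ?thesis
      using xy unfolding f_def 1 2 3 by (simp add: norm_mult field_simps)
  next
    case (ramified w)
    have "8 dvd 2 * h" using assms(2) by presburger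
    then have "w ^ (2 * h) = 1"
      using ramified(2) by (auto elim!: dvdE simp: power_mult)
    then show ?thesis
      using g_prime_eq[OF ramified(3) assms(2,1)] g_prime_eq[OF ramified(3) h2 assms(1)]
        g_prime_eq[OF ramified(3) _ assms(1), of 0] ramified(1)
      by (simp add: f_def norm_power)
  next
    case inert
    then show ?thesis
      using g_prime_eq[OF inert assms(2,1)] g_prime_eq[OF inert h2 assms(1)]
        g_prime_eq[OF inert _ assms(1), of 0] by (simp add: f_def)
  qed
qed

lemma g_0_eq: "g 0 n = of_real (real (card (gauss_of_norm n)) / 4)"
  by (simp add: g_eq_sum_sgn)

lemma cmod_g_le: "cmod (g k n) \<le> card (gauss_of_norm n) / 4"
proof -
  have "cmod (\<Sum>a\<in>gauss_of_norm n. sgn a ^ k) \<le> (\<Sum>a\<in>gauss_of_norm n. 1)"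
    by (rule sum_norm_le) (simp add: norm_power norm_sgn power_le_one)
  then show ?thesis by (simp add: g_eq_sum_sgn norm_divide)
qed

text \<open>
  A solution of \<open>a\<^sup>2 + b\<^sup>2 = n\<close> is determined by \<open>a\<close> and the sign of
  \<open>b\<close>.
\<close>

lemma f_le_sqrt:
  assumes "n > 0"
  shows "f h n \<le> 2 * sqrt n"
proof -
  define r where "r = \<lfloor>sqrt n\<rfloor>"
  have s1: "sqrt (real n) \<ge> 1" using assms by simp
  have "gauss_of_norm n \<subseteq> (\<lambda>(a, e). Complex (of_int a) (e * sqrt (real n - (of_int a)\<^sup>2))) ` ({-r..r} \<times> {-1, 1})"
  proof
    fix z assume "z \<in> gauss_of_norm n"
    then obtain a b :: int where z: "z = Complex (of_int a) (of_int b)" "(real_of_int a)\<^sup>2 + (real_of_int b)\<^sup>2 = n"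
      by (auto simp: gauss_of_norm_def gauss_ints_def cmod_power2)
    then have "n - (real_of_int a)\<^sup>2 = (real_of_int b)\<^sup>2" by simp
    then have b: "sqrt (real n - (of_int a)\<^sup>2) = \<bar>real_of_int b\<bar>"
      by (simp only: real_sqrt_abs)
    have "\<bar>real_of_int a\<bar> \<le> sqrt n"
      by (rule real_le_rsqrt) (simp flip: z(2))
    then have "a \<le> r" "- a \<le> r"
      by (auto simp: r_def le_floor_iff)
    then have "a \<in> {-r..r}" by auto
    moreover have "z = Complex (of_int a) ((if b < 0 then -1 else 1) * sqrt (real n - (of_int a)\<^sup>2))"
      unfolding b by (simp add: z)
    ultimately show "z \<in> (\<lambda>(a, e). Complex (of_int a) (e * sqrt (real n - (of_int a)\<^sup>2))) ` ({-r..r} \<times> {-1, 1})"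
      by (intro image_eqI[of _ _ "(a, if b < 0 then -1 else 1)"]) auto
  qed
  then have "card (gauss_of_norm n) \<le> card ((\<lambda>(a, e). Complex (of_int a) (e * sqrt (real n - (of_int a)\<^sup>2))) ` ({-r..r} \<times> {-1, 1::real}))"
    by (intro card_mono) auto
  also have "\<dots> \<le> card ({-r..r} \<times> {-1, 1::real})"
    by (rule card_image_le) auto
  also have "\<dots> = 2 * nat (2 * r + 1)"
    by (simp add: card_cartesian_product)
  finally have "real (card (gauss_of_norm n)) \<le> real (2 * nat (2 * r + 1))"
    by (rule of_nat_mono)
  also have "r \<ge> 0" by (simp add: r_def)
  then have "real (2 * nat (2 * r + 1)) = 2 * (2 * of_int r + 1)" by simp
  also have "\<dots> \<le> 2 * (2 * sqrt n + 1)"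
    by (simp add: r_def)
  also have "\<dots> \<le> 8 * sqrt n"
  proof -
    have "2 * (2 * x + 1) \<le> 8 * x" if "x \<ge> 1" for x :: real using that by simp
    then show ?thesis using s1 by blast
  qed
  finally show ?thesis
    using cmod_g_le[of h n] by (simp add: f_def)
qed

text \<open>
  The elements of norm up to \<open>Y\<close> lie in a square of side \<open>2 \<surd>Y\<close>.
\<close>

lemma sum_f_le:
  assumes "Y \<ge> 1"
  shows "(\<Sum>n | 0 < n \<and> real n \<le> Y. f h n) \<le> 3 * Y"
proof -
  let ?I = "{n. 0 < n \<and> real n \<le> Y}"
  define r where "r = \<lfloor>sqrt Y\<rfloor>"
  have "?I \<subseteq> {..nat \<lfloor>Y\<rfloor>}" by (auto simp: le_nat_floor)
  then have fin: "finite ?I" by (rule finite_subset) simp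
  have "(\<Sum>n\<in>?I. f h n) \<le> (\<Sum>n\<in>?I. real (card (gauss_of_norm n))) / 4"
    unfolding sum_divide_distrib f_def by (rule sum_mono) (rule cmod_g_le)
  also have "(\<Sum>n\<in>?I. real (card (gauss_of_norm n))) = real (card (\<Union>n\<in>?I. gauss_of_norm n))"
  proof (subst card_UN_disjoint)
    show "\<forall>i\<in>?I. \<forall>j\<in>?I. i \<noteq> j \<longrightarrow> gauss_of_norm i \<inter> gauss_of_norm j = {}"
      by (auto simp: gauss_of_norm_def)
  qed (use fin in auto)
  also have "card (\<Union>n\<in>?I. gauss_of_norm n) \<le> card ((\<lambda>(a, b). Complex (of_int a) (of_int b)) ` ({-r..r} \<times> {-r..r}))"
  proof (intro card_mono subsetI)
    fix z assume "z \<in> (\<Union>n\<in>?I. gauss_of_norm n)"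
    then obtain n and a b :: int where z: "real n \<le> Y" "z = Complex (of_int a) (of_int b)"
       "(real_of_int a)\<^sup>2 + (real_of_int b)\<^sup>2 = n"
      by (auto simp: gauss_of_norm_def gauss_ints_def cmod_power2)
    have "\<bar>real_of_int a\<bar> \<le> sqrt Y" "\<bar>real_of_int b\<bar> \<le> sqrt Y"
    proof (safe intro!: real_le_rsqrt)
      show "\<bar>real_of_int a\<bar>\<^sup>2 \<le> Y" "\<bar>real_of_int b\<bar>\<^sup>2 \<le> Y"
        using z zero_le_power2[of "real_of_int a"] zero_le_power2[of "real_of_int b"]
        unfolding power2_abs by linarith+
    qed
    then have "a \<le> r" "- a \<le> r" "b \<le> r" "- b \<le> r"
      by (auto simp: r_def le_floor_iff)
    then show "z \<in> (\<lambda>(a, b). Complex (of_int a) (of_int b)) ` ({-r..r} \<times> {-r..r})"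
      using z(2) by (intro image_eqI[of _ _ "(a, b)"]) auto
  qed auto
  also have "\<dots> \<le> card ({-r..r} \<times> {-r..r})"
    by (rule card_image_le) auto
  also have "\<dots> = (nat (2 * r + 1))\<^sup>2"
    by (simp add: card_cartesian_product power2_eq_square)
  also have "real \<dots> = (2 * of_int r + 1)\<^sup>2"
    using assms by (simp add: r_def)
  also have "\<dots> \<le> (2 * sqrt Y + sqrt Y)\<^sup>2"
    using assms by (intro power_mono add_mono) (auto simp: r_def)
  also have "\<dots> = 9 * Y"
    using assms by (simp add: power2_eq_square algebra_simps)
  finally show ?thesis using assms by simp
qed

section \<open>The L-series near the point 1\<close>

text \<open>
  A fundamental domain for multiplication by units. It is bounded by the diagonals, not by the axes, so that the
  elements with a given real part form one side of a square.
\<close>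

definition wedge :: "complex set" where
  "wedge = {z. Re z > 0 \<and> - Re z \<le> Im z \<and> Im z < Re z}"

lemma sum_sgn_wedge:
  assumes "4 dvd k" "n > 0"
  shows "(\<Sum>a\<in>gauss_of_norm n. sgn a ^ k) = 4 * (\<Sum>a\<in>gauss_of_norm n \<inter> wedge. sgn a ^ k)"
proof -
  let ?S = "gauss_of_norm n"
  define W where "W = ?S \<inter> wedge"
  have rot: "u * z \<in> ?S" if "z \<in> ?S" "u \<in> gauss_ints" "cmod u = 1" for u z
    using that by (auto simp: gauss_of_norm_def norm_mult gauss_ints_closed)
  have im: "{z \<in> ?S. cnj u * z \<in> wedge} = (*) u ` W" if u: "u \<in> gauss_ints" "cmod u = 1" for u
  proof (intro equalityI subsetI)
    fix z assume "z \<in> {z \<in> ?S. cnj u * z \<in> wedge}"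
    then have "cnj u * z \<in> W" using rot[of z "cnj u"] u by (auto simp: W_def gauss_ints_closed)
    moreover have "z = u * (cnj u * z)"
      using gauss_unit_inverse[OF u(2)] by (metis mult.assoc mult_1)
    ultimately show "z \<in> (*) u ` W" by blast
  next
    fix z assume "z \<in> (*) u ` W"
    then obtain y where y: "y \<in> W" "z = u * y" by blast
    have "cnj u * z = y"
      using gauss_unit_inverse[OF u(2)] y by (metis mult.assoc mult.commute mult_1)
    moreover have "z \<in> ?S"
      using y rot[of y u] u by (simp add: W_def)
    ultimately show "z \<in> {z \<in> ?S. cnj u * z \<in> wedge}"
      using y(1) by (simp add: W_def)
  qed
  have part: "?S = (*) 1 ` W \<union> (*) \<i> ` W \<union> (*) (-1) ` W \<union> (*) (-\<i>) ` W"
  proof -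
    have "z \<in> wedge \<or> cnj \<i> * z \<in> wedge \<or> cnj (-1) * z \<in> wedge \<or> cnj (-\<i>) * z \<in> wedge" if "z \<in> ?S" for z
    proof -
      have "z \<noteq> 0" using that assms(2) by (auto simp: gauss_of_norm_def)
      then have "Re z \<noteq> 0 \<or> Im z \<noteq> 0" by (auto simp: complex_eq_iff)
      then show ?thesis by (simp add: wedge_def) linarith
    qed
    then have "?S = {z \<in> ?S. cnj 1 * z \<in> wedge} \<union> {z \<in> ?S. cnj \<i> * z \<in> wedge}
        \<union> {z \<in> ?S. cnj (-1) * z \<in> wedge} \<union> {z \<in> ?S. cnj (-\<i>) * z \<in> wedge}"
      by auto
    also have "\<dots> = (*) 1 ` W \<union> (*) \<i> ` W \<union> (*) (-1) ` W \<union> (*) (-\<i>) ` W"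
      by (subst (1 2 3 4) im) (simp_all add: gauss_ints_iff)
    finally show ?thesis .
  qed
  have disj: "(*) 1 ` W \<inter> (*) \<i> ` W = {}" "((*) 1 ` W \<union> (*) \<i> ` W) \<inter> (*) (-1) ` W = {}"
    "((*) 1 ` W \<union> (*) \<i> ` W \<union> (*) (-1) ` W) \<inter> (*) (-\<i>) ` W = {}"
    by (auto simp: W_def wedge_def complex_eq_iff)
  have fin: "finite W" by (simp add: W_def)
  have "even k" using assms by presburger
  have sg: "sgn \<i> ^ k = 1" "sgn (-\<i>) ^ k = 1" "sgn (-1 :: complex) ^ k = 1"
    using \<open>even k\<close> by (simp_all add: sgn_eq i_power_4_dvd[OF assms(1)])
  have "(\<Sum>a\<in>?S. sgn a ^ k) = (\<Sum>a\<in>(*) 1 ` W. sgn a ^ k) + (\<Sum>a\<in>(*) \<i> ` W. sgn a ^ k)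
      + (\<Sum>a\<in>(*) (-1) ` W. sgn a ^ k) + (\<Sum>a\<in>(*) (-\<i>) ` W. sgn a ^ k)"
    using fin disj unfolding part by (simp only: sum.union_disjoint finite_Un finite_imageI)
  also have "\<dots> = 4 * (\<Sum>a\<in>W. sgn a ^ k)"
  proof -
    have "(\<Sum>a\<in>(*) u ` W. sgn a ^ k) = (\<Sum>a\<in>W. sgn a ^ k)" if "u \<noteq> 0" "sgn u ^ k = 1" for u
      using sum_sgn_mult_image[OF that(1), of k W] that(2) by simp
    from this[of 1] this[of \<i>] this[of "-1"] this[of "-\<i>"] sg show ?thesis
      by (simp del: mult_1)
  qed
  finally show ?thesis by (simp add: W_def)
qed

text \<open>
  The points \<open>m + \<i> j\<close> with \<open>-m \<le> j < m\<close>, numbered by \<open>i = j + m\<close>.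
  The excluded end point \<open>i = 2 * m\<close> is \<open>\<i>\<close> times the first one.
\<close>

definition wedge_point :: "nat \<Rightarrow> nat \<Rightarrow> complex" where
  "wedge_point m i = Complex (of_nat m) (of_nat i - of_nat m)"

definition wedge_index :: "(nat \<times> nat) set" where
  "wedge_index = (SIGMA m:UNIV. {..<2 * m})"

definition wedge_term :: "nat \<Rightarrow> real \<Rightarrow> nat \<times> nat \<Rightarrow> complex" where
  "wedge_term k \<sigma> = (\<lambda>(m, i). sgn (wedge_point m i) ^ k * of_real ((cmod (wedge_point m i))\<^sup>2 powr - \<sigma>))"

lemma wedge_point_bij:
  "bij_betw (case_prod wedge_point) {z \<in> wedge_index. (cmod (case_prod wedge_point z))\<^sup>2 = of_nat n}
     (gauss_of_norm n \<inter> wedge)"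
  unfolding bij_betw_def
proof (intro conjI equalityI subsetI)
  show "inj_on (case_prod wedge_point) {z \<in> wedge_index. (cmod (case_prod wedge_point z))\<^sup>2 = of_nat n}"
    by (auto simp: inj_on_def wedge_point_def)
next
  fix z assume "z \<in> case_prod wedge_point ` {z \<in> wedge_index. (cmod (case_prod wedge_point z))\<^sup>2 = of_nat n}"
  then show "z \<in> gauss_of_norm n \<inter> wedge"
    by (auto simp: gauss_of_norm_def wedge_point_def gauss_ints_iff wedge_def wedge_index_def)
next
  fix z assume z: "z \<in> gauss_of_norm n \<inter> wedge"
  then obtain a b :: int where ab: "z = Complex (of_int a) (of_int b)"
    by (auto simp: gauss_of_norm_def gauss_ints_def)
  have ab0: "a > 0" "- a \<le> b" "b < a"
    using z by (auto simp: ab wedge_def)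
  have "z = case_prod wedge_point (nat a, nat (b + a))"
    using ab0 by (simp add: ab wedge_point_def)
  moreover have "(nat a, nat (b + a)) \<in> wedge_index"
    using ab0 by (simp add: wedge_index_def)
  ultimately show "z \<in> case_prod wedge_point ` {z \<in> wedge_index. (cmod (case_prod wedge_point z))\<^sup>2 = of_nat n}"
    using z by (intro image_eqI) (auto simp: gauss_of_norm_def)
qed

lemma sum_wedge_term_norm:
  assumes "4 dvd k"
  shows "(\<Sum>z | z \<in> wedge_index \<and> (cmod (case_prod wedge_point z))\<^sup>2 = of_nat n. wedge_term k \<sigma> z)
           = g k n * of_real (real n powr - \<sigma>)"
proof (cases "n = 0")
  case True
  then show ?thesis
    by (auto intro!: sum.neutral simp: wedge_term_def)
next
  case False
  have "(\<Sum>z | z \<in> wedge_index \<and> (cmod (case_prod wedge_point z))\<^sup>2 = of_nat n. wedge_term k \<sigma> z)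
     = (\<Sum>z | z \<in> wedge_index \<and> (cmod (case_prod wedge_point z))\<^sup>2 = of_nat n.
          sgn (case_prod wedge_point z) ^ k * of_real (real n powr - \<sigma>))"
    by (rule sum.cong) (auto simp: wedge_term_def)
  also have "\<dots> = (\<Sum>a\<in>gauss_of_norm n \<inter> wedge. sgn a ^ k * of_real (real n powr - \<sigma>))"
    by (rule sum.reindex_bij_betw[OF wedge_point_bij])
  also have "\<dots> = g k n * of_real (real n powr - \<sigma>)"
    using sum_sgn_wedge[OF assms, of n] False by (simp add: g_eq_sum_sgn sum_distrib_right)
  finally show ?thesis .
qed

lemma wedge_point_norm:
  assumes "i < 2 * m"
  shows "real m ^ 2 \<le> (cmod (wedge_point m i))\<^sup>2" "(cmod (wedge_point m i))\<^sup>2 \<le> 2 * real m ^ 2"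
proof -
  have "\<bar>real i - real m\<bar> \<le> real m" using assms by linarith
  then have "(real i - real m)\<^sup>2 \<le> real m ^ 2"
    by (simp add: abs_le_square_iff[symmetric])
  then show "real m ^ 2 \<le> (cmod (wedge_point m i))\<^sup>2" "(cmod (wedge_point m i))\<^sup>2 \<le> 2 * real m ^ 2"
    by (auto simp: wedge_point_def cmod_power2)
qed

lemma norm_wedge_term_le:
  assumes "i < 2 * m" "\<sigma> > 0"
  shows "cmod (wedge_term k \<sigma> (m, i)) \<le> real m powr (- 2 * \<sigma>)"
proof -
  have m: "m > 0" using assms by auto
  have w0: "(cmod (wedge_point m i))\<^sup>2 > 0"
    using wedge_point_norm(1)[OF assms(1)] m by (smt (verit) of_nat_0_less_iff zero_less_power)
  have "cmod (wedge_term k \<sigma> (m, i)) \<le> 1 * ((cmod (wedge_point m i))\<^sup>2 powr - \<sigma>)"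
    unfolding wedge_term_def case_prod_conv norm_mult
    by (intro mult_mono) (auto simp: norm_power norm_sgn power_le_one)
  also have "\<dots> \<le> (real m ^ 2) powr - \<sigma>"
    using wedge_point_norm(1)[OF assms(1)] m assms by (auto intro!: powr_mono2')
  also have "\<dots> = real m powr (- 2 * \<sigma>)"
    using m by (simp add: powr_powr flip: powr_numeral)
  finally show ?thesis .
qed

lemma sum_norm_wedge_shell:
  assumes "\<sigma> > 0"
  shows "(\<Sum>i<2*m. cmod (wedge_term k \<sigma> (m, i))) \<le> 2 * real m powr (1 - 2 * \<sigma>)"
proof (cases "m = 0")
  case False
  have "(\<Sum>i<2*m. cmod (wedge_term k \<sigma> (m, i))) \<le> (\<Sum>i<2*m. real m powr (- 2 * \<sigma>))"
    by (rule sum_mono) (use norm_wedge_term_le assms in auto)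
  also have "\<dots> = 2 * (real m powr 1 * real m powr (- 2 * \<sigma>))"
    using False by simp
  also have "real m powr 1 * real m powr (- 2 * \<sigma>) = real m powr (1 - 2 * \<sigma>)"
    unfolding powr_add[symmetric] by simp
  finally show ?thesis .
qed auto

lemma wedge_term_summable:
  assumes "\<sigma> > 1"
  shows "(\<lambda>z. norm (wedge_term k \<sigma> z)) summable_on wedge_index"
  unfolding wedge_index_def Infinite_Sum.abs_summable_on_Sigma_iff[where f = "wedge_term k \<sigma>"]
proof (intro conjI ballI)
  have "summable (\<lambda>m. 2 * real m powr (1 - 2 * \<sigma>))"
    using assms by (intro summable_mult) (simp add: summable_real_powr_iff)
  then have "(\<lambda>m. 2 * real m powr (1 - 2 * \<sigma>)) summable_on UNIV"
    by (intro norm_summable_imp_summable_on) simp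
  then show "(\<lambda>m. norm (\<Sum>\<^sub>\<infinity>i\<in>{..<2*m}. norm (wedge_term k \<sigma> (m, i)))) summable_on UNIV"
    by (rule summable_on_comparison_test) (use sum_norm_wedge_shell[of \<sigma>] assms in \<open>auto simp: sum_nonneg\<close>)
qed auto

definition L_series :: "nat \<Rightarrow> real \<Rightarrow> complex" where
  "L_series k \<sigma> = (\<Sum>\<^sub>\<infinity>n. g k n * of_real (real n powr - \<sigma>))"

definition shell :: "nat \<Rightarrow> real \<Rightarrow> nat \<Rightarrow> complex" where
  "shell k \<sigma> m = (\<Sum>i<2*m. wedge_term k \<sigma> (m, i))"

text \<open>
  The absolutely convergent sum over the fundamental domain is arranged in two ways: by the norm, which gives
  the L-series, and by the real part, which gives the shells.
\<close>

lemma
  assumes "4 dvd k" "\<sigma> > 1"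
  shows L_series_summable: "(\<lambda>n. g k n * of_real (real n powr - \<sigma>)) summable_on UNIV"
    and L_series_shells: "shell k \<sigma> sums L_series k \<sigma>"
proof -
  define B where "B = (\<lambda>n. {z \<in> wedge_index. (cmod (case_prod wedge_point z))\<^sup>2 = real n})"
  have fin: "finite (B n)" for n
    using bij_betw_finite[OF wedge_point_bij[of n]] by (simp add: B_def)
  have bij: "bij_betw snd (Sigma UNIV B) wedge_index"
    unfolding bij_betw_def
  proof (intro conjI equalityI subsetI)
    show "inj_on snd (Sigma UNIV B)" by (auto simp: inj_on_def B_def)
    fix z assume z: "z \<in> wedge_index"
    obtain n where "(cmod (case_prod wedge_point z))\<^sup>2 = real n"
      by (rule gauss_norm_nat[of "case_prod wedge_point z"]) (auto simp: gauss_ints_iff wedge_point_def split: prod.split)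
    then show "z \<in> snd ` Sigma UNIV B" using z by (intro image_eqI[of _ _ "(n, z)"]) (auto simp: B_def)
  qed (auto simp: B_def)
  have s: "wedge_term k \<sigma> summable_on wedge_index"
    using wedge_term_summable[OF assms(2)] by (rule abs_summable_summable)
  then have s': "(\<lambda>z. wedge_term k \<sigma> (snd z)) summable_on Sigma UNIV B"
    by (subst summable_on_reindex_bij_betw[OF bij])
  have eq: "(\<Sum>\<^sub>\<infinity>z\<in>B n. wedge_term k \<sigma> z) = g k n * of_real (real n powr - \<sigma>)" for n
    using sum_wedge_term_norm[OF assms(1)] fin[of n] by (simp add: B_def)
  show "(\<lambda>n. g k n * of_real (real n powr - \<sigma>)) summable_on UNIV"
    using summable_on_Sigma_banach[of "\<lambda>n z. wedge_term k \<sigma> z" UNIV B] s' by (simp add: eq case_prod_unfold)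
  have "L_series k \<sigma> = (\<Sum>\<^sub>\<infinity>z\<in>Sigma UNIV B. wedge_term k \<sigma> (snd z))"
    using infsum_Sigma_banach[OF s'] by (simp add: eq L_series_def)
  also have "\<dots> = infsum (wedge_term k \<sigma>) wedge_index"
    by (rule infsum_reindex_bij_betw[OF bij])
  finally have L: "L_series k \<sigma> = infsum (wedge_term k \<sigma>) (Sigma UNIV (\<lambda>m. {..<2*m}))"
    by (simp add: wedge_index_def)
  have "(\<lambda>m. \<Sum>\<^sub>\<infinity>i\<in>{..<2*m}. wedge_term k \<sigma> (m, i)) summable_on UNIV"
    using summable_on_Sigma_banach[of "\<lambda>m i. wedge_term k \<sigma> (m, i)" UNIV "\<lambda>m. {..<2*m}"] s
    by (simp add: wedge_index_def)
  moreover have "(\<Sum>\<^sub>\<infinity>m. \<Sum>\<^sub>\<infinity>i\<in>{..<2*m}. wedge_term k \<sigma> (m, i)) = L_series k \<sigma>"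
    unfolding L by (rule infsum_Sigma_banach) (use s in \<open>simp add: wedge_index_def\<close>)
  ultimately have "(shell k \<sigma> has_sum L_series k \<sigma>) UNIV"
    by (simp add: has_sum_iff shell_def[abs_def])
  then show "shell k \<sigma> sums L_series k \<sigma>"
    by (rule has_sum_imp_sums)
qed

lemma g_powr_abs_summable:
  assumes "\<sigma> > 1"
  shows "(\<lambda>n. norm (g k n * of_real (real n powr - \<sigma>))) summable_on A"
proof -
  have "(\<lambda>n. norm (g 0 n * of_real (real n powr - \<sigma>))) summable_on UNIV"
    using L_series_summable[OF _ assms, of 0] by (simp add: summable_on_iff_abs_summable_on_complex)
  then have "(\<lambda>n. norm (g k n * of_real (real n powr - \<sigma>))) summable_on UNIV"
  proof (rule summable_on_comparison_test)
    fix n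
    show "norm (g k n * of_real (real n powr - \<sigma>)) \<le> norm (g 0 n * of_real (real n powr - \<sigma>))"
      using mult_right_mono[OF cmod_g_le[of k n], of "real n powr - \<sigma>"] by (simp add: norm_mult g_0_eq)
  qed auto
  then show ?thesis by (rule summable_on_subset_banach) auto
qed

text \<open>
  By induction with the stronger bound \<open>1 + 1 / s - M powr - s / s\<close>, the value that comparison with
  an integral gives.
\<close>

lemma sum_powr_le:
  assumes "s > 0"
  shows "(\<Sum>m=1..M. real m powr (- 1 - s)) \<le> 1 + 1 / s"
proof (cases "M = 0")
  case False
  then have "M \<ge> 1" by simp
  then have "(\<Sum>m=1..M. real m powr (- 1 - s)) \<le> 1 + 1 / s - 1 / s * real M powr - s"
  proof (induction M rule: dec_induct)
    case base
    then show ?case by simp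
  next
    case (step M)
    define x where "x = real (Suc M)"
    have M: "real M > 0" "real M = x - 1" using step by (auto simp: x_def)
    have x: "x > 1" using M by simp
    have "ln (1 - 1 / x) \<le> - (1 / x)"
      using ln_add_one_self_le_self2[of "- (1 / x)"] x by simp
    moreover have "x * (1 - 1 / x) = x - 1" using x by (simp add: field_simps)
    moreover from this have "real M = x * (1 - 1 / x)" using M(2) by simp
    ultimately have "ln (real M) \<le> ln x - 1 / x"
      using x ln_mult_pos[of x "1 - 1/x"] by simp
    then have "- s * ln (real M) \<ge> - s * ln x + s / x"
      using mult_left_mono[of "ln (real M)" "ln x - 1 / x" s] assms by (simp add: algebra_simps)
    then have "real M powr - s \<ge> exp (- s * ln x + s / x)"
      using M by (simp add: powr_def)
    also have "exp (- s * ln x + s / x) = x powr - s * exp (s / x)"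
      using x by (simp add: powr_def flip: exp_add)
    also have "x powr - s * exp (s / x) \<ge> x powr - s * (1 + s / x)"
      by (intro mult_left_mono exp_ge_add_one_self) auto
    also have "x powr - s * (1 + s / x) = x powr - s + s * x powr (- 1 - s)"
    proof -
      have "- 1 - s = - s - 1" by simp
      then have "x powr (- 1 - s) = x powr - s / x"
        using x powr_diff[of x "-s" 1] by (simp only:) simp
      then show ?thesis by (simp add: distrib_left)
    qed
    finally have "real M powr - s \<ge> x powr - s + s * x powr (- 1 - s)" .
    then have "x powr (- 1 - s) \<le> 1 / s * real M powr - s - 1 / s * x powr - s"
      using assms by (simp add: field_simps)
    then show ?case
      using step by (simp add: x_def add.commute)
  qed
  also have "\<dots> \<le> 1 + 1 / s" using assms by simp
  finally show ?thesis .
qed (use assms in simp)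

text \<open>
  The \<open>2 m\<close> points of a shell have norm at least \<open>m\<^sup>2\<close>.
\<close>

lemma L_series_0_bound:
  assumes "1 < \<sigma>" "\<sigma> \<le> 2"
  shows "cmod (L_series 0 \<sigma>) \<le> 4 / (\<sigma> - 1)"
proof (rule Lim_bounded)
  show "(\<lambda>M. cmod (\<Sum>m<M. shell 0 \<sigma> m)) \<longlonglongrightarrow> cmod (L_series 0 \<sigma>)"
    using L_series_shells[of 0 \<sigma>] assms by (intro tendsto_norm) (simp add: sums_def)
  show "\<forall>M\<ge>1. cmod (\<Sum>m<M. shell 0 \<sigma> m) \<le> 4 / (\<sigma> - 1)"
  proof (intro allI impI)
    fix M :: nat assume "M \<ge> 1"
    have "cmod (\<Sum>m<M. shell 0 \<sigma> m) \<le> (\<Sum>m<M. 2 * real m powr (1 - 2 * \<sigma>))"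
    proof (rule sum_norm_le)
      fix m
      have "cmod (shell 0 \<sigma> m) \<le> (\<Sum>i<2*m. cmod (wedge_term 0 \<sigma> (m, i)))"
        unfolding shell_def by (rule norm_sum)
      also have "\<dots> \<le> 2 * real m powr (1 - 2 * \<sigma>)"
        using sum_norm_wedge_shell assms by simp
      finally show "cmod (shell 0 \<sigma> m) \<le> 2 * real m powr (1 - 2 * \<sigma>)" .
    qed
    also have "\<dots> \<le> (\<Sum>m=0..M. 2 * real m powr (1 - 2 * \<sigma>))"
      by (rule sum_mono2) auto
    also have "\<dots> = 2 * (\<Sum>m=1..M. real m powr (- 1 - 2 * (\<sigma> - 1)))"
      by (simp add: sum.atLeast_Suc_atMost[of 0] algebra_simps flip: sum_distrib_left)
    also have "\<dots> \<le> 2 * (1 + 1 / (2 * (\<sigma> - 1)))"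
      using assms by (intro mult_left_mono sum_powr_le) auto
    also have "2 * (1 + 1 / (2 * (\<sigma> - 1))) = 2 + 1 / (\<sigma> - 1)"
    proof -
      have h: "2 * (1 / (2 * x)) = 1 / x" for x :: real by simp
      show ?thesis unfolding distrib_left h by simp
    qed
    also have "\<dots> \<le> 2 / (\<sigma> - 1) + 1 / (\<sigma> - 1)"
      using assms by (intro add_right_mono) (simp add: le_divide_eq)
    also have "\<dots> \<le> 4 / (\<sigma> - 1)"
      using assms by (simp add: add_divide_distrib[symmetric] divide_right_mono)
    finally show "cmod (\<Sum>m<M. shell 0 \<sigma> m) \<le> 4 / (\<sigma> - 1)" .
  qed
qed

lemma unit_power_linear:
  fixes w :: complex
  assumes "cmod w = 1"
  shows "cmod (w ^ k - 1 - of_nat k * (w - 1)) \<le> real k ^ 2 * (cmod (w - 1))\<^sup>2"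
proof (induction k)
  case (Suc k)
  have "w ^ Suc k - 1 - of_nat (Suc k) * (w - 1)
      = w * (w ^ k - 1 - of_nat k * (w - 1)) + of_nat k * (w - 1)\<^sup>2"
    by (simp add: algebra_simps power2_eq_square)
  also have "cmod \<dots> \<le> cmod (w ^ k - 1 - of_nat k * (w - 1)) + real k * (cmod (w - 1))\<^sup>2"
    by (rule order.trans[OF norm_triangle_ineq]) (simp add: norm_mult norm_power assms)
  also have "\<dots> \<le> (real k ^ 2 + real k) * (cmod (w - 1))\<^sup>2"
    using Suc.IH by (simp add: algebra_simps)
  also have "\<dots> \<le> real (Suc k) ^ 2 * (cmod (w - 1))\<^sup>2"
    by (intro mult_right_mono) (auto simp: power2_eq_square algebra_simps)
  finally show ?case .
qed simp

text \<open>
  A rotation by a small angle: to first order \<open>1 + s\<close> has argument \<open>Im s\<close>.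
\<close>

lemma sgn_one_plus:
  fixes s :: complex
  assumes "cmod s \<le> 1 / 4"
  shows "cmod (sgn (1 + s) - 1 - \<i> * of_real (Im s)) \<le> 3 * (cmod s)\<^sup>2"
proof -
  define \<rho> where "\<rho> = cmod (1 + s)"
  define r where "r = Re s"
  define t where "t = Im s"
  have rt: "\<bar>r\<bar> \<le> cmod s" "\<bar>t\<bar> \<le> cmod s"
    by (auto simp: r_def t_def abs_Re_le_cmod abs_Im_le_cmod)
  have \<rho>1: "\<bar>\<rho> - 1\<bar> \<le> cmod s"
    using norm_triangle_ineq3[of "1 + s" 1] by (simp add: \<rho>_def)
  then have \<rho>: "\<rho> \<ge> 3 / 4" using assms by linarith
  have sq: "\<rho>\<^sup>2 = (1 + r)\<^sup>2 + t\<^sup>2"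
    by (simp add: \<rho>_def cmod_power2 r_def t_def)
  have r1: "1 + r \<ge> 3 / 4" using rt assms by linarith
  have "(\<rho> - (1 + r)) * (\<rho> + (1 + r)) = t\<^sup>2"
    using sq by (simp add: algebra_simps power2_eq_square)
  then have e: "\<rho> - (1 + r) = t\<^sup>2 / (\<rho> + (1 + r))"
    using \<rho> r1 by (simp add: field_simps)
  have d: "\<bar>\<rho> - (1 + r)\<bar> \<le> t\<^sup>2"
  proof -
    have "t\<^sup>2 / (\<rho> + (1 + r)) \<le> t\<^sup>2 / 1"
      using \<rho> r1 by (intro divide_left_mono) auto
    then show ?thesis
      unfolding e using \<rho> r1 by simp
  qed
  have "sgn (1 + s) - 1 - \<i> * of_real (Im s) = (of_real (1 + r - \<rho>) + \<i> * of_real (t * (1 - \<rho>))) / of_real \<rho>"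
  proof -
    have "1 + s = of_real (1 + r) + \<i> * of_real t" by (simp add: complex_eq_iff r_def t_def)
    then have "sgn (1 + s) = (of_real (1 + r) + \<i> * of_real t) / of_real \<rho>"
      by (metis sgn_eq \<rho>_def)
    then show ?thesis
      using \<rho> by (simp add: field_simps t_def)
  qed
  also have "cmod \<dots> \<le> (\<bar>1 + r - \<rho>\<bar> + \<bar>t * (1 - \<rho>)\<bar>) / \<rho>"
    using \<rho> by (auto simp: norm_divide norm_mult simp del: of_real_add of_real_diff of_real_mult
        intro!: divide_right_mono order.trans[OF norm_triangle_ineq])
  also have "\<dots> \<le> ((cmod s)\<^sup>2 + (cmod s)\<^sup>2) / (3 / 4)"
  proof (intro frac_le add_mono)
    have "t\<^sup>2 \<le> (cmod s)\<^sup>2" using rt(2) by (simp add: abs_le_square_iff[symmetric])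
    then show "\<bar>1 + r - \<rho>\<bar> \<le> (cmod s)\<^sup>2" using d by linarith
    show "\<bar>t * (1 - \<rho>)\<bar> \<le> (cmod s)\<^sup>2"
      unfolding abs_mult power2_eq_square using rt \<rho>1 by (intro mult_mono) auto
  qed (use \<rho> in auto)
  also have "\<dots> \<le> 3 * (cmod s)\<^sup>2" by simp
  finally show ?thesis .
qed

text \<open>
  Moving from one point \<open>z\<close> of the shell to the next multiplies \<open>sgn z ^ k\<close> by about
  \<open>1 + \<i> k m / \<bar>z\<bar>\<^sup>2\<close>. The increments sum to zero, because the last point is
  \<open>\<i>\<close> times the first and 4 divides \<open>k\<close>. So the sum in question is, up to sign,
  \<open>1 / (\<i> k m)\<close> times the sum of the second order errors.
\<close>

lemma shell_one_bound:
  assumes "4 dvd k" "k > 0" "m \<ge> k"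
  shows "cmod (\<Sum>i<2*m. sgn (wedge_point m i) ^ k * of_real (1 / (cmod (wedge_point m i))\<^sup>2)) \<le> 14 * k / m\<^sup>2"
proof -
  have m4: "m \<ge> 4" using assms by (auto elim!: dvdE)
  define u where "u = (\<lambda>i. sgn (wedge_point m i))"
  define t where "t = (\<lambda>i. m / (cmod (wedge_point m i))\<^sup>2)"
  \<comment> \<open>The next point is \<open>z + \<i> = z (1 + s)\<close> with \<open>s = \<i> / z\<close>, and
    \<open>Im s = m / \<bar>z\<bar>\<^sup>2\<close>.\<close>
  have step: "cmod (u (Suc i) ^ k - u i ^ k - \<i> * of_nat k * of_real (t i) * u i ^ k) \<le> 7 * real k ^ 2 / m\<^sup>2"
    if i: "i < 2 * m" for i
  proof -
    define z where "z = wedge_point m i"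
    define s where "s = \<i> / z"
    define w where "w = sgn (1 + s)"
    have z: "cmod z \<ge> m"
      using wedge_point_norm(1)[OF i] by (auto simp: z_def intro: power2_le_imp_le)
    then have z0: "z \<noteq> 0" using m4 by auto
    have z': "wedge_point m (Suc i) = z * (1 + s)"
      using z0 by (simp add: s_def distrib_left) (simp add: z_def wedge_point_def complex_eq_iff)
    have s: "cmod s \<le> 1 / m"
      using z m4 by (simp add: s_def norm_divide divide_simps)
    have s4: "cmod s \<le> 1 / 4"
      by (rule order.trans[OF s]) (use m4 in \<open>simp add: divide_simps\<close>)
    have "1 + s \<noteq> 0"
    proof
      assume "1 + s = 0"
      then have "s = -1" by (metis add_eq_0_iff)
      then show False using s4 by simp
    qed
    then have w1: "cmod w = 1" by (simp add: w_def norm_sgn)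
    have t: "t i = Im s"
    proof -
      have "Re z = m" by (simp add: z_def wedge_point_def)
      then show ?thesis
        by (simp add: t_def s_def z_def[symmetric] Im_divide cmod_power2)
    qed
    have w: "cmod (w - 1 - \<i> * of_real (t i)) \<le> 3 * (cmod s)\<^sup>2"
      unfolding w_def t by (rule sgn_one_plus[OF s4])
    have s2: "(cmod s)\<^sup>2 \<le> 1 / m\<^sup>2"
      using power_mono[OF s, of 2] by (simp add: power_divide)
    have "cmod (w - 1) \<le> cmod (w - 1 - \<i> * of_real (t i)) + cmod (\<i> * of_real (t i))"
      using norm_triangle_ineq[of "w - 1 - \<i> * of_real (t i)" "\<i> * of_real (t i)"] by simp
    also have "\<dots> \<le> 3 * (1 / m\<^sup>2) + 1 / m"
      using w s2 s abs_Im_le_cmod[of s] by (intro add_mono) (auto simp: t norm_mult)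
    also have "\<dots> \<le> 2 / m"
      using m4 by (simp add: power2_eq_square field_simps)
    finally have wm: "cmod (w - 1) \<le> 2 / m" .
    have "u (Suc i) ^ k - u i ^ k - \<i> * of_nat k * of_real (t i) * u i ^ k
      = u i ^ k * ((w ^ k - 1 - of_nat k * (w - 1)) + of_nat k * (w - 1 - \<i> * of_real (t i)))"
      unfolding u_def z' sgn_mult power_mult_distrib z_def[symmetric] w_def[symmetric] by (simp add: algebra_simps)
    also have "cmod \<dots> \<le> 1 * (real k ^ 2 * (cmod (w - 1))\<^sup>2 + k * (3 * (cmod s)\<^sup>2))"
      unfolding norm_mult using w
      by (intro mult_mono order.trans[OF norm_triangle_ineq] add_mono unit_power_linear[OF w1])
         (auto simp: norm_mult u_def norm_power norm_sgn power_le_one intro!: mult_left_mono)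
    also have "\<dots> \<le> 1 * (real k ^ 2 * (2 / m)\<^sup>2 + real k ^ 2 * (3 * (1 / m\<^sup>2)))"
    proof (intro mult_left_mono add_mono mult_mono power_mono wm s2)
      show "real k \<le> real k ^ 2" using assms by (simp add: power2_eq_square)
    qed auto
    also have "\<dots> = 7 * real k ^ 2 / m\<^sup>2" by (simp add: power_divide)
    finally show ?thesis .
  qed
  have "wedge_point m (2 * m) = \<i> * wedge_point m 0"
    by (simp add: wedge_point_def complex_eq_iff)
  then have "u (2 * m) ^ k = u 0 ^ k"
    by (simp add: u_def sgn_mult power_mult_distrib) (simp add: sgn_eq i_power_4_dvd[OF assms(1)])
  then have tele: "(\<Sum>i<2*m. u (Suc i) ^ k - u i ^ k) = 0"
    using sum_lessThan_telescope[of "\<lambda>i. u i ^ k" "2 * m"] by simp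
  have "\<i> * of_nat k * of_nat m * (\<Sum>i<2*m. u i ^ k * of_real (1 / (cmod (wedge_point m i))\<^sup>2))
      = (\<Sum>i<2*m. \<i> * of_nat k * of_real (t i) * u i ^ k)"
    by (simp add: sum_distrib_left t_def mult_ac)
  also have "\<dots> = - (\<Sum>i<2*m. u (Suc i) ^ k - u i ^ k - \<i> * of_nat k * of_real (t i) * u i ^ k)"
    using tele by (simp add: sum_subtractf)
  also have "cmod \<dots> \<le> (\<Sum>i<2*m. 7 * real k ^ 2 / m\<^sup>2)"
    unfolding norm_minus_cancel by (rule sum_norm_le) (use step in auto)
  also have "\<dots> = k * m * (14 * k / m\<^sup>2)"
    by (simp add: power2_eq_square)
  finally have "k * m * cmod (\<Sum>i<2*m. u i ^ k * of_real (1 / (cmod (wedge_point m i))\<^sup>2)) \<le> k * m * (14 * k / m\<^sup>2)"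
    by (simp add: norm_mult)
  then show ?thesis
    using assms m4 unfolding u_def by (subst (asm) mult_le_cancel_left_pos) auto
qed

text \<open>
  On a shell \<open>\<bar>z\<bar> powr (-2 (\<sigma> - 1))\<close> deviates from
  \<open>m powr (-2 (\<sigma> - 1))\<close> only by a factor \<open>1 + O(\<sigma> - 1)\<close>. The exponent 1
  is treated by the previous lemma.
\<close>

lemma shell_bound:
  assumes "4 dvd k" "k > 0" "m \<ge> k" "1 < \<sigma>" "\<sigma> \<le> 2"
  shows "cmod (shell k \<sigma> m) \<le> 14 * k / m\<^sup>2 + 2 * (\<sigma> - 1) * real m powr (- 1 - 2 * (\<sigma> - 1))"
proof -
  define \<tau> where "\<tau> = \<sigma> - 1"
  have m0: "m > 0" using assms by simp
  let ?z = "wedge_point m" and ?M = "real m powr (- 2 * \<tau>)"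
  have eq: "shell k \<sigma> m = of_real ?M * (\<Sum>i<2*m. sgn (?z i) ^ k * of_real (1 / (cmod (?z i))\<^sup>2))
     + (\<Sum>i<2*m. sgn (?z i) ^ k * of_real (1 / (cmod (?z i))\<^sup>2 * ((cmod (?z i))\<^sup>2 powr - \<tau> - ?M)))"
    unfolding shell_def sum_distrib_left sum.distrib[symmetric]
  proof (rule sum.cong)
    fix i assume "i \<in> {..<2*m}"
    have "(cmod (?z i))\<^sup>2 powr - \<sigma> = (cmod (?z i))\<^sup>2 powr (- \<tau> - 1)"
      by (simp add: \<tau>_def)
    also have "\<dots> = 1 / (cmod (?z i))\<^sup>2 * (cmod (?z i))\<^sup>2 powr - \<tau>"
      by (simp add: powr_diff)
    finally show "wedge_term k \<sigma> (m, i) = of_real ?M * (sgn (?z i) ^ k * of_real (1 / (cmod (?z i))\<^sup>2))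
        + sgn (?z i) ^ k * of_real (1 / (cmod (?z i))\<^sup>2 * ((cmod (?z i))\<^sup>2 powr - \<tau> - ?M))"
      by (simp add: wedge_term_def algebra_simps)
  qed simp
  have "cmod (shell k \<sigma> m) \<le> ?M * (14 * k / m\<^sup>2) + (\<Sum>i<2*m. 1 / m\<^sup>2 * (\<tau> * ?M))"
    unfolding eq
  proof (intro order.trans[OF norm_triangle_ineq] add_mono sum_norm_le)
    show "cmod (of_real ?M * (\<Sum>i<2*m. sgn (?z i) ^ k * of_real (1 / (cmod (?z i))\<^sup>2))) \<le> ?M * (14 * k / m\<^sup>2)"
      unfolding norm_mult norm_of_real
      using mult_left_mono[OF shell_one_bound[OF assms(1-3)], of ?M] by simp
  next
    fix i assume "i \<in> {..<2*m}"
    then have i: "i < 2 * m" by simp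
    note z = wedge_point_norm[OF i]
    have z0: "(cmod (?z i))\<^sup>2 > 0" using z(1) m0 by (smt (verit) of_nat_0_less_iff zero_less_power)
    have M: "(real m ^ 2) powr - \<tau> = ?M"
      using m0 by (simp add: powr_powr flip: powr_numeral)
    \<comment> \<open>Both bounds come from
      \<open>m\<^sup>2 \<le> \<bar>z\<bar>\<^sup>2 \<le> 2 m\<^sup>2\<close>.\<close>
    have up: "(cmod (?z i))\<^sup>2 powr - \<tau> \<le> ?M"
      unfolding M[symmetric] using z m0 assms by (intro powr_mono2') (auto simp: \<tau>_def)
    have "(1 - \<tau>) * ?M \<le> 2 powr - \<tau> * ?M"
    proof (rule mult_right_mono)
      have "1 - \<tau> \<le> 1 + (- \<tau> * ln 2)"
        using ln_2_less_1 assms by (simp add: \<tau>_def mult_left_le)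
      also have "\<dots> \<le> exp (- \<tau> * ln 2)" by (rule exp_ge_add_one_self)
      finally show "1 - \<tau> \<le> 2 powr - \<tau>" by (simp add: powr_def)
    qed auto
    also have "2 powr - \<tau> * ?M = (2 * real m ^ 2) powr - \<tau>"
      by (simp add: powr_mult M)
    also have "\<dots> \<le> (cmod (?z i))\<^sup>2 powr - \<tau>"
      using z z0 assms by (intro powr_mono2') (auto simp: \<tau>_def)
    finally have lo: "(1 - \<tau>) * ?M \<le> (cmod (?z i))\<^sup>2 powr - \<tau>" .
    have d: "\<bar>(cmod (?z i))\<^sup>2 powr - \<tau> - ?M\<bar> \<le> \<tau> * ?M"
      using lo up by (simp add: algebra_simps)
    have "cmod (sgn (?z i) ^ k * of_real (1 / (cmod (?z i))\<^sup>2 * ((cmod (?z i))\<^sup>2 powr - \<tau> - ?M)))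
      \<le> 1 * (1 / (cmod (?z i))\<^sup>2 * \<bar>(cmod (?z i))\<^sup>2 powr - \<tau> - ?M\<bar>)"
      unfolding norm_mult norm_of_real abs_mult
      by (intro mult_mono) (auto simp: norm_power norm_sgn power_le_one)
    also have "\<dots> \<le> 1 * (1 / m\<^sup>2 * (\<tau> * ?M))"
    proof (intro mult_left_mono mult_mono d)
      show "1 / (cmod (?z i))\<^sup>2 \<le> 1 / m\<^sup>2"
        using z(1) m0 by (intro frac_le) auto
    qed simp_all
    finally show "cmod (sgn (?z i) ^ k * of_real (1 / (cmod (?z i))\<^sup>2 * ((cmod (?z i))\<^sup>2 powr - \<tau> - ?M)))
        \<le> 1 / m\<^sup>2 * (\<tau> * ?M)" by simp
  qed
  also have "\<dots> \<le> 1 * (14 * k / m\<^sup>2) + 2 * \<tau> * (?M / m)"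
  proof -
    have "?M \<le> real m powr 0"
      using m0 assms by (intro powr_mono) (auto simp: \<tau>_def)
    then have "?M \<le> 1" using m0 by simp
    then have "?M * (14 * k / m\<^sup>2) \<le> 1 * (14 * k / m\<^sup>2)"
      by (rule mult_right_mono) simp
    moreover have "(\<Sum>i<2*m. 1 / real (m\<^sup>2) * (\<tau> * ?M)) = 2 * \<tau> * (?M / m)"
      using m0 by (simp add: power2_eq_square)
    ultimately show ?thesis by linarith
  qed
  also have "?M / m = real m powr (- 1 - 2 * \<tau>)"
  proof -
    have "- 1 - 2 * \<tau> = - 2 * \<tau> - 1" by simp
    then show ?thesis
      using m0 powr_diff[of m "- 2 * \<tau>" 1] by (simp only:) simp
  qed
  finally show ?thesis by (simp add: \<tau>_def)
qed

lemma sum_inverse_square_le: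
  assumes "k \<ge> 2"
  shows "(\<Sum>m=k..M. 1 / real m ^ 2) \<le> 2 / k"
proof (cases "M \<ge> k")
  case True
  then have "(\<Sum>m=k..M. 1 / real m ^ 2) \<le> 2 / k - 1 / M"
  proof (induction M rule: dec_induct)
    case base
    then show ?case using assms by (simp add: field_simps power2_eq_square)
  next
    case (step M)
    have M: "real M > 0" using step assms by simp
    have "1 / (real M + 1) ^ 2 \<le> 1 / M - 1 / (real M + 1)"
    proof -
      have "1 / M - 1 / (real M + 1) = 1 / (real M * (real M + 1))"
        using M by (simp add: divide_simps)
      then show ?thesis
        using M by (simp add: power2_eq_square frac_le)
    qed
    then show ?case using step by (simp add: add.commute)
  qed
  also have "\<dots> \<le> 2 / k" by simp
  finally show ?thesis .
qed simp

lemma sum_inverse_le_ln: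
  assumes "M \<ge> 1"
  shows "(\<Sum>m=1..M. 1 / real m) \<le> 1 + ln M"
  using assms
proof (induction M rule: dec_induct)
  case (step M)
  have M: "real M > 0" using step by simp
  have "ln (real M / (real M + 1)) \<le> real M / (real M + 1) - 1"
    using M by (intro ln_le_minus_one) auto
  also have "\<dots> = - (1 / (real M + 1))" using M by (simp add: field_simps)
  finally have "1 / (real M + 1) \<le> ln (real M + 1) - ln M"
    using M by (simp add: ln_div)
  then show ?case using step by (simp add: add.commute)
qed simp

text \<open>
  Shells with \<open>m < k\<close> are bounded trivially by \<open>2 / m\<close> and account for
  \<open>log k\<close>; those with \<open>m \<ge> k\<close> contribute \<open>O(1)\<close> by cancellation.
\<close>

lemma L_series_bound:
  assumes "4 dvd k" "k > 0" "1 < \<sigma>" "\<sigma> \<le> 2"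
  shows "cmod (L_series k \<sigma>) \<le> 33 * (1 + ln k)"
proof (rule Lim_bounded)
  define \<tau> where "\<tau> = \<sigma> - 1"
  have k4: "k \<ge> 4" using assms by (auto elim!: dvdE)
  show "(\<lambda>M. cmod (\<Sum>m<M. shell k \<sigma> m)) \<longlonglongrightarrow> cmod (L_series k \<sigma>)"
    using L_series_shells[of k \<sigma>] assms by (intro tendsto_norm) (simp add: sums_def)
  show "\<forall>M\<ge>1. cmod (\<Sum>m<M. shell k \<sigma> m) \<le> 33 * (1 + ln k)"
  proof (intro allI impI)
    fix M :: nat assume "M \<ge> 1"
    \<comment> \<open>The contribution \<open>b\<close> is the main part of each bound; \<open>c\<close> sums to
      at most 3 because its factor \<open>\<tau>\<close> cancels the pole.\<close>
    define b where "b = (\<lambda>m. if m < k then 2 * (1 / real m) else 14 * real k * (1 / real m ^ 2))"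
    define c where "c = (\<lambda>m. 2 * \<tau> * real m powr (- 1 - 2 * \<tau>))"
    have nn: "b m \<ge> 0" "c m \<ge> 0" for m using assms by (auto simp: b_def c_def \<tau>_def)
    have "cmod (\<Sum>m<M. shell k \<sigma> m) \<le> (\<Sum>m<M. b m + c m)"
    proof (rule sum_norm_le)
      fix m
      show "cmod (shell k \<sigma> m) \<le> b m + c m"
      proof (cases "m < k")
        case True
        have "cmod (shell k \<sigma> m) \<le> (\<Sum>i<2*m. cmod (wedge_term k \<sigma> (m, i)))"
          unfolding shell_def by (rule norm_sum)
        also have "\<dots> \<le> 2 * real m powr (1 - 2 * \<sigma>)"
          using sum_norm_wedge_shell assms by simp
        also have "\<dots> \<le> 2 * real m powr (-1)"
        proof (cases "m = 0")
          case False
          then have "real m powr (1 - 2 * \<sigma>) \<le> real m powr (-1)"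
            using assms by (intro powr_mono) auto
          then show ?thesis by simp
        qed simp
        also have "\<dots> = b m" using True by (simp add: b_def powr_minus_divide)
        finally show ?thesis using nn(2)[of m] by linarith
      next
        case False
        then show ?thesis
          using shell_bound[OF assms(1,2) _ assms(3,4), of m] by (simp add: b_def c_def \<tau>_def)
      qed
    qed
    also have "\<dots> = (\<Sum>m<M. b m) + (\<Sum>m<M. c m)" by (rule sum.distrib)
    also have "(\<Sum>m<M. c m) \<le> (\<Sum>m=0..M. c m)"
      by (rule sum_mono2) (use nn in auto)
    also have "\<dots> = 2 * \<tau> * (\<Sum>m=1..M. real m powr (- 1 - 2 * \<tau>))"
      by (simp add: sum.atLeast_Suc_atMost[of 0] c_def flip: sum_distrib_left)
    also have "\<dots> \<le> 2 * \<tau> * (1 + 1 / (2 * \<tau>))"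
      using assms by (intro mult_left_mono sum_powr_le) (auto simp: \<tau>_def)
    also have "\<dots> \<le> 3"
    proof -
      have "\<tau> > 0" "\<tau> \<le> 1" using assms by (auto simp: \<tau>_def)
      then show ?thesis by (simp add: distrib_left)
    qed
    also have "(\<Sum>m<M. b m) = (\<Sum>m<M. if m < k then 2 * (1 / real m) else 0)
        + (\<Sum>m<M. if m < k then 0 else 14 * real k * (1 / real m ^ 2))"
      unfolding sum.distrib[symmetric] by (rule sum.cong) (auto simp: b_def)
    also have "(\<Sum>m<M. if m < k then 2 * (1 / real m) else 0) = (\<Sum>m\<in>{m \<in> {..<M}. m < k}. 2 * (1 / real m))"
      by (rule sum.inter_filter[symmetric]) simp
    also have "\<dots> \<le> (\<Sum>m=0..k. 2 * (1 / real m))"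
      by (rule sum_mono2) auto
    also have "\<dots> = 2 * (\<Sum>m=1..k. 1 / real m)"
      by (simp add: sum.atLeast_Suc_atMost[of 0] sum_distrib_left)
    also have "\<dots> \<le> 2 * (1 + ln k)"
      using k4 by (intro mult_left_mono sum_inverse_le_ln) auto
    also have "(\<Sum>m<M. if m < k then 0 else 14 * real k * (1 / real m ^ 2))
        = (\<Sum>m<M. if \<not> m < k then 14 * real k * (1 / real m ^ 2) else 0)"
      by (rule sum.cong) auto
    also have "\<dots> = (\<Sum>m\<in>{m \<in> {..<M}. \<not> m < k}. 14 * real k * (1 / real m ^ 2))"
      by (rule sum.inter_filter[symmetric]) simp
    also have "\<dots> \<le> (\<Sum>m=k..M. 14 * real k * (1 / real m ^ 2))"
      by (rule sum_mono2) auto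
    also have "\<dots> = 14 * real k * (\<Sum>m=k..M. 1 / real m ^ 2)"
      by (simp add: sum_distrib_left)
    also have "\<dots> \<le> 14 * real k * (2 / k)"
      using k4 by (intro mult_left_mono sum_inverse_square_le) auto
    also have "\<dots> = 28" using k4 by simp
    also have "2 * (1 + ln (real k)) + 28 + 3 \<le> 33 * (1 + ln k)"
      using k4 by (simp add: algebra_simps)
    finally show "cmod (\<Sum>m<M. shell k \<sigma> m) \<le> 33 * (1 + ln k)" by simp
  qed
qed

section \<open>The sum of f over primes\<close>

definition rough :: "nat set \<Rightarrow> nat set" where
  "rough Q = {n. n > 0 \<and> (\<forall>q\<in>Q. \<not> q dvd n)}"

definition L_term :: "nat \<Rightarrow> real \<Rightarrow> nat \<Rightarrow> complex" where
  "L_term k \<sigma> n = g k n * of_real (real n powr - \<sigma>)"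

lemma L_term_abs_summable:
  assumes "\<sigma> > 1"
  shows "(\<lambda>n. norm (L_term k \<sigma> n)) summable_on A"
  unfolding L_term_def by (rule g_powr_abs_summable[OF assms])

lemma L_term_summable:
  assumes "\<sigma> > 1"
  shows "L_term k \<sigma> summable_on A"
  by (rule abs_summable_summable[OF L_term_abs_summable[OF assms]])

text \<open>
  One factor of the Euler product. The terms with \<open>p dvd n\<close> are the terms at \<open>p n\<close>,
  which the Hecke relation expresses by the full sum; so removing them multiplies the sum by
  \<open>1 - (a + b) x + a b x\<^sup>2\<close>.
\<close>

lemma infsum_rough_insert:
  assumes "prime p" "hecke_params k p a b" "\<sigma> > 1" "finite Q" "\<And>q. q \<in> Q \<Longrightarrow> prime q" "p \<notin> Q"
  defines "x \<equiv> complex_of_real (real p powr - \<sigma>)"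
  shows "infsum (L_term k \<sigma>) (rough (insert p Q)) = infsum (L_term k \<sigma>) (rough Q) * ((1 - a * x) * (1 - b * x))"
proof -
  let ?c = "L_term k \<sigma>" and ?A = "rough Q"
  define L where "L = infsum ?c ?A"
  have p0: "p > 0" using assms(1) prime_gt_0_nat by blast
  have coprime: "q dvd p * n \<longleftrightarrow> q dvd n" if "q \<in> Q" for q n
    using that assms by (metis primes_coprime coprime_dvd_mult_right_iff)
  have inj: "inj_on ((*) p) B" for B
    using p0 by (auto simp: inj_on_def)
  have mult: "{n \<in> ?A. p dvd n} = (*) p ` ?A"
  proof (intro equalityI subsetI)
    fix n assume n: "n \<in> {n \<in> ?A. p dvd n}"
    then obtain m where m: "n = p * m" by auto
    then have "m \<in> ?A" using n coprime by (auto simp: rough_def)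
    then show "n \<in> (*) p ` ?A" using m by blast
  next
    fix n assume "n \<in> (*) p ` ?A"
    then show "n \<in> {n \<in> ?A. p dvd n}" using coprime p0 by (auto simp: rough_def)
  qed
  have split: "?A = rough (insert p Q) \<union> {n \<in> ?A. p dvd n}" "rough (insert p Q) \<inter> {n \<in> ?A. p dvd n} = {}"
    by (auto simp: rough_def)
  have "L = infsum ?c (rough (insert p Q)) + infsum ?c {n \<in> ?A. p dvd n}"
    unfolding L_def by (subst split(1)) (rule infsum_Un_disjoint[OF _ _ split(2)]; rule L_term_summable[OF assms(3)])
  also have "infsum ?c {n \<in> ?A. p dvd n} = infsum (\<lambda>n. ?c (p * n)) ?A"
    unfolding mult by (subst infsum_reindex[OF inj]) (simp add: o_def)
  also have "\<dots> = infsum (\<lambda>n. (a + b) * x * ?c n + (- a * b * x\<^sup>2) * (if p dvd n then ?c (n div p) else 0)) ?A"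
  proof (rule infsum_cong)
    fix n assume "n \<in> ?A"
    then have n0: "n > 0" by (simp add: rough_def)
    have e: "?c (p * n) = ((a + b) * g k n - a * b * (if p dvd n then g k (n div p) else 0)) * (x * of_real (real n powr - \<sigma>))"
      unfolding hecke_relation[OF assms(2) n0, symmetric] by (simp add: L_term_def powr_mult x_def)
    show "?c (p * n) = (a + b) * x * ?c n + (- a * b * x\<^sup>2) * (if p dvd n then ?c (n div p) else 0)"
    proof (cases "p dvd n")
      case True
      then obtain m where m: "n = p * m" by auto
      have nm: "of_real (real n powr - \<sigma>) = x * of_real (real m powr - \<sigma>)"
        by (simp add: m powr_mult x_def)
      have "n div p = m" using m p0 by simp
      then show ?thesis
        unfolding e unfolding L_term_def nm using True by (simp add: algebra_simps power2_eq_square)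
    next
      case False
      then show ?thesis unfolding e unfolding L_term_def by (simp add: algebra_simps)
    qed
  qed
  also have "\<dots> = (a + b) * x * L + (- a * b * x\<^sup>2) * infsum (\<lambda>n. if p dvd n then ?c (n div p) else 0) ?A"
  proof -
    have "(\<lambda>n. if p dvd n then ?c (n div p) else 0) summable_on ?A"
    proof -
      have "(\<lambda>n. ?c (n div p)) summable_on (*) p ` ?A"
        by (subst summable_on_reindex[OF inj]) (use p0 in \<open>simp add: o_def L_term_summable[OF assms(3)]\<close>)
      then show ?thesis
        by (rule summable_on_cong_neutral[THEN iffD1, rotated -1]) (auto simp flip: mult)
    qed
    then show ?thesis
      unfolding L_def
      by (rule infsum_add[OF summable_on_cmult_right[OF L_term_summable[OF assms(3), of k ?A], of "(a + b) * x"]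
          summable_on_cmult_right[of _ ?A "- a * b * x\<^sup>2"], unfolded infsum_cmult_right'])
  qed
  also have "infsum (\<lambda>n. if p dvd n then ?c (n div p) else 0) ?A = infsum (\<lambda>n. ?c (n div p)) ((*) p ` ?A)"
    by (rule infsum_cong_neutral) (auto simp flip: mult)
  also have "\<dots> = L"
    unfolding L_def by (subst infsum_reindex[OF inj]) (use p0 in \<open>simp add: o_def\<close>)
  finally show ?thesis
    unfolding L_def[symmetric] by (simp add: algebra_simps power2_eq_square)
qed

lemma norm_one_minus_le_exp:
  fixes y :: complex
  shows "cmod (1 - y) \<le> exp (- Re y + (cmod y)\<^sup>2 / 2)"
proof (rule power2_le_imp_le)
  have "(cmod (1 - y))\<^sup>2 = 1 + (- 2 * Re y + (cmod y)\<^sup>2)"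
    unfolding cmod_power2 by (simp add: power2_eq_square algebra_simps)
  also have "\<dots> \<le> exp (- 2 * Re y + (cmod y)\<^sup>2)"
    by (rule exp_ge_add_one_self)
  also have "\<dots> = (exp (- Re y + (cmod y)\<^sup>2 / 2))\<^sup>2"
    by (simp add: power2_eq_square flip: exp_add)
  finally show "(cmod (1 - y))\<^sup>2 \<le> (exp (- Re y + (cmod y)\<^sup>2 / 2))\<^sup>2" .
qed simp

lemma norm_infsum_rough_le:
  assumes "4 dvd k" "\<sigma> > 1" "finite Q" "\<And>q. q \<in> Q \<Longrightarrow> prime q"
  shows "cmod (infsum (L_term k \<sigma>) (rough Q))
     \<le> cmod (L_series k \<sigma>) * exp (\<Sum>q\<in>Q. 1 / real q ^ 2 - Re (g k q) * real q powr - \<sigma>)"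
  using assms(3,4)
proof (induction Q rule: finite_induct)
  case empty
  have "infsum (L_term k \<sigma>) (rough {}) = L_series k \<sigma>"
    unfolding L_series_def by (rule infsum_cong_neutral) (auto simp: rough_def L_term_def)
  then show ?case by simp
next
  case (insert p Q)
  have p: "prime p" using insert by simp
  obtain a b where h: "hecke_params k p a b"
    using hecke_params_ex p by blast
  have ab: "cmod a \<le> 1" "cmod b \<le> 1" using h by (auto simp: hecke_params_def)
  define x where "x = real p powr - \<sigma>"
  have p1: "real p \<ge> 1" using prime_gt_0_nat[OF p] by linarith
  have "x \<ge> 0" by (simp add: x_def)
  have "x \<le> real p powr - 1" unfolding x_def using p1 assms(2) by (intro powr_mono) auto
  then have x: "x \<le> 1 / real p" using p1 by (simp add: powr_minus_divide)
  have ax: "cmod (1 - u * of_real x) \<le> exp (- Re u * x + 1 / real p ^ 2 / 2)" if "cmod u \<le> 1" for u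
  proof -
    have "cmod (u * of_real x) \<le> 1 * (1 / real p)"
      unfolding norm_mult norm_of_real using that x \<open>x \<ge> 0\<close> by (intro mult_mono) auto
    then have "(cmod (u * of_real x))\<^sup>2 \<le> (1 / real p)\<^sup>2"
      by (intro power_mono) auto
    then have "exp (- Re (u * of_real x) + (cmod (u * of_real x))\<^sup>2 / 2) \<le> exp (- Re u * x + 1 / real p ^ 2 / 2)"
      by (simp add: power_divide)
    then show ?thesis using norm_one_minus_le_exp[of "u * of_real x"] by linarith
  qed
  have "cmod (infsum (L_term k \<sigma>) (rough (insert p Q)))
     = cmod (infsum (L_term k \<sigma>) (rough Q)) * (cmod (1 - a * of_real x) * cmod (1 - b * of_real x))"
    using insert by (subst infsum_rough_insert[OF p h assms(2)]) (auto simp: norm_mult x_def)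
  also have "\<dots> \<le> (cmod (L_series k \<sigma>) * exp (\<Sum>q\<in>Q. 1 / real q ^ 2 - Re (g k q) * real q powr - \<sigma>))
      * (exp (- Re a * x + 1 / real p ^ 2 / 2) * exp (- Re b * x + 1 / real p ^ 2 / 2))"
    by (intro mult_mono insert.IH ax ab) (auto simp: insert)
  also have "\<dots> = cmod (L_series k \<sigma>) * exp (\<Sum>q\<in>insert p Q. 1 / real q ^ 2 - Re (g k q) * real q powr - \<sigma>)"
    using insert g_prime_eq[OF h assms(1) p] by (simp add: x_def algebra_simps flip: exp_add)
  finally show ?case .
qed

lemma sum_inverse_prime_squares:
  "(\<Sum>q | prime q \<and> q \<le> Y. 1 / real q ^ 2) \<le> 1"
proof -
  have "(\<Sum>q | prime q \<and> q \<le> Y. 1 / real q ^ 2) \<le> (\<Sum>m=2..Y. 1 / real m ^ 2)"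
    by (rule sum_mono2) (auto dest: prime_ge_2_nat)
  also have "\<dots> \<le> 1" using sum_inverse_square_le[of 2 Y] by simp
  finally show ?thesis .
qed

text \<open>
  As \<open>Y\<close> grows, the sum over integers without prime factors up to \<open>Y\<close> tends to its
  first term 1. It is therefore at least \<open>1/2\<close>, while it equals the L-series divided by the Euler
  product over the primes up to \<open>Y\<close>.
\<close>

lemma exp_prime_sum_le_L_series:
  assumes "4 dvd k" "\<sigma> > 1"
  shows "\<exists>Y0. \<forall>Y\<ge>Y0. exp (\<Sum>q | prime q \<and> q \<le> Y. Re (g k q) * real q powr - \<sigma>) \<le> 2 * exp 1 * cmod (L_series k \<sigma>)"
proof -
  let ?c = "L_term k \<sigma>"
  \<comment> \<open>Outside the finite set \<open>F\<close> the terms have total modulus at most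
    \<open>1/2\<close>.\<close>
  obtain F where F: "finite F" "dist (\<Sum>n\<in>F. norm (?c n)) (infsum (\<lambda>n. norm (?c n)) UNIV) \<le> 1/2"
    using infsum_finite_approximation[OF L_term_abs_summable[OF assms(2), of k UNIV], of "1/2"] by auto
  obtain Y0 where Y0: "\<And>n. n \<in> F \<Longrightarrow> n \<le> Y0"
    using F(1) by (metis Max_ge)
  show ?thesis
  proof (intro exI allI impI)
    fix Y assume Y: "Y \<ge> Y0"
    define Q where "Q = {q. prime q \<and> q \<le> Y}"
    have Q: "finite Q" "\<And>q. q \<in> Q \<Longrightarrow> prime q" by (auto simp: Q_def)
    define R where "R = rough Q - {1}"
    have big: "n > Y" if "n \<in> R" for n
    proof -
      have "n \<noteq> 1" "n > 0" using that by (auto simp: R_def rough_def)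
      then obtain q where q: "prime q" "q dvd n" using prime_factor_nat by blast
      then have "q > Y" using that by (auto simp: R_def rough_def Q_def)
      moreover have "q \<le> n" using q \<open>n > 0\<close> dvd_imp_le by blast
      ultimately show ?thesis by simp
    qed
    have "R \<inter> F = {}" using big Y0 Y by fastforce
    note s = L_term_abs_summable[OF assms(2), of k]
    have "infsum (\<lambda>n. norm (?c n)) R + (\<Sum>n\<in>F. norm (?c n)) = infsum (\<lambda>n. norm (?c n)) (R \<union> F)"
      using infsum_Un_disjoint[OF s s \<open>R \<inter> F = {}\<close>] F(1) by simp
    also have "\<dots> \<le> infsum (\<lambda>n. norm (?c n)) UNIV"
      by (rule infsum_mono2[OF s s]) auto
    finally have "infsum (\<lambda>n. norm (?c n)) R \<le> 1/2"
      using F(2) unfolding dist_real_def by arith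
    then have half: "cmod (infsum ?c R) \<le> 1/2"
      using norm_infsum_bound[OF s[of R]] by linarith
    have "1 \<in> rough Q" using Q(2)[THEN prime_ge_2_nat] by (fastforce simp: rough_def)
    then have "rough Q = {1} \<union> R" by (auto simp: R_def)
    then have "infsum ?c (rough Q) = infsum ?c {1} + infsum ?c R"
      by (simp only:) (rule infsum_Un_disjoint, auto intro!: L_term_summable[OF assms(2)] simp: R_def)
    also have "infsum ?c {1} = 1"
      using g_1[OF assms(1)] by (simp add: L_term_def)
    finally have "cmod (infsum ?c (rough Q)) \<ge> 1 - cmod (infsum ?c R)"
      using norm_diff_ineq[of 1 "infsum ?c R"] by simp
    with half have "1/2 \<le> cmod (infsum ?c (rough Q))" by linarith
    also have "\<dots> \<le> cmod (L_series k \<sigma>) * exp (\<Sum>q\<in>Q. 1 / real q ^ 2 - Re (g k q) * real q powr - \<sigma>)"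
      by (rule norm_infsum_rough_le[OF assms Q])
    also have "\<dots> \<le> cmod (L_series k \<sigma>) * exp (1 - (\<Sum>q\<in>Q. Re (g k q) * real q powr - \<sigma>))"
      using sum_inverse_prime_squares[of Y] by (intro mult_left_mono) (auto simp: sum_subtractf Q_def)
    finally show "exp (\<Sum>q | prime q \<and> q \<le> Y. Re (g k q) * real q powr - \<sigma>) \<le> 2 * exp 1 * cmod (L_series k \<sigma>)"
      by (simp add: exp_diff field_simps Q_def)
  qed
qed

lemma power_dvd_fact_mult:
  assumes "p > 0"
  shows "(p::nat) ^ k dvd fact (p * k)"
proof (induction k)
  case (Suc k)
  obtain r where r: "p = Suc r" using assms by (cases p) auto
  have "fact (p * Suc k) = (p * Suc k) * (fact (p * k + r) :: nat)"
    by (simp add: r algebra_simps)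
  moreover have "p ^ k dvd fact (p * k + r)"
    using Suc.IH by (rule dvd_trans) (rule fact_dvd, simp)
  ultimately show ?case
    by (metis dvd_triv_left mult_dvd_mono power_Suc)
qed simp

lemma prod_dvd_of_coprime:
  fixes F :: "nat \<Rightarrow> nat"
  assumes "finite A" "\<And>i. i \<in> A \<Longrightarrow> F i dvd x" "\<And>i j. i \<in> A \<Longrightarrow> j \<in> A \<Longrightarrow> i \<noteq> j \<Longrightarrow> coprime (F i) (F j)"
  shows "prod F A dvd x"
  using assms
proof (induction A rule: finite_induct)
  case (insert i A)
  have "coprime (F i) (prod F A)"
    using insert by (intro prod_coprime_right) auto
  moreover have "F i dvd x" "prod F A dvd x" using insert by auto
  ultimately show ?case using insert by (simp add: divides_mult)
qed simp

text \<open>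
  The product of \<open>p ^ (n div p)\<close> over all primes \<open>p \<le> n\<close> divides
  \<open>n!\<close>, which is at most \<open>n ^ n\<close>, and \<open>n div p \<ge> n / (2 p)\<close>.
\<close>

lemma sum_ln_prime_over_prime:
  assumes "n \<ge> 1"
  shows "(\<Sum>p | prime p \<and> p \<le> n. ln (real p) / real p) \<le> 2 * ln (real n)"
proof -
  let ?P = "{p. prime p \<and> p \<le> n}"
  have P: "finite ?P" by simp
  have "(\<Prod>p\<in>?P. p ^ (n div p)) dvd fact n"
  proof (rule prod_dvd_of_coprime[OF P])
    fix p assume "p \<in> ?P"
    then have "p > 0" by (auto simp: prime_gt_0_nat)
    then have "p ^ (n div p) dvd fact (p * (n div p))" by (rule power_dvd_fact_mult)
    also have "fact (p * (n div p)) dvd (fact n :: nat)" by (rule fact_dvd) simp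
    finally show "p ^ (n div p) dvd fact n" .
  qed (auto simp: primes_coprime)
  then have "(\<Prod>p\<in>?P. p ^ (n div p)) \<le> fact n" by (rule dvd_imp_le) simp
  also have "fact n \<le> n ^ n" by (rule fact_le_power[THEN order.trans]) simp_all
  finally have "real (\<Prod>p\<in>?P. p ^ (n div p)) \<le> real (n ^ n)" by (rule of_nat_mono)
  then have le: "(\<Prod>p\<in>?P. real p ^ (n div p)) \<le> real n ^ n" by simp
  have pos: "(\<Prod>p\<in>?P. real p ^ (n div p)) > 0"
    by (intro prod_pos) (auto simp: prime_gt_0_nat)
  have "ln (\<Prod>p\<in>?P. real p ^ (n div p)) \<le> ln (real n ^ n)"
    using le pos assms by (subst ln_le_cancel_iff) auto
  also have "ln (real n ^ n) = n * ln n" using assms by (simp add: ln_realpow)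
  also have "ln (\<Prod>p\<in>?P. real p ^ (n div p)) = (\<Sum>p\<in>?P. real (n div p) * ln p)"
    by (subst ln_prod) (auto simp: prime_gt_0_nat ln_realpow)
  finally have 1: "(\<Sum>p\<in>?P. real (n div p) * ln p) \<le> n * ln n" .
  have "n / 2 * (\<Sum>p\<in>?P. ln (real p) / real p) = (\<Sum>p\<in>?P. (n / (2 * real p)) * ln p)"
    by (simp add: sum_distrib_left)
  also have "\<dots> \<le> (\<Sum>p\<in>?P. real (n div p) * ln p)"
  proof (intro sum_mono mult_right_mono)
    fix p assume "p \<in> ?P"
    then have p: "p > 0" "p \<le> n" "p \<ge> 2" by (auto simp: prime_gt_0_nat prime_ge_2_nat)
    have "n = n div p * p + n mod p" by simp
    also have "\<dots> \<le> n div p * p + n div p * p"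
    proof -
      have "1 * p \<le> n div p * p" using p by (intro mult_le_mono1) (simp add: Suc_le_eq div_greater_zero_iff)
      moreover have "n mod p < p" using p by simp
      ultimately show ?thesis by linarith
    qed
    finally have "real n \<le> real (2 * (n div p * p))" by (intro of_nat_mono) simp
    then show "n / (2 * real p) \<le> real (n div p)"
      using p by (simp add: field_simps)
    show "0 \<le> ln (real p)" using p by simp
  qed
  also note 1
  finally have "n * (\<Sum>p\<in>?P. ln (real p) / real p) \<le> n * (2 * ln n)" by simp
  then show ?thesis using assms by (subst (asm) mult_le_cancel_left_pos) auto
qed

lemma f_prime_bound:
  assumes "4 dvd h" "prime p"
  shows "f h p \<le> 2"
  using g_prime_power_bound[OF assms(2,1), of 1] by (simp add: f_def)

lemma f_nonneg: "f h n \<ge> 0"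
  by (simp add: f_def)

lemma sum_f_over_primes_powr:
  assumes "4 dvd h" "h > 0" "1 < \<sigma>" "\<sigma> \<le> 2"
  shows "(\<Sum>p | prime p \<and> p \<le> y. f h p * real p powr - \<sigma>)
     \<le> 3/4 * ln (8 * exp 1 / (\<sigma> - 1)) + 1/4 * ln (66 * exp 1 * (1 + ln (2 * real h)))"
proof -
  have h2: "4 dvd 2 * h" "2 * h > 0" using assms by auto
  obtain Y1 where Y1: "\<And>Y. Y \<ge> Y1 \<Longrightarrow> exp (\<Sum>q | prime q \<and> q \<le> Y. Re (g 0 q) * real q powr - \<sigma>) \<le> 2 * exp 1 * cmod (L_series 0 \<sigma>)"
    using exp_prime_sum_le_L_series[of 0 \<sigma>] assms by auto
  obtain Y2 where Y2: "\<And>Y. Y \<ge> Y2 \<Longrightarrow> exp (\<Sum>q | prime q \<and> q \<le> Y. Re (g (2 * h) q) * real q powr - \<sigma>) \<le> 2 * exp 1 * cmod (L_series (2 * h) \<sigma>)"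
    using exp_prime_sum_le_L_series[OF h2(1) assms(3)] by auto
  \<comment> \<open>All terms on the left are nonnegative, so the range of summation may be enlarged until both
    prime sums are controlled by their L-series.\<close>
  define Y where "Y = max y (max Y1 Y2)"
  have "exp (\<Sum>q | prime q \<and> q \<le> Y. Re (g 0 q) * real q powr - \<sigma>) \<le> 2 * exp 1 * cmod (L_series 0 \<sigma>)"
    by (rule Y1) (simp add: Y_def)
  also have "\<dots> \<le> 2 * exp 1 * (4 / (\<sigma> - 1))"
    using assms by (intro mult_left_mono L_series_0_bound) auto
  also have "\<dots> = 8 * exp 1 / (\<sigma> - 1)" by simp
  finally have 1: "(\<Sum>q | prime q \<and> q \<le> Y. Re (g 0 q) * real q powr - \<sigma>) \<le> ln (8 * exp 1 / (\<sigma> - 1))"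
    using assms by (subst ln_ge_iff) auto
  have "exp (\<Sum>q | prime q \<and> q \<le> Y. Re (g (2 * h) q) * real q powr - \<sigma>) \<le> 2 * exp 1 * cmod (L_series (2 * h) \<sigma>)"
    by (rule Y2) (simp add: Y_def)
  also have "\<dots> \<le> 2 * exp 1 * (33 * (1 + ln (real (2 * h))))"
    using assms h2 by (intro mult_left_mono L_series_bound) auto
  also have "\<dots> = 66 * exp 1 * (1 + ln (2 * real h))" by simp
  finally have 2: "(\<Sum>q | prime q \<and> q \<le> Y. Re (g (2 * h) q) * real q powr - \<sigma>) \<le> ln (66 * exp 1 * (1 + ln (2 * real h)))"
  proof (subst ln_ge_iff)
    have "ln (2 * real h) \<ge> 0" using assms by (intro ln_ge_zero) auto
    then show "0 < 66 * exp 1 * (1 + ln (2 * real h))" by (intro mult_pos_pos) auto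
  qed
  have "(\<Sum>p | prime p \<and> p \<le> y. f h p * real p powr - \<sigma>) \<le> (\<Sum>p | prime p \<and> p \<le> Y. f h p * real p powr - \<sigma>)"
    by (rule sum_mono2) (auto simp: Y_def f_nonneg)
  also have "\<dots> \<le> (\<Sum>p | prime p \<and> p \<le> Y. (3/4 * Re (g 0 p) + 1/4 * Re (g (2 * h) p)) * real p powr - \<sigma>)"
    by (intro sum_mono mult_right_mono f_prime_le assms) auto
  also have "\<dots> = 3/4 * (\<Sum>q | prime q \<and> q \<le> Y. Re (g 0 q) * real q powr - \<sigma>)
      + 1/4 * (\<Sum>q | prime q \<and> q \<le> Y. Re (g (2 * h) q) * real q powr - \<sigma>)"
    unfolding sum_distrib_left sum.distrib[symmetric] by (rule sum.cong) (auto simp: algebra_simps)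
  also have "\<dots> \<le> 3/4 * ln (8 * exp 1 / (\<sigma> - 1)) + 1/4 * ln (66 * exp 1 * (1 + ln (2 * real h)))"
    using 1 2 by (intro add_mono mult_left_mono) auto
  finally show ?thesis .
qed

text \<open>
  The passage from \<open>p powr - (1 + \<tau>)\<close> to \<open>1 / p\<close> with
  \<open>\<tau> = 1 / ln y\<close> costs at most \<open>\<tau> ln p / p\<close> for each prime, hence
  \<open>O(1)\<close> altogether.
\<close>

lemma sum_f_over_primes:
  fixes y :: nat
  assumes "4 dvd h" "h > 0" "y \<ge> 3"
  shows "(\<Sum>p | prime p \<and> p \<le> y. f h p / real p)
     \<le> 3/4 * ln (8 * exp 1 * ln y) + 1/4 * ln (66 * exp 1 * (1 + ln (2 * real h))) + 4"
proof -
  let ?P = "{p. prime p \<and> p \<le> y}"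
  have "exp 1 \<le> (3 :: real)" by (rule exp_le)
  then have "exp 1 \<le> real y" using assms(3) by linarith
  then have ly: "ln (real y) \<ge> 1" using assms(3) by (subst ln_ge_iff) auto
  define \<tau> where "\<tau> = 1 / ln (real y)"
  have \<tau>: "\<tau> > 0" "\<tau> \<le> 1" using ly by (auto simp: \<tau>_def divide_simps)
  have "(\<Sum>p\<in>?P. f h p / real p) \<le> (\<Sum>p\<in>?P. f h p * real p powr - (1 + \<tau>) + 2 * \<tau> * (ln (real p) / real p))"
  proof (rule sum_mono)
    fix p assume "p \<in> ?P"
    then have p: "prime p" "real p > 0" "ln (real p) \<ge> 0"
      by (auto simp: prime_gt_0_nat Suc_le_eq)
    have "1 + (- \<tau> * ln (real p)) \<le> exp (- \<tau> * ln (real p))" by (rule exp_ge_add_one_self)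
    also have "\<dots> = real p powr - \<tau>" using p by (simp add: powr_def)
    finally have "(1 - \<tau> * ln (real p)) / real p \<le> real p powr - \<tau> / real p"
      using p by (intro divide_right_mono) auto
    also have "\<dots> = real p powr (- \<tau> - 1)" using p by (simp add: powr_diff)
    also have "- \<tau> - 1 = - (1 + \<tau>)" by simp
    finally have "1 / real p - \<tau> * (ln (real p) / real p) \<le> real p powr - (1 + \<tau>)"
      by (simp add: diff_divide_distrib)
    then have "f h p * (1 / real p - \<tau> * (ln (real p) / real p)) \<le> f h p * real p powr - (1 + \<tau>)"
      by (intro mult_left_mono f_nonneg)
    moreover have "f h p * (\<tau> * (ln (real p) / real p)) \<le> 2 * (\<tau> * (ln (real p) / real p))"
      using p \<tau> f_prime_bound[OF assms(1) p(1)] by (intro mult_right_mono) auto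
    ultimately show "f h p / real p \<le> f h p * real p powr - (1 + \<tau>) + 2 * \<tau> * (ln (real p) / real p)"
      by (simp add: algebra_simps)
  qed
  also have "\<dots> = (\<Sum>p\<in>?P. f h p * real p powr - (1 + \<tau>)) + 2 * \<tau> * (\<Sum>p\<in>?P. ln (real p) / real p)"
    by (simp only: sum.distrib sum_distrib_left)
  also have "2 * \<tau> * (\<Sum>p\<in>?P. ln (real p) / real p) \<le> 2 * \<tau> * (2 * ln y)"
    using \<tau> assms by (intro mult_left_mono sum_ln_prime_over_prime) auto
  also have "\<dots> = 4" using ly by (simp add: \<tau>_def)
  also have "(\<Sum>p\<in>?P. f h p * real p powr - (1 + \<tau>))
      \<le> 3/4 * ln (8 * exp 1 / (1 + \<tau> - 1)) + 1/4 * ln (66 * exp 1 * (1 + ln (2 * real h)))"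
    using \<tau> by (intro sum_f_over_primes_powr assms) auto
  also have "8 * exp 1 / (1 + \<tau> - 1) = 8 * exp 1 * ln y" by (simp add: \<tau>_def)
  finally show ?thesis by simp
qed

section \<open>Sums over integers with small prime factors\<close>

definition smooth_upto :: "nat set \<Rightarrow> real \<Rightarrow> nat set" where
  "smooth_upto P X = {n. n > 0 \<and> real n \<le> X \<and> prime_factors n \<subseteq> P}"

lemma finite_smooth_upto [simp]: "finite (smooth_upto P X)"
proof (rule finite_subset)
  show "smooth_upto P X \<subseteq> {..nat \<lfloor>X\<rfloor>}"
    by (auto simp: smooth_upto_def le_nat_floor)
qed simp

lemma smooth_upto_mono: "X \<le> Y \<Longrightarrow> smooth_upto P X \<subseteq> smooth_upto P Y"
  by (auto simp: smooth_upto_def)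

lemma smooth_upto_divide:
  assumes "q \<ge> 1"
  shows "smooth_upto P (X / real q) \<subseteq> smooth_upto P X"
proof (cases "X \<ge> 0")
  case True
  then have "X / real q \<le> X" using assms by (simp add: divide_le_eq mult_left_le mult_le_cancel_left1)
  then show ?thesis by (rule smooth_upto_mono)
next
  case False
  then have "X / real q < 0" using assms by (simp add: divide_less_0_iff)
  then show ?thesis by (auto simp: smooth_upto_def)
qed

text \<open>
  The induction over the primes needs a bound for \<open>m\<close> that does not depend on \<open>j\<close>,
  hence \<open>X / q\<close>.
\<close>

lemma smooth_upto_insert_cases:
  assumes "prime q" "q \<notin> P" "n \<in> smooth_upto (insert q P) X"
  shows "n \<in> smooth_upto P X \<or>
    (\<exists>j m. j \<in> {1..nat \<lfloor>X\<rfloor>} \<and> m \<in> smooth_upto P (X / real q) \<and> n = q ^ j * m)"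
proof (cases "q dvd n")
  case True
  have n0: "n > 0" using assms by (simp add: smooth_upto_def)
  define j where "j = multiplicity q n"
  obtain m where m: "n = q ^ j * m" "\<not> q dvd m"
    using multiplicity_decompose'[of n q] assms(1) n0 by (metis j_def neq0_conv not_prime_unit)
  have m0: "m > 0" using n0 m by (cases m) auto
  have j1: "j \<ge> 1" using m True by (cases j) auto
  have q2: "q \<ge> 2" using assms(1) prime_ge_2_nat by blast
  have "prime_factors m \<subseteq> prime_factors n"
    using n0 m by (intro dvd_prime_factors) auto
  moreover have "q \<notin> prime_factors m" using m by (auto dest: in_prime_factors_imp_dvd)
  ultimately have pf: "prime_factors m \<subseteq> P" using assms(3) by (auto simp: smooth_upto_def)
  have "j < q ^ j" using q2 by (simp add: power_gt_expt)
  also have "q ^ j \<le> n" using m m0 by simp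
  finally have "real j \<le> X" using assms(3) by (simp add: smooth_upto_def)
  then have "j \<in> {1..nat \<lfloor>X\<rfloor>}" using j1 by (simp add: le_nat_floor)
  moreover have "real m \<le> X / real q"
  proof -
    have "q ^ 1 \<le> q ^ j" using q2 j1 by (intro power_increasing) auto
    then have "q * m \<le> n" using m by simp
    then have "real (q * m) \<le> real n" by (rule of_nat_mono)
    then have "real (q * m) \<le> X" using assms(3) unfolding smooth_upto_def by auto
    then show ?thesis using q2 by (simp add: field_simps)
  qed
  ultimately show ?thesis using m0 pf m(1) by (auto simp: smooth_upto_def)
next
  case False
  then have "q \<notin> prime_factors n" by (auto dest: in_prime_factors_imp_dvd)
  then show ?thesis using assms by (auto simp: smooth_upto_def)
qed

lemma sum_smooth_insert_le:
  fixes F :: "nat \<Rightarrow> real"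
  assumes "prime q" "q \<notin> P" "\<And>n. F n \<ge> 0"
  shows "(\<Sum>n\<in>smooth_upto (insert q P) X. F n) \<le> (\<Sum>n\<in>smooth_upto P X. F n)
    + (\<Sum>j=1..nat \<lfloor>X\<rfloor>. \<Sum>m\<in>smooth_upto P (X / real q). F (q ^ j * m))"
proof -
  let ?I = "(\<lambda>(j, m). q ^ j * m) ` ({1..nat \<lfloor>X\<rfloor>} \<times> smooth_upto P (X / real q))"
  have "(\<Sum>n\<in>smooth_upto (insert q P) X. F n) \<le> (\<Sum>n\<in>smooth_upto P X \<union> ?I. F n)"
  proof (rule sum_mono2)
    show "smooth_upto (insert q P) X \<subseteq> smooth_upto P X \<union> ?I"
      using smooth_upto_insert_cases[OF assms(1,2)] by fastforce
  qed (use assms in auto)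
  also have "\<dots> \<le> (\<Sum>n\<in>smooth_upto P X. F n) + (\<Sum>n\<in>?I. F n)"
    using assms(3) by (subst sum_Un) (auto intro!: sum_nonneg)
  also have "(\<Sum>n\<in>?I. F n) \<le> (\<Sum>z\<in>{1..nat \<lfloor>X\<rfloor>} \<times> smooth_upto P (X / real q). F ((\<lambda>(j, m). q ^ j * m) z))"
    using sum_image_le[of "{1..nat \<lfloor>X\<rfloor>} \<times> smooth_upto P (X / real q)" F "\<lambda>(j, m). q ^ j * m"] assms(3)
    by (simp add: o_def)
  also have "\<dots> = (\<Sum>j=1..nat \<lfloor>X\<rfloor>. \<Sum>m\<in>smooth_upto P (X / real q). F (q ^ j * m))"
    by (simp add: sum.cartesian_product case_prod_unfold)
  finally show ?thesis by simp
qed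

text \<open>
  An upper bound Euler product, by induction over the set of primes.
\<close>

lemma sum_multiplicative_smooth_le:
  fixes F :: "nat \<Rightarrow> real" and H :: "nat \<Rightarrow> nat \<Rightarrow> real"
  assumes "finite P" "\<And>q. q \<in> P \<Longrightarrow> prime q" "\<And>n. F n \<ge> 0" "F 1 \<le> 1"
    and "\<And>q j m. q \<in> P \<Longrightarrow> j \<ge> 1 \<Longrightarrow> m > 0 \<Longrightarrow> \<not> q dvd m \<Longrightarrow> F (q ^ j * m) \<le> H q j * F m"
    and "\<And>q j. q \<in> P \<Longrightarrow> H q j \<ge> 0"
    and "\<And>q J. q \<in> P \<Longrightarrow> 1 + (\<Sum>j=1..J. H q j) \<le> c q"
  shows "(\<Sum>n\<in>smooth_upto P X. F n) \<le> (\<Prod>q\<in>P. c q)"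
  using assms(1,2,5,6,7)
proof (induction P arbitrary: X rule: finite_induct)
  case empty
  have "smooth_upto {} X \<subseteq> {1}"
    by (auto simp: smooth_upto_def prime_factorization_empty_iff)
  then have "(\<Sum>n\<in>smooth_upto {} X. F n) \<le> (\<Sum>n\<in>{1}. F n)"
    using assms(3) by (intro sum_mono2) auto
  then show ?case using assms(4) by simp
next
  case (insert q P)
  have q: "prime q" "q \<notin> P" using insert by auto
  let ?S = "\<Sum>n\<in>smooth_upto P X. F n"
  have S: "?S \<le> (\<Prod>q\<in>P. c q)" "?S \<ge> 0" using insert assms(3) by (auto intro: sum_nonneg)
  have "(\<Sum>n\<in>smooth_upto (insert q P) X. F n) \<le> ?S
    + (\<Sum>j=1..nat \<lfloor>X\<rfloor>. \<Sum>m\<in>smooth_upto P (X / real q). F (q ^ j * m))"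
    using q assms(3) by (intro sum_smooth_insert_le)
  also have "(\<Sum>j=1..nat \<lfloor>X\<rfloor>. \<Sum>m\<in>smooth_upto P (X / real q). F (q ^ j * m))
      \<le> (\<Sum>j=1..nat \<lfloor>X\<rfloor>. H q j * ?S)"
  proof (rule sum_mono)
    fix j assume j: "j \<in> {1..nat \<lfloor>X\<rfloor>}"
    have "(\<Sum>m\<in>smooth_upto P (X / real q). F (q ^ j * m)) \<le> (\<Sum>m\<in>smooth_upto P (X / real q). H q j * F m)"
    proof (rule sum_mono)
      fix m assume m: "m \<in> smooth_upto P (X / real q)"
      have "\<not> q dvd m"
        using m q by (auto simp: smooth_upto_def in_prime_factors_iff)
      then show "F (q ^ j * m) \<le> H q j * F m"
        using insert.prems(2)[of q j m] j m by (auto simp: smooth_upto_def)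
    qed
    also have "\<dots> = H q j * (\<Sum>m\<in>smooth_upto P (X / real q). F m)"
      by (simp add: sum_distrib_left)
    also have "\<dots> \<le> H q j * ?S"
      using smooth_upto_divide[of q P X] prime_gt_0_nat[OF q(1)] insert.prems(3) assms(3)
      by (intro mult_left_mono sum_mono2) auto
    finally show "(\<Sum>m\<in>smooth_upto P (X / real q). F (q ^ j * m)) \<le> H q j * ?S" .
  qed
  also have "?S + (\<Sum>j=1..nat \<lfloor>X\<rfloor>. H q j * ?S) = (1 + (\<Sum>j=1..nat \<lfloor>X\<rfloor>. H q j)) * ?S"
    by (simp add: sum_distrib_right distrib_right)
  also have "\<dots> \<le> c q * (\<Prod>q\<in>P. c q)"
  proof (intro mult_mono S)
    show b: "1 + (\<Sum>j=1..nat \<lfloor>X\<rfloor>. H q j) \<le> c q" using insert.prems by simp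
    have "(\<Sum>j=1..nat \<lfloor>X\<rfloor>. H q j) \<ge> 0" using insert.prems by (intro sum_nonneg) auto
    then show "0 \<le> c q" using b by linarith
  qed
  finally show ?case using insert by simp
qed

lemma sum_geometric_le:
  fixes r :: real
  assumes "0 \<le> r" "r < 1"
  shows "(\<Sum>j=1..J. r ^ j) \<le> r / (1 - r)"
proof -
  have "(\<Sum>j=1..J. r ^ j) * (1 - r) = r - r ^ Suc J"
  proof (induction J)
    case (Suc J)
    have "(\<Sum>j=1..Suc J. r ^ j) * (1 - r) = (\<Sum>j=1..J. r ^ j) * (1 - r) + r ^ Suc J * (1 - r)"
      by (simp add: distrib_right)
    also have "\<dots> = (r - r ^ Suc J) + r ^ Suc J * (1 - r)"
      by (simp only: Suc)
    also have "\<dots> = r - r ^ Suc (Suc J)"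
      by (simp add: algebra_simps)
    finally show ?case .
  qed simp
  then have "(\<Sum>j=1..J. r ^ j) = (r - r ^ Suc J) / (1 - r)"
    using assms by (simp add: eq_divide_eq)
  also have "\<dots> \<le> r / (1 - r)"
    using assms by (intro divide_right_mono) auto
  finally show ?thesis .
qed

definition smooth_harmonic :: "nat set \<Rightarrow> real \<Rightarrow> real" where
  "smooth_harmonic P X = (\<Sum>n\<in>smooth_upto P X. 1 / real n)"

lemma smooth_harmonic_nonneg: "smooth_harmonic P X \<ge> 0"
  unfolding smooth_harmonic_def by (rule sum_nonneg) auto

lemma smooth_harmonic_divide: "q \<ge> 1 \<Longrightarrow> smooth_harmonic P (X / real q) \<le> smooth_harmonic P X"
  unfolding smooth_harmonic_def by (rule sum_mono2) (use smooth_upto_divide in auto)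

lemma smooth_harmonic_insert_le:
  assumes "prime q" "q \<notin> P"
  shows "smooth_harmonic (insert q P) X \<le> smooth_harmonic P X + 1 / (real q - 1) * smooth_harmonic P (X / real q)"
proof -
  have q: "real q \<ge> 2" using prime_ge_2_nat[OF assms(1)] by simp
  have "smooth_harmonic (insert q P) X \<le> smooth_harmonic P X
    + (\<Sum>j=1..nat \<lfloor>X\<rfloor>. \<Sum>m\<in>smooth_upto P (X / real q). 1 / real (q ^ j * m))"
    unfolding smooth_harmonic_def by (rule sum_smooth_insert_le[OF assms]) simp
  also have "(\<Sum>j=1..nat \<lfloor>X\<rfloor>. \<Sum>m\<in>smooth_upto P (X / real q). 1 / real (q ^ j * m))
     = (\<Sum>j=1..nat \<lfloor>X\<rfloor>. (1 / real q) ^ j) * smooth_harmonic P (X / real q)"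
    unfolding smooth_harmonic_def sum_product by (simp add: power_divide)
  also have "\<dots> \<le> (1 / real q) / (1 - 1 / real q) * smooth_harmonic P (X / real q)"
    using q by (intro mult_right_mono sum_geometric_le smooth_harmonic_nonneg) auto
  also have "(1 / real q) / (1 - 1 / real q) = 1 / (real q - 1)"
    using q by (simp add: field_simps)
  finally show ?thesis by simp
qed

text \<open>
  The number of removed classes modulo \<open>q\<close> divided by the number of remaining ones.
\<close>

definition selberg_weight :: "nat \<Rightarrow> real" where
  "selberg_weight q = 2 / (real q - 2)"

definition selberg_sum :: "nat set \<Rightarrow> real \<Rightarrow> real" where
  "selberg_sum Q Z = (\<Sum>D | D \<subseteq> Q \<and> real (\<Prod>D) \<le> Z. \<Prod>q\<in>D. selberg_weight q)"

lemma selberg_sum_insert: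
  assumes "finite Q" "q \<notin> Q" "q > 0"
  shows "selberg_sum (insert q Q) Z = selberg_sum Q Z + selberg_weight q * selberg_sum Q (Z / real q)"
proof -
  let ?A = "{D. D \<subseteq> Q \<and> real (\<Prod>D) \<le> Z}" and ?B = "{D. D \<subseteq> Q \<and> real (\<Prod>D) \<le> Z / real q}"
  have fin: "finite D" "q \<notin> D" if "D \<subseteq> Q" for D
    using that assms finite_subset by auto
  have prodins: "\<Prod>(insert q D) = q * \<Prod>D" if "D \<subseteq> Q" for D
    using fin[OF that] by simp
  have "{D. D \<subseteq> insert q Q \<and> real (\<Prod>D) \<le> Z} = ?A \<union> insert q ` ?B"
  proof (intro equalityI subsetI)
    fix D assume D: "D \<in> {D. D \<subseteq> insert q Q \<and> real (\<Prod>D) \<le> Z}"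
    show "D \<in> ?A \<union> insert q ` ?B"
    proof (cases "q \<in> D")
      case True
      define E where "E = D - {q}"
      have E: "E \<subseteq> Q" "D = insert q E" using D True by (auto simp: E_def)
      have "real (\<Prod>D) = real q * real (\<Prod>E)" unfolding E(2) prodins[OF E(1)] by simp
      then have "real q * real (\<Prod>E) \<le> Z" using D by simp
      then have "real (\<Prod>E) \<le> Z / real q" using assms(3) by (simp add: field_simps)
      then show ?thesis using E by blast
    qed (use D in auto)
  next
    fix D assume "D \<in> ?A \<union> insert q ` ?B"
    then show "D \<in> {D. D \<subseteq> insert q Q \<and> real (\<Prod>D) \<le> Z}"
    proof
      assume "D \<in> insert q ` ?B"
      then obtain E where E: "E \<in> ?B" "D = insert q E" by blast
      then have "real q * real (\<Prod>E) \<le> Z" using assms(3) by (simp add: field_simps)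
      moreover have "real (\<Prod>D) = real q * real (\<Prod>E)" using E prodins[of E] by simp
      ultimately show ?thesis using E by auto
    qed auto
  qed
  moreover have "finite ?A" "finite ?B" using assms(1) by auto
  moreover have "?A \<inter> insert q ` ?B = {}" using assms(2) by auto
  moreover have "inj_on (insert q) ?B" using assms(2) by (auto simp: inj_on_def)
  ultimately have "selberg_sum (insert q Q) Z = selberg_sum Q Z + (\<Sum>D\<in>?B. \<Prod>r\<in>insert q D. selberg_weight r)"
    unfolding selberg_sum_def by (simp add: sum.union_disjoint sum.reindex)
  also have "(\<Sum>D\<in>?B. \<Prod>r\<in>insert q D. selberg_weight r) = (\<Sum>D\<in>?B. selberg_weight q * (\<Prod>r\<in>D. selberg_weight r))"
    by (rule sum.cong) (use fin in auto)
  finally show ?thesis by (simp add: selberg_sum_def sum_distrib_left)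
qed

lemma selberg_weight_nonneg: "q \<ge> 3 \<Longrightarrow> selberg_weight q \<ge> 0"
  by (simp add: selberg_weight_def)

lemma selberg_sum_mono:
  assumes "finite Q" "\<And>q. q \<in> Q \<Longrightarrow> q \<ge> 3" "Z \<le> Z'"
  shows "selberg_sum Q Z \<le> selberg_sum Q Z'"
  unfolding selberg_sum_def using assms
  by (intro sum_mono2) (auto intro!: prod_nonneg selberg_weight_nonneg)

lemma selberg_sum_nonneg:
  assumes "\<And>q. q \<in> Q \<Longrightarrow> q \<ge> 3"
  shows "selberg_sum Q Z \<ge> 0"
  unfolding selberg_sum_def using assms
  by (intro sum_nonneg prod_nonneg selberg_weight_nonneg) auto

text \<open>
  This bounds the main term of the sieve from below. Adding a prime \<open>q\<close> to \<open>P\<close> changes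
  each factor on the left by a multiple \<open>t = 1 / (q - 1)\<close> of its value at \<open>X / q\<close>. If
  \<open>q\<close> is sifted, the product gains at most \<open>(2 t + t\<^sup>2)\<close> times its bound at
  \<open>X Y / q\<close>, and \<open>2 t + t\<^sup>2 \<le> 2 / (q - 2)\<close> is the weight of \<open>q\<close>
  in the sieve. Two factors are needed because two classes are removed modulo \<open>q\<close>.
\<close>

lemma smooth_harmonic_product_le:
  assumes "finite P" "\<And>q. q \<in> P \<Longrightarrow> prime q" "\<And>q. q \<in> P \<Longrightarrow> good q \<Longrightarrow> q \<ge> 3" "X \<ge> 0" "Y \<ge> 0"
  shows "smooth_harmonic P X * smooth_harmonic P Y
     \<le> (\<Prod>q\<in>{q \<in> P. \<not> good q}. (real q / (real q - 1))\<^sup>2) * selberg_sum {q \<in> P. good q} (X * Y)"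
  using assms
proof (induction P arbitrary: X Y rule: finite_induct)
  case empty
  have H: "smooth_harmonic {} X = (if X \<ge> 1 then 1 else 0)" for X
  proof -
    have "smooth_upto {} X = (if X \<ge> 1 then {1} else {})"
      by (auto simp: smooth_upto_def prime_factorization_empty_iff)
    then show ?thesis by (simp add: smooth_harmonic_def)
  qed
  have G: "selberg_sum {} Z = (if Z \<ge> 1 then 1 else 0)" for Z
  proof -
    have "{D. D \<subseteq> {} \<and> real (\<Prod>D) \<le> Z} = (if Z \<ge> 1 then {{}} else {})" by auto
    then show ?thesis by (simp add: selberg_sum_def)
  qed
  have "1 \<le> X * Y" if "1 \<le> X" "1 \<le> Y" using mult_mono[OF that] that by simp
  then show ?case by (simp add: H G)
next
  case (insert q P)
  have q: "prime q" "q \<notin> P" using insert by auto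
  then have q2: "real q \<ge> 2" using prime_ge_2_nat by (metis numeral_le_real_of_nat_iff)
  have q0: "q > 0" "q \<ge> 1" using prime_gt_0_nat[OF q(1)] by auto
  define K where "K = (\<Prod>q\<in>{q \<in> P. \<not> good q}. (real q / (real q - 1))\<^sup>2)"
  let ?Q = "{q \<in> P. good q}" and ?B = "smooth_harmonic P" and ?t = "1 / (real q - 1)"
  have K0: "K \<ge> 0" unfolding K_def by (intro prod_nonneg) auto
  have t0: "?t \<ge> 0" using q2 by simp
  have IH: "?B X * ?B Y \<le> K * selberg_sum ?Q (X * Y)" if "X \<ge> 0" "Y \<ge> 0" for X Y
    unfolding K_def using insert that by auto
  have Q: "finite ?Q" "\<And>q. q \<in> ?Q \<Longrightarrow> q \<ge> 3" using insert by auto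
  have B0: "?B x \<ge> 0" for x by (rule smooth_harmonic_nonneg)
  have XY: "X \<ge> 0" "Y \<ge> 0" "X / real q \<ge> 0" "Y / real q \<ge> 0" using insert by auto
  have "smooth_harmonic (insert q P) X * smooth_harmonic (insert q P) Y
     \<le> (?B X + ?t * ?B (X / q)) * (?B Y + ?t * ?B (Y / q))"
    using t0 by (intro mult_mono smooth_harmonic_insert_le q) (use t0 in \<open>auto intro!: add_nonneg_nonneg mult_nonneg_nonneg divide_nonneg_nonneg B0 smooth_harmonic_nonneg\<close>)
  also have "\<dots> \<le> (\<Prod>q\<in>{r \<in> insert q P. \<not> good r}. (real q / (real q - 1))\<^sup>2) * selberg_sum {r \<in> insert q P. good r} (X * Y)"
  proof (cases "good q")
    case False
    have "(?B X + ?t * ?B (X / q)) * (?B Y + ?t * ?B (Y / q)) \<le> (?B X + ?t * ?B X) * (?B Y + ?t * ?B Y)"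
      using t0 q0 by (intro mult_mono add_mono mult_left_mono smooth_harmonic_divide) (use t0 in \<open>auto intro!: add_nonneg_nonneg mult_nonneg_nonneg divide_nonneg_nonneg B0\<close>)
    also have "\<dots> = (1 + ?t)\<^sup>2 * (?B X * ?B Y)"
      by (simp only: power2_eq_square) (simp add: algebra_simps)
    also have "1 + ?t = real q / (real q - 1)" using q2 by (simp add: field_simps)
    also have "(real q / (real q - 1))\<^sup>2 * (?B X * ?B Y) \<le> (real q / (real q - 1))\<^sup>2 * (K * selberg_sum ?Q (X * Y))"
      using XY by (intro mult_left_mono IH) auto
    also have "{r \<in> insert q P. good r} = ?Q" using False by auto
    moreover have "{r \<in> insert q P. \<not> good r} = insert q {r \<in> P. \<not> good r}" using False by auto
    ultimately show ?thesis using insert(1) q(2) by (simp add: K_def mult.assoc)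
  next
    case True
    then have q3: "real q \<ge> 3" using insert.prems(2)[of q] by simp
    let ?G = "selberg_sum ?Q"
    have "(?B X + ?t * ?B (X / q)) * (?B Y + ?t * ?B (Y / q))
      = ?B X * ?B Y + ?t * (?B (X / q) * ?B Y) + ?t * (?B X * ?B (Y / q)) + ?t\<^sup>2 * (?B (X / q) * ?B (Y / q))"
      by (simp only: power2_eq_square) (simp add: algebra_simps)
    also have "\<dots> \<le> K * ?G (X * Y) + ?t * (K * ?G (X / q * Y)) + ?t * (K * ?G (X * (Y / q))) + ?t\<^sup>2 * (K * ?G (X / q * (Y / q)))"
      using XY t0 by (intro add_mono mult_left_mono IH) auto
    also have "\<dots> \<le> K * ?G (X * Y) + ?t * (K * ?G (X * Y / q)) + ?t * (K * ?G (X * Y / q)) + ?t\<^sup>2 * (K * ?G (X * Y / q))"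
    proof -
      have "X / q * (Y / q) \<le> X * Y / q"
      proof -
        have "X * Y / q / q \<le> X * Y / q / 1"
          using XY q2 by (intro divide_left_mono) (auto intro!: divide_nonneg_nonneg mult_nonneg_nonneg)
        then show ?thesis by simp
      qed
      then have "?G (X / q * (Y / q)) \<le> ?G (X * Y / q)" by (intro selberg_sum_mono Q)
      then show ?thesis using K0 q0 by (intro add_mono mult_left_mono) auto
    qed
    also have "\<dots> = K * (?G (X * Y) + (2 * ?t + ?t\<^sup>2) * ?G (X * Y / q))"
      by (simp add: algebra_simps)
    also have "\<dots> \<le> K * (?G (X * Y) + selberg_weight q * ?G (X * Y / q))"
    proof (intro mult_left_mono add_left_mono mult_right_mono K0 selberg_sum_nonneg Q)
      have "(2 * (real q - 1) + 1) * (real q - 2) \<le> 2 * (real q - 1)\<^sup>2"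
        using q3 by (simp add: power2_eq_square algebra_simps)
      then have "(2 * (real q - 1) + 1) / (real q - 1)\<^sup>2 \<le> 2 / (real q - 2)"
        using q3 by (simp add: divide_simps)
      moreover have "2 * ?t + ?t\<^sup>2 = (2 * (real q - 1) + 1) / (real q - 1)\<^sup>2"
      proof -
        have "2 * (1 / t) + (1 / t)\<^sup>2 = (2 * t + 1) / t\<^sup>2" if "t \<noteq> 0" for t :: real
          using that by (simp add: field_simps power2_eq_square)
        then show ?thesis using q3 by force
      qed
      ultimately show "2 * ?t + ?t\<^sup>2 \<le> selberg_weight q" by (simp add: selberg_weight_def)
    qed auto
    also have "?G (X * Y) + selberg_weight q * ?G (X * Y / q) = selberg_sum (insert q ?Q) (X * Y)"
      using Q q q0 by (subst selberg_sum_insert) auto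
    also have "insert q ?Q = {r \<in> insert q P. good r}" using True by auto
    moreover have "{r \<in> P. \<not> good r} = {r \<in> insert q P. \<not> good r}" using True by auto
    ultimately show ?thesis by (simp add: K_def)
  qed
  finally show ?case .
qed

lemma ln_le_sum_inverse: "ln (real n + 1) \<le> (\<Sum>m=1..n. 1 / real m)"
proof (induction n)
  case (Suc n)
  have "ln ((real n + 2) / (real n + 1)) \<le> (real n + 2) / (real n + 1) - 1"
    by (rule ln_le_minus_one) auto
  also have "\<dots> = 1 / (real n + 1)" by (simp add: field_simps)
  finally have "ln (real n + 2) - ln (real n + 1) \<le> 1 / (real n + 1)"
    by (simp add: ln_div)
  then show ?case using Suc by (simp add: add.commute)
qed simp

lemma smooth_harmonic_ge_ln:
  assumes "z \<ge> 1"
  shows "ln z \<le> smooth_harmonic {p. prime p \<and> real p \<le> z} z"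
proof -
  define n where "n = nat \<lfloor>z\<rfloor>"
  have "z \<le> real n + 1" using assms unfolding n_def by linarith
  then have "ln z \<le> ln (real n + 1)" using assms by (subst ln_le_cancel_iff) auto
  also have "\<dots> \<le> (\<Sum>m=1..n. 1 / real m)" by (rule ln_le_sum_inverse)
  also have "\<dots> \<le> smooth_harmonic {p. prime p \<and> real p \<le> z} z"
    unfolding smooth_harmonic_def
  proof (rule sum_mono2)
    show "{1..n} \<subseteq> smooth_upto {p. prime p \<and> real p \<le> z} z"
    proof
      fix m assume m: "m \<in> {1..n}"
      then have mz: "real m \<le> z" using assms by (simp add: n_def le_nat_iff le_floor_iff)
      have "real p \<le> z" if "p \<in> prime_factors m" for p
      proof -
        have "p \<le> m" using that m by (intro dvd_imp_le) (auto simp: in_prime_factors_iff)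
        then show ?thesis using mz by linarith
      qed
      then show "m \<in> smooth_upto {p. prime p \<and> real p \<le> z} z"
        using m mz by (auto simp: smooth_upto_def)
    qed
  qed auto
  finally show ?thesis .
qed

section \<open>An upper bound sieve removing two residue classes modulo each prime\<close>

lemma sum_crt:
  fixes F K :: "nat \<Rightarrow> real"
  assumes "coprime q D" "q > 0" "D > 0" "\<And>m. F (m mod q) = F m" "\<And>m. K (m mod D) = K m"
  shows "(\<Sum>m<q*D. F m * K m) = (\<Sum>r<q. F r) * (\<Sum>s<D. K s)"
proof -
  let ?h = "\<lambda>m. (m mod q, m mod D)"
  have inj: "inj_on ?h {..<q*D}"
  proof (rule inj_onI)
    fix m n assume mn: "m \<in> {..<q*D}" "n \<in> {..<q*D}" "?h m = ?h n"
    have "int q dvd int m - int n" "int D dvd int m - int n"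
      using mn(3) by (metis Pair_inject mod_eq_dvd_iff of_nat_mod)+
    then have "int q * int D dvd int m - int n"
      using assms(1) by (intro divides_mult) auto
    then have "int m mod int (q * D) = int n mod int (q * D)"
      by (simp add: mod_eq_dvd_iff)
    then have "m mod (q * D) = n mod (q * D)"
      by (metis of_nat_eq_iff of_nat_mod)
    then show "m = n" using mn by simp
  qed
  have "?h ` {..<q*D} = {..<q} \<times> {..<D}"
  proof (rule card_subset_eq)
    show "card (?h ` {..<q*D}) = card ({..<q} \<times> {..<D})"
      using inj by (simp add: card_image card_cartesian_product)
  qed (use assms in auto)
  then have bij: "bij_betw ?h {..<q*D} ({..<q} \<times> {..<D})"
    using inj by (simp add: bij_betw_def)
  have "(\<Sum>m<q*D. F m * K m) = (\<Sum>m<q*D. (\<lambda>(r, s). F r * K s) (?h m))"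
    using assms by simp
  also have "\<dots> = (\<Sum>(r, s)\<in>{..<q} \<times> {..<D}. F r * K s)"
    by (rule sum.reindex_bij_betw[OF bij])
  also have "\<dots> = (\<Sum>r<q. F r) * (\<Sum>s<D. K s)"
    by (simp add: sum_product sum.cartesian_product)
  finally show ?thesis .
qed

lemma sum_crt_prod:
  fixes F :: "nat \<Rightarrow> nat \<Rightarrow> real"
  assumes "finite U" "\<And>q. q \<in> U \<Longrightarrow> prime q" "\<And>q m. q \<in> U \<Longrightarrow> F q (m mod q) = F q m"
  shows "(\<Sum>m<\<Prod>U. \<Prod>q\<in>U. F q m) = (\<Prod>q\<in>U. \<Sum>r<q. F q r)"
  using assms
proof (induction U rule: finite_induct)
  case (insert q U)
  have q: "prime q" "q > 0" using insert by (auto simp: prime_gt_0_nat)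
  have "coprime q (\<Prod>U)"
    using insert by (intro prod_coprime_right) (auto intro!: primes_coprime)
  moreover have "\<Prod>U > 0"
    using insert by (intro prod_pos) (auto simp: prime_gt_0_nat)
  moreover have "(\<Prod>r\<in>U. F r (m mod \<Prod>U)) = (\<Prod>r\<in>U. F r m)" for m
  proof (rule prod.cong)
    fix r assume r: "r \<in> U"
    then have "r dvd \<Prod>U" using insert by (intro dvd_prodI) auto
    then have "m mod \<Prod>U mod r = m mod r" by (rule mod_mod_cancel)
    then show "F r (m mod \<Prod>U) = F r m"
      using insert.prems(2)[of r] r by (metis insertCI)
  qed simp
  ultimately have "(\<Sum>m<q*\<Prod>U. F q m * (\<Prod>r\<in>U. F r m)) = (\<Sum>r<q. F q r) * (\<Sum>s<\<Prod>U. \<Prod>r\<in>U. F r s)"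
    using insert q by (intro sum_crt) auto
  then show ?case using insert by simp
qed simp

lemma sum_periodic_le:
  fixes K :: "nat \<Rightarrow> real"
  assumes "D > 0" "\<And>m. K (m mod D) = K m" "\<And>m. \<bar>K m\<bar> \<le> B" "(\<Sum>s<D. K s) = real D * c" "c \<ge> 0"
  shows "(\<Sum>m<M. K m) \<le> real M * c + real D * B"
proof -
  have block: "(\<Sum>m<n*D. K m) = n * (\<Sum>s<D. K s)" for n
  proof (induction n)
    case (Suc n)
    have "(\<Sum>m<Suc n*D. K m) = (\<Sum>m<n*D. K m) + (\<Sum>m\<in>{n*D..<n*D+D}. K m)"
      by (subst sum.union_disjoint[symmetric]) (auto intro!: sum.cong)
    also have "(\<Sum>m\<in>{n*D..<n*D+D}. K m) = (\<Sum>s<D. K (s + n * D))"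
      using sum.shift_bounds_nat_ivl[of K 0 "n*D" D] by (simp add: add.commute lessThan_atLeast0)
    also have "\<dots> = (\<Sum>s<D. K s)"
    proof (rule sum.cong)
      fix s show "K (s + n * D) = K s" using assms(2)[of "s + n * D"] assms(2)[of s] by simp
    qed simp
    finally show ?case using Suc by (simp add: algebra_simps)
  qed simp
  have M: "M = M div D * D + M mod D" by simp
  have "(\<Sum>m<M. K m) = (\<Sum>m<M div D * D. K m) + (\<Sum>m\<in>{M div D * D..<M}. K m)"
  proof (subst sum.union_disjoint[symmetric])
    have "M div D * D \<le> M" by (metis M le_add1)
    then show "(\<Sum>m<M. K m) = (\<Sum>m\<in>{..<M div D * D} \<union> {M div D * D..<M}. K m)"
      by (simp add: ivl_disj_un_one(2))
  qed auto
  also have "(\<Sum>m<M div D * D. K m) = real (M div D * D) * c"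
    unfolding block assms(4) by simp
  also have "\<dots> \<le> real M * c" using assms(5) by (intro mult_right_mono of_nat_mono) auto
  also have "(\<Sum>m\<in>{M div D * D..<M}. K m) \<le> real (card {M div D * D..<M}) * B"
    by (rule sum_bounded_above) (use assms(3) abs_le_D1 in blast)
  also have "real (card {M div D * D..<M}) * B \<le> real D * B"
  proof (intro mult_right_mono of_nat_mono)
    have "M - M div D * D = M mod D" by (simp add: minus_div_mult_eq_mod)
    then show "card {M div D * D..<M} \<le> D" using assms(1) by (simp add: less_imp_le)
    show "B \<ge> 0" using assms(3)[of 0] by linarith
  qed
  finally show ?thesis by simp
qed

lemma prime_factors_prod_primes:
  assumes "finite D" "\<And>q. q \<in> D \<Longrightarrow> prime q"
  shows "{q. prime q \<and> q dvd \<Prod>D} = (D :: nat set)"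
proof (intro equalityI subsetI)
  fix q assume q: "q \<in> {q. prime q \<and> q dvd \<Prod>D}"
  then obtain r where "r \<in> D" "q dvd r"
    using assms(1) prime_dvd_prod_iff[of D q "\<lambda>x. x"] by auto
  then show "q \<in> D" using q assms(2) by (metis mem_Collect_eq primes_dvd_imp_eq)
qed (use assms in \<open>auto intro: dvd_prodI\<close>)

text \<open>
  Selberg's sieve in dual form. Let \<open>\<psi> q\<close> be \<open>-1\<close> on the two removed classes and
  \<open>2 / (q - 2)\<close> on the others. It has mean value 0 and mean square \<open>2 / (q - 2)\<close>
  modulo \<open>q\<close>. Hence the products \<open>\<Psi> D\<close> of the \<open>\<psi> q\<close> over
  \<open>q \<in> D\<close> are orthogonal over full periods, and on an interval up to small errors. The sum
  \<open>T\<close> of all \<open>\<Psi> D\<close> with \<open>\<Prod>D \<le> Z\<close> is constant and equal to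
  the sieve sum on \<open>S\<close>; so the number of elements of \<open>S\<close> is controlled by the sum of
  \<open>T\<^sup>2\<close> over the whole interval.
\<close>

lemma selberg_sieve_two_classes:
  fixes bad :: "nat \<Rightarrow> nat \<Rightarrow> bool"
  assumes Q: "finite Q" "\<And>q. q \<in> Q \<Longrightarrow> prime q" "\<And>q. q \<in> Q \<Longrightarrow> q \<ge> 3"
    and bad: "\<And>q m. q \<in> Q \<Longrightarrow> bad q (m mod q) = bad q m" "\<And>q. q \<in> Q \<Longrightarrow> card {r. r < q \<and> bad q r} = 2"
    and S: "S \<subseteq> {..<M}" "\<And>m q. m \<in> S \<Longrightarrow> q \<in> Q \<Longrightarrow> \<not> bad q m"
    and Z: "Z \<ge> 1"
  shows "real (card S) * (selberg_sum Q Z)\<^sup>2 \<le> real M * selberg_sum Q Z + 4 * Z ^ 4"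
proof -
  define \<D> where "\<D> = {D. D \<subseteq> Q \<and> real (\<Prod>D) \<le> Z}"
  define \<psi> where "\<psi> = (\<lambda>q m. if bad q m then - 1 else selberg_weight q)"
  define \<Psi> where "\<Psi> = (\<lambda>D m. \<Prod>q\<in>D. \<psi> q m)"
  define T where "T = (\<lambda>m. \<Sum>D\<in>\<D>. \<Psi> D m)"
  let ?G = "selberg_sum Q Z"
  have fin\<D>: "finite \<D>" using Q(1) by (auto simp: \<D>_def)
  have D: "finite D" "D \<subseteq> Q" "real (\<Prod>D) \<le> Z" if "D \<in> \<D>" for D
    using that Q(1) finite_subset by (auto simp: \<D>_def)
  \<comment> \<open>Distinct sets of primes have distinct products, so there are at most \<open>Z\<close> of
    them.\<close>
  have card\<D>: "real (card \<D>) \<le> Z"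
  proof -
    have "inj_on (\<lambda>D. \<Prod>D) \<D>"
    proof (rule inj_onI)
      fix D E assume DE: "D \<in> \<D>" "E \<in> \<D>" "\<Prod>D = \<Prod>E"
      show "D = E"
        using prime_factors_prod_primes[of D] prime_factors_prod_primes[of E] D[OF DE(1)] D[OF DE(2)] Q(2) DE(3)
        by (metis subsetD)
    qed
    moreover have "(\<lambda>D. \<Prod>D) ` \<D> \<subseteq> {1..nat \<lfloor>Z\<rfloor>}"
    proof
      fix n assume "n \<in> (\<lambda>D. \<Prod>D) ` \<D>"
      then obtain D' where D': "D' \<in> \<D>" "n = \<Prod>D'" by blast
      have "\<Prod>D' > 0" using D(2)[OF D'(1)] Q(2) by (intro prod_pos) (auto simp: prime_gt_0_nat)
      then show "n \<in> {1..nat \<lfloor>Z\<rfloor>}" using D(3)[OF D'(1)] D'(2) by (simp add: le_nat_floor)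
    qed
    ultimately have "card \<D> \<le> card {1..nat \<lfloor>Z\<rfloor>}" by (intro card_inj_on_le) auto
    then show ?thesis using Z by (simp add: le_nat_iff le_floor_iff)
  qed
  have \<psi>per: "\<psi> q (m mod q) = \<psi> q m" if "q \<in> Q" for q m
    using bad(1)[OF that] by (simp add: \<psi>_def)
  have sums: "(\<Sum>r<q. \<psi> q r) = 0" "(\<Sum>r<q. \<psi> q r * \<psi> q r) = real q * selberg_weight q" if q: "q \<in> Q" for q
  proof -
    have q3: "real q \<ge> 3" using Q(3)[OF q] by simp
    have split: "(\<Sum>r<q. H (bad q r)) = 2 * H True + (real q - 2) * H False" for H :: "bool \<Rightarrow> real"
    proof -
      have c: "card {r \<in> {..<q}. bad q r} = 2" using bad(2)[OF q] by (simp add: lessThan_def Collect_conj_eq[symmetric])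
      have "card {r \<in> {..<q}. \<not> bad q r} = card ({..<q} - {r \<in> {..<q}. bad q r})"
        by (rule arg_cong[of _ _ card]) auto
      also have "\<dots> = q - 2" using c by (subst card_Diff_subset) auto
      finally have c': "card {r \<in> {..<q}. \<not> bad q r} = q - 2" .
      have "(\<Sum>r<q. H (bad q r)) = (\<Sum>r<q. (if bad q r then H True else 0) + (if \<not> bad q r then H False else 0))"
        by (rule sum.cong) auto
      also have "\<dots> = (\<Sum>r\<in>{r \<in> {..<q}. bad q r}. H True) + (\<Sum>r\<in>{r \<in> {..<q}. \<not> bad q r}. H False)"
        by (simp only: sum.distrib sum.inter_filter finite_lessThan)
      also have "\<dots> = 2 * H True + (real q - 2) * H False"
        using c c' q3 by (simp add: of_nat_diff)
      finally show ?thesis .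
    qed
    show "(\<Sum>r<q. \<psi> q r) = 0"
      unfolding \<psi>_def using split[of "\<lambda>b. if b then -1 else selberg_weight q"] q3 by (simp add: selberg_weight_def field_simps)
    show "(\<Sum>r<q. \<psi> q r * \<psi> q r) = real q * selberg_weight q"
    proof -
      define w where "w = selberg_weight q"
      have inv: "x * (2 / x) = 2" if "x \<noteq> 0" for x :: real using that by simp
      have w: "(real q - 2) * w = 2"
        unfolding w_def selberg_weight_def by (rule inv) (use q3 in simp)
      have "(\<Sum>r<q. \<psi> q r * \<psi> q r) = 2 + (real q - 2) * w * w"
        using split[of "\<lambda>b. (if b then -1 else w) * (if b then -1 else w)"]
        unfolding \<psi>_def w_def[symmetric] by (simp add: mult.assoc)
      also have "\<dots> = real q * w" 
      proof -
        have "real q * w = 2 + 2 * w" using w by (simp add: algebra_simps)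
        then show ?thesis by (simp only: w)
      qed
      finally show ?thesis by (simp add: w_def)
    qed
  qed
  have \<Psi>bound: "\<bar>\<Psi> D' m\<bar> \<le> 2" if D': "D' \<in> \<D>" for D' m
  proof -
    \<comment> \<open>Only \<open>q = 3\<close> has a weight above 1.\<close>
    have "\<bar>\<Psi> D' m\<bar> = (\<Prod>q\<in>D'. \<bar>\<psi> q m\<bar>)" by (simp add: \<Psi>_def abs_prod)
    also have "\<dots> \<le> (\<Prod>q\<in>D'. if q = 3 then 2 else 1)"
    proof (intro prod_mono conjI)
      fix q assume "q \<in> D'"
      then have q: "q \<in> Q" using D[OF D'] by auto
      then have q3: "q \<ge> 3" "prime q" using Q by auto
      show "\<bar>\<psi> q m\<bar> \<le> (if q = 3 then 2 else 1)"
      proof (cases "q = 3")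
        case False
        then have "q \<ge> 4" using q3 by simp
        then have "real q \<ge> 4" by simp
        then show ?thesis using False by (simp add: \<psi>_def selberg_weight_def)
      qed (simp add: \<psi>_def selberg_weight_def)
    qed simp
    also have "\<dots> \<le> 2" using D(1)[OF D'] by (simp add: prod.delta)
    finally show ?thesis .
  qed
  have orth: "(\<Sum>m<M. \<Psi> D1 m * \<Psi> D2 m) \<le> (if D1 = D2 then real M * (\<Prod>q\<in>D1. selberg_weight q) else 0) + 4 * Z\<^sup>2"
    if D12: "D1 \<in> \<D>" "D2 \<in> \<D>" for D1 D2
  proof -
    \<comment> \<open>The product \<open>\<Psi> D1 * \<Psi> D2\<close> has period
      \<open>\<Prod>(D1 \<union> D2) \<le> Z\<^sup>2\<close>. If \<open>D1 \<noteq> D2\<close>, some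
      \<open>\<psi> q\<close> occurs in it exactly once, and its sum over a period vanishes.\<close>
    define U where "U = D1 \<union> D2"
    define F where "F = (\<lambda>q m. (if q \<in> D1 then \<psi> q m else 1) * (if q \<in> D2 then \<psi> q m else 1))"
    have U: "finite U" "U \<subseteq> Q" using D[OF D12(1)] D[OF D12(2)] by (auto simp: U_def)
    have "\<Psi> D1 m * \<Psi> D2 m = (\<Prod>q\<in>U. F q m)" for m
    proof -
      have "\<Psi> D1 m = (\<Prod>q\<in>U. if q \<in> D1 then \<psi> q m else 1)" "\<Psi> D2 m = (\<Prod>q\<in>U. if q \<in> D2 then \<psi> q m else 1)"
        unfolding \<Psi>_def using U(1)
        by (auto simp: U_def prod.inter_restrict[symmetric] Int_absorb1 Int_absorb2 simp flip: prod.inter_restrict)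
      then show ?thesis by (simp add: F_def prod.distrib)
    qed
    note \<Psi>F = this
    have U0: "\<Prod>U > 0" using U Q(2) by (intro prod_pos) (auto simp: prime_gt_0_nat)
    have Fper: "F q (m mod q) = F q m" if "q \<in> U" for q m
      using \<psi>per[of q m] that U by (auto simp: F_def)
    have "\<Prod>U \<le> \<Prod>D1 * \<Prod>D2"
    proof -
      have "\<Prod>U * \<Prod>(D1 \<inter> D2) = \<Prod>D1 * \<Prod>D2"
        unfolding U_def using D[OF D12(1)] D[OF D12(2)] by (intro prod.union_inter) auto
      moreover have "\<Prod>(D1 \<inter> D2) > 0"
        using D[OF D12(1)] Q(2) by (intro prod_pos) (auto simp: prime_gt_0_nat)
      then have "\<Prod>(D1 \<inter> D2) \<ge> 1" by simp
      ultimately show ?thesis by (metis mult.right_neutral mult_le_mono2)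
    qed
    then have "real (\<Prod>U) \<le> real (\<Prod>D1 * \<Prod>D2)" by (rule of_nat_mono)
    also have "\<dots> = real (\<Prod>D1) * real (\<Prod>D2)" by simp
    also have "\<dots> \<le> Z * Z" using D[OF D12(1)] D[OF D12(2)] Z by (intro mult_mono) (auto intro: prod_nonneg)
    finally have UZ: "real (\<Prod>U) \<le> Z\<^sup>2" by (simp add: power2_eq_square)
    define c where "c = (if D1 = D2 then (\<Prod>q\<in>D1. selberg_weight q) else 0)"
    have per: "(\<Sum>m<\<Prod>U. \<Psi> D1 m * \<Psi> D2 m) = real (\<Prod>U) * c"
    proof (cases "D1 = D2")
      case True
      have "(\<Sum>m<\<Prod>U. \<Psi> D1 m * \<Psi> D2 m) = (\<Prod>q\<in>U. \<Sum>r<q. F q r)"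
        unfolding \<Psi>F using U Q(2) Fper by (intro sum_crt_prod) auto
      also have "\<dots> = (\<Prod>q\<in>U. real q * selberg_weight q)"
        by (rule prod.cong) (use True U sums(2) in \<open>auto simp: F_def U_def\<close>)
      also have "\<dots> = real (\<Prod>U) * c" using True by (simp add: c_def U_def prod.distrib)
      finally show ?thesis .
    next
      case False
      then obtain q where q: "q \<in> U" "(q \<in> D1) \<noteq> (q \<in> D2)" by (auto simp: U_def)
      then have "(\<Sum>r<q. F q r) = 0" using sums(1)[of q] U by (auto simp: F_def)
      then have "(\<Prod>q\<in>U. \<Sum>r<q. F q r) = 0" using U(1) q(1) by (metis prod_zero)
      moreover have "(\<Sum>m<\<Prod>U. \<Psi> D1 m * \<Psi> D2 m) = (\<Prod>q\<in>U. \<Sum>r<q. F q r)"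
        unfolding \<Psi>F using U Q(2) Fper by (intro sum_crt_prod) auto
      ultimately show ?thesis using False by (simp add: c_def)
    qed
    have "(\<Sum>m<M. \<Psi> D1 m * \<Psi> D2 m) \<le> real M * c + real (\<Prod>U) * 4"
    proof (rule sum_periodic_le[OF U0 _ _ per])
      fix m
      show "\<Psi> D1 (m mod \<Prod>U) * \<Psi> D2 (m mod \<Prod>U) = \<Psi> D1 m * \<Psi> D2 m"
        unfolding \<Psi>F
      proof (rule prod.cong)
        fix r assume r: "r \<in> U"
        then have "r dvd \<Prod>U" using U by (intro dvd_prodI) auto
        then have "m mod \<Prod>U mod r = m mod r" by (rule mod_mod_cancel)
        then show "F r (m mod \<Prod>U) = F r m" using Fper[OF r] by metis
      qed simp
      have "\<bar>\<Psi> D1 m * \<Psi> D2 m\<bar> \<le> 2 * 2"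
        unfolding abs_mult using \<Psi>bound D12 by (intro mult_mono) auto
      then show "\<bar>\<Psi> D1 m * \<Psi> D2 m\<bar> \<le> 4" by simp
      show "c \<ge> 0" unfolding c_def using D(2)[OF D12(1)] Q(3) by (auto intro!: prod_nonneg selberg_weight_nonneg)
    qed
    also have "\<dots> \<le> real M * c + Z\<^sup>2 * 4" using UZ by simp
    finally show ?thesis by (cases "D1 = D2") (simp_all add: c_def mult.commute)
  qed
  have TS: "T m = ?G" if "m \<in> S" for m
    unfolding T_def selberg_sum_def \<D>_def[symmetric] \<Psi>_def
    by (intro sum.cong prod.cong) (use S(2)[OF that] D in \<open>auto simp: \<psi>_def\<close>)
  have finS: "finite S" using S(1) finite_subset by blast
  have "real (card S) * ?G\<^sup>2 = (\<Sum>m\<in>S. (T m)\<^sup>2)" using TS by simp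
  also have "\<dots> \<le> (\<Sum>m<M. (T m)\<^sup>2)" using S(1) by (intro sum_mono2) auto
  also have "\<dots> = (\<Sum>m<M. \<Sum>D1\<in>\<D>. \<Sum>D2\<in>\<D>. \<Psi> D1 m * \<Psi> D2 m)"
    by (simp add: T_def power2_eq_square sum_product)
  also have "\<dots> = (\<Sum>D1\<in>\<D>. \<Sum>D2\<in>\<D>. \<Sum>m<M. \<Psi> D1 m * \<Psi> D2 m)"
    by (subst sum.swap, rule sum.cong, simp, rule sum.swap)
  also have "\<dots> \<le> (\<Sum>D1\<in>\<D>. \<Sum>D2\<in>\<D>. (if D1 = D2 then real M * (\<Prod>q\<in>D1. selberg_weight q) else 0) + 4 * Z\<^sup>2)"
    by (intro sum_mono orth)
  also have "\<dots> = real M * ?G + real (card \<D>) * real (card \<D>) * (4 * Z\<^sup>2)"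
    unfolding selberg_sum_def \<D>_def[symmetric]
    using fin\<D> by (simp add: sum.distrib sum.delta sum_distrib_left)
  also have "\<dots> \<le> real M * ?G + Z * Z * (4 * Z\<^sup>2)"
    using card\<D> Z by (intro add_left_mono mult_right_mono mult_mono) auto
  finally show ?thesis by (simp add: power2_eq_square power4_eq_xxxx)
qed

section \<open>Estimates for f and for the sifted sets\<close>

text \<open>
  For \<open>s \<le> 3/5\<close> the terms \<open>(i + 3) s ^ i\<close> decay at least like
  \<open>(4/5) ^ i\<close>.
\<close>

lemma sum_arith_geometric_le:
  fixes s :: real
  assumes "0 \<le> s" "s \<le> 3 / 5"
  shows "(\<Sum>j=2..J. (real j + 1) * s ^ j) \<le> 15 * s\<^sup>2"
proof -
  have t: "(real n + 3) * s ^ n \<le> 3 * (4 / 5) ^ n" for n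
  proof (induction n)
    case (Suc n)
    have "s ^ Suc n \<le> s ^ n * (3 / 5)"
      using assms mult_left_mono[of s "3 / 5" "s ^ n"] by (simp add: mult.commute)
    then have "(real (Suc n) + 3) * s ^ Suc n \<le> (4 / 3 * (real n + 3)) * (s ^ n * (3 / 5))"
      using assms by (intro mult_mono) auto
    also have "\<dots> = (4 / 5) * ((real n + 3) * s ^ n)" by simp
    also have "\<dots> \<le> (4 / 5) * (3 * (4 / 5) ^ n)" by (intro mult_left_mono Suc.IH) auto
    finally show ?case by simp
  qed simp
  have u: "(\<Sum>i<n. (real i + 3) * s ^ i) \<le> 15 - 15 * (4 / 5) ^ n" for n
  proof (induction n)
    case (Suc n)
    then show ?case using t[of n] by simp
  qed simp
  have "(\<Sum>j=2..J. (real j + 1) * s ^ j) \<le> (\<Sum>j\<in>{0+2..<J+2}. (real j + 1) * s ^ j)"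
    using assms by (intro sum_mono2) auto
  also have "\<dots> = (\<Sum>i=0..<J. (real (i + 2) + 1) * s ^ (i + 2))"
    by (rule sum.shift_bounds_nat_ivl)
  also have "\<dots> = s\<^sup>2 * (\<Sum>i<J. (real i + 3) * s ^ i)"
    unfolding sum_distrib_left lessThan_atLeast0 by (rule sum.cong) (auto simp: power2_eq_square algebra_simps)
  also have "\<dots> \<le> s\<^sup>2 * 15"
    by (intro mult_left_mono order.trans[OF u]) auto
  finally show ?thesis by simp
qed

text \<open>
  For \<open>n > 0\<close> this is the square of \<open>n / \<phi>(n)\<close>.
\<close>

definition totient_ratio_sq :: "nat \<Rightarrow> real" where
  "totient_ratio_sq n = (\<Prod>q\<in>prime_factors n. (real q / (real q - 1))\<^sup>2)"

lemma f_1: "4 dvd h \<Longrightarrow> f h 1 = 1"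
  using g_1[of h] by (simp add: f_def)

lemma f_mult_prime_power:
  assumes "4 dvd h" "prime q" "m > 0" "\<not> q dvd m"
  shows "f h (q ^ j * m) = f h (q ^ j) * f h m"
  using g_prime_power_mult[OF assms(2,1,3,4)] by (simp add: f_def norm_mult)

lemma f_prime_power_le:
  assumes "4 dvd h" "prime q"
  shows "f h (q ^ j) \<le> real j + 1"
  using g_prime_power_bound[OF assms(2,1), of j] by (simp add: f_def)

lemma f_mult_coprime:
  assumes "4 dvd h" "coprime m n" "m > 0" "n > 0"
  shows "f h (m * n) = f h m * f h n"
  using g_mult_coprime[OF assms] by (simp add: f_def norm_mult)

lemma ratio_sq_ge_1: "q \<ge> 2 \<Longrightarrow> 1 \<le> (real q / (real q - 1))\<^sup>2"
  by (intro one_le_power) (simp add: le_divide_eq)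

lemma ratio_sq_le:
  assumes "q \<ge> 2"
  shows "(real q / (real q - 1))\<^sup>2 \<le> 1 + 8 / real q" "(real q / (real q - 1))\<^sup>2 \<le> 4"
proof -
  define x where "x = real q"
  have x: "x \<ge> 2" using assms by (simp add: x_def)
  have "x / (x - 1) \<le> 2" using x by (simp add: divide_le_eq)
  then have "(x / (x - 1))\<^sup>2 \<le> 2\<^sup>2" using x by (intro power_mono) auto
  then show "(real q / (real q - 1))\<^sup>2 \<le> 4" by (simp add: x_def)
  have "x * x * x \<le> (x + 8) * ((x - 1) * (x - 1))"
  proof -
    have "(x + 8) * ((x - 1) * (x - 1)) - x * x * x = 6 * (x * x) - 15 * x + 8"
      by (simp add: algebra_simps)
    moreover have "6 * (x * x) \<ge> 6 * (2 * x)" using x by (intro mult_left_mono mult_right_mono) auto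
    moreover have "(x - 2) * (6 * x - 3) \<ge> 0" using x by (intro mult_nonneg_nonneg) auto
    then have "6 * (x * x) - 15 * x + 6 \<ge> 0" by (simp add: algebra_simps)
    ultimately show ?thesis by linarith
  qed
  then show "(real q / (real q - 1))\<^sup>2 \<le> 1 + 8 / real q"
    unfolding x_def[symmetric] using x by (simp add: power2_eq_square power_divide divide_simps mult.commute mult.left_commute)
qed

lemma totient_ratio_sq_prime_power:
  assumes "prime q" "m > 0" "\<not> q dvd m" "j \<ge> 1"
  shows "totient_ratio_sq (q ^ j * m) = (real q / (real q - 1))\<^sup>2 * totient_ratio_sq m"
proof -
  have "prime_factors (q ^ j * m) = prime_factors (q ^ j) \<union> prime_factors m"
    using assms by (intro prime_factors_product) auto
  also have "prime_factors (q ^ j) = {q}"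
    using assms by (simp add: prime_factorization_prime_power)
  finally have "prime_factors (q ^ j * m) = insert q (prime_factors m)" by simp
  moreover have "q \<notin> prime_factors m" using assms by (auto simp: in_prime_factors_iff)
  ultimately show ?thesis by (simp add: totient_ratio_sq_def)
qed

lemma totient_ratio_sq_ge_1: "totient_ratio_sq n \<ge> 1"
  unfolding totient_ratio_sq_def by (intro prod_ge_1 ratio_sq_ge_1) (auto simp: in_prime_factors_iff prime_ge_2_nat)

text \<open>
  In the Euler factor at \<open>q\<close> the term \<open>j = 1\<close> is
  \<open>f h q / q + O(1 / q\<^sup>2)\<close>, and the terms with \<open>j \<ge> 2\<close> are
  \<open>O(1 / q\<^sup>2)\<close> together.
\<close>

lemma sum_smooth_f_ratio_le:
  assumes "4 dvd h"
  shows "(\<Sum>a\<in>smooth_upto {p. prime p \<and> p \<le> y} X. f h a * totient_ratio_sq a / real a)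
    \<le> exp ((\<Sum>p | prime p \<and> p \<le> y. f h p / real p) + 76)"
proof -
  let ?P = "{p. prime p \<and> p \<le> y}"
  define H where "H = (\<lambda>q (j::nat). f h (q ^ j) * (real q / (real q - 1))\<^sup>2 / real q ^ j)"
  have "(\<Sum>a\<in>smooth_upto ?P X. f h a * totient_ratio_sq a / real a) \<le> (\<Prod>q\<in>?P. exp (f h q / real q + 76 * (1 / real q ^ 2)))"
  proof (rule sum_multiplicative_smooth_le)
    fix n show "f h n * totient_ratio_sq n / real n \<ge> 0"
      using totient_ratio_sq_ge_1[of n] by (simp add: f_nonneg)
    show "f h 1 * totient_ratio_sq 1 / real 1 \<le> 1"
      using f_1[OF assms] by (simp add: totient_ratio_sq_def)
  next
    fix q j m :: nat assume "q \<in> ?P" and q: "j \<ge> 1" "m > (0::nat)" "\<not> q dvd m"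
    then have "prime q" by simp
    then show "f h (q ^ j * m) * totient_ratio_sq (q ^ j * m) / real (q ^ j * m) \<le> H q j * (f h m * totient_ratio_sq m / real m)"
      using q by (simp add: f_mult_prime_power[OF assms] totient_ratio_sq_prime_power H_def) (simp add: mult_ac)
  next
    fix q j :: nat show "0 \<le> H q j" by (simp add: H_def f_nonneg)
  next
    fix q J :: nat assume "q \<in> ?P"
    then have q: "prime q" "q \<ge> 2" by (auto simp: prime_ge_2_nat)
    define r where "r = 1 / real q"
    have r: "0 \<le> r" "r \<le> 1/2" using q by (auto simp: r_def divide_simps)
    have H1: "H q 1 \<le> f h q * r + 16 * r\<^sup>2"
    proof -
      have "H q 1 = f h q * r * (real q / (real q - 1))\<^sup>2" by (simp add: H_def r_def)
      also have "\<dots> \<le> f h q * r * (1 + 8 * r)"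
        using ratio_sq_le(1)[OF q(2)] r by (intro mult_left_mono) (auto simp: r_def f_nonneg)
      also have "\<dots> = f h q * r + f h q * (8 * r\<^sup>2)" by (simp add: power2_eq_square algebra_simps)
      also have "f h q * (8 * r\<^sup>2) \<le> 2 * (8 * r\<^sup>2)"
        using f_prime_bound[OF assms q(1)] by (intro mult_right_mono) auto
      finally show ?thesis by simp
    qed
    have Hj: "H q j \<le> 4 * ((real j + 1) * r ^ j)" for j
    proof -
      have "H q j = f h (q ^ j) * (real q / (real q - 1))\<^sup>2 * r ^ j" by (simp add: H_def r_def power_divide)
      also have "\<dots> \<le> (real j + 1) * 4 * r ^ j"
        using ratio_sq_le(2)[OF q(2)] f_prime_power_le[OF assms q(1)] r
        by (intro mult_right_mono mult_mono) (auto simp: f_nonneg)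
      finally show ?thesis by (simp only: mult_ac)
    qed
    have "(\<Sum>j=1..J. H q j) \<le> H q 1 + (\<Sum>j=2..J. H q j)"
    proof (cases J)
      case 0
      then show ?thesis by (simp add: H_def f_nonneg)
    next
      case (Suc n)
      then show ?thesis by (simp add: sum.atLeast_Suc_atMost numeral_2_eq_2)
    qed
    also have "(\<Sum>j=2..J. H q j) \<le> (\<Sum>j=2..J. 4 * ((real j + 1) * r ^ j))" by (intro sum_mono Hj)
    also have "\<dots> = 4 * (\<Sum>j=2..J. (real j + 1) * r ^ j)" by (simp add: sum_distrib_left)
    also have "\<dots> \<le> 4 * (15 * r\<^sup>2)" using r by (intro mult_left_mono sum_arith_geometric_le) auto
    finally have "1 + (\<Sum>j=1..J. H q j) \<le> 1 + (f h q * r + 76 * r\<^sup>2)" using H1 by simp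
    also have "\<dots> \<le> exp (f h q * r + 76 * r\<^sup>2)" by (rule exp_ge_add_one_self)
    finally show "1 + (\<Sum>j=1..J. H q j) \<le> exp (f h q / real q + 76 * (1 / real q ^ 2))"
      by (simp add: r_def power_divide)
  qed auto
  also have "\<dots> = exp ((\<Sum>p\<in>?P. f h p / real p) + 76 * (\<Sum>p\<in>?P. 1 / real p ^ 2))"
    by (simp add: exp_sum[symmetric] sum.distrib sum_distrib_left)
  also have "\<dots> \<le> exp ((\<Sum>p\<in>?P. f h p / real p) + 76)"
    using sum_inverse_prime_squares[of y] by simp
  finally show ?thesis .
qed

text \<open>
  The bound \<open>\<eta> \<le> 1/4\<close> keeps \<open>p powr (\<eta> - 1)\<close> below \<open>3/5\<close>
  and the sum of its squares over the primes convergent.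
\<close>

lemma sum_smooth_f_rankin_le:
  assumes "4 dvd h" "0 \<le> \<eta>" "\<eta> \<le> 1 / 4"
  shows "(\<Sum>a\<in>smooth_upto {p. prime p \<and> p \<le> y} X. f h a * real a powr (\<eta> - 1))
    \<le> exp ((\<Sum>p | prime p \<and> p \<le> y. f h p * real p powr (\<eta> - 1)) + 45)"
proof -
  let ?P = "{p. prime p \<and> p \<le> y}"
  define H where "H = (\<lambda>q (j::nat). f h (q ^ j) * (real q powr (\<eta> - 1)) ^ j)"
  have "(\<Sum>a\<in>smooth_upto ?P X. f h a * real a powr (\<eta> - 1))
     \<le> (\<Prod>q\<in>?P. exp (f h q * real q powr (\<eta> - 1) + 15 * (real q powr (- 1 - 1 / 2))))"
  proof (rule sum_multiplicative_smooth_le)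
    fix n show "f h n * real n powr (\<eta> - 1) \<ge> 0" by (simp add: f_nonneg)
    show "f h 1 * real 1 powr (\<eta> - 1) \<le> 1" using f_1[OF assms(1)] by simp
  next
    fix q j m :: nat assume "q \<in> ?P" and q: "j \<ge> 1" "m > (0::nat)" "\<not> q dvd m"
    then have pq: "prime q" "real q > 0" by (auto simp: prime_gt_0_nat)
    have "real (q ^ j) powr (\<eta> - 1) = (real q powr (\<eta> - 1)) ^ j"
      using pq by (simp add: powr_powr mult.commute flip: powr_realpow)
    then show "f h (q ^ j * m) * real (q ^ j * m) powr (\<eta> - 1) \<le> H q j * (f h m * real m powr (\<eta> - 1))"
      using q pq by (simp add: f_mult_prime_power[OF assms(1)] H_def powr_mult)
  next
    fix q j :: nat show "0 \<le> H q j" by (simp add: H_def f_nonneg)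
  next
    fix q J :: nat assume "q \<in> ?P"
    then have q: "prime q" "real q \<ge> 2" by (auto dest: prime_ge_2_nat)
    define r where "r = real q powr (\<eta> - 1)"
    have "r \<le> 2 powr (\<eta> - 1)" unfolding r_def using q assms by (intro powr_mono2') auto
    also have "\<dots> \<le> 2 powr (- (3 / 4))" using assms by (intro powr_mono) auto
    also have "\<dots> \<le> 3 / 5"
    proof (rule power_le_imp_le_base)
      have "(2 powr (- (3 / 4)) :: real) ^ Suc 3 = 2 powr (- 3)"
        by (simp add: powr_powr flip: powr_realpow)
      also have "\<dots> = 1 / 8" by (simp add: powr_minus_divide)
      also have "\<dots> \<le> (3 / 5) ^ Suc 3" by (simp add: power_divide)
      finally show "(2 powr (- (3 / 4)) :: real) ^ Suc 3 \<le> (3 / 5) ^ Suc 3" .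
    qed simp
    finally have r: "0 \<le> r" "r \<le> 3 / 5" by (auto simp: r_def)
    have Hj: "H q j \<le> (real j + 1) * r ^ j" for j
      unfolding H_def r_def[symmetric] using r f_prime_power_le[OF assms(1) q(1)] by (intro mult_right_mono) auto
    have "(\<Sum>j=1..J. H q j) \<le> H q 1 + (\<Sum>j=2..J. H q j)"
    proof (cases J)
      case 0
      then show ?thesis by (simp add: H_def f_nonneg)
    next
      case (Suc n)
      then show ?thesis by (simp add: sum.atLeast_Suc_atMost numeral_2_eq_2)
    qed
    also have "(\<Sum>j=2..J. H q j) \<le> (\<Sum>j=2..J. (real j + 1) * r ^ j)" by (intro sum_mono Hj)
    also have "\<dots> \<le> 15 * r\<^sup>2" using r by (intro sum_arith_geometric_le) auto
    also have "r\<^sup>2 = real q powr (2 * (\<eta> - 1))"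
      using q by (simp add: r_def powr_powr mult.commute flip: powr_numeral)
    also have "15 * \<dots> \<le> 15 * real q powr (- 1 - 1 / 2)"
      using q assms by (intro mult_left_mono powr_mono) auto
    also have "H q 1 = f h q * r" by (simp add: H_def r_def)
    finally have "1 + (\<Sum>j=1..J. H q j) \<le> 1 + (f h q * r + 15 * real q powr (- 1 - 1 / 2))" by simp
    also have "\<dots> \<le> exp (f h q * r + 15 * real q powr (- 1 - 1 / 2))" by (rule exp_ge_add_one_self)
    finally show "1 + (\<Sum>j=1..J. H q j) \<le> exp (f h q * real q powr (\<eta> - 1) + 15 * (real q powr (- 1 - 1 / 2)))"
      by (simp add: r_def)
  qed auto
  also have "\<dots> = exp ((\<Sum>p\<in>?P. f h p * real p powr (\<eta> - 1)) + 15 * (\<Sum>p\<in>?P. real p powr (- 1 - 1 / 2)))"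
    by (simp add: exp_sum[symmetric] sum.distrib sum_distrib_left)
  also have "(\<Sum>p\<in>?P. real p powr (- 1 - 1 / 2)) \<le> (\<Sum>m=1..y. real m powr (- 1 - 1 / 2))"
    by (rule sum_mono2) (auto simp: Suc_le_eq prime_gt_0_nat)
  also have "\<dots> \<le> 1 + 1 / (1 / 2)" by (rule sum_powr_le) simp
  finally show ?thesis by simp
qed

text \<open>
  For \<open>p \<le> y\<close> the factor \<open>p powr (B / ln y)\<close> is at most
  \<open>1 + (B / ln y) exp B ln p\<close>, and the sum of \<open>ln p / p\<close> over these primes is
  \<open>O(ln y)\<close>.
\<close>

lemma sum_f_primes_shift_le:
  fixes y :: nat
  assumes "4 dvd h" "y \<ge> 2" "B \<ge> 0"
  shows "(\<Sum>p | prime p \<and> p \<le> y. f h p * real p powr (B / ln y - 1))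
    \<le> (\<Sum>p | prime p \<and> p \<le> y. f h p / real p) + 4 * B * exp B"
proof -
  let ?P = "{p. prime p \<and> p \<le> y}"
  define \<eta> where "\<eta> = B / ln y"
  have ly: "ln (real y) > 0" using assms by simp
  have \<eta>: "\<eta> \<ge> 0" using ly assms by (simp add: \<eta>_def)
  have "(\<Sum>p\<in>?P. f h p * real p powr (\<eta> - 1)) \<le> (\<Sum>p\<in>?P. f h p / real p + 2 * \<eta> * exp B * (ln (real p) / real p))"
  proof (rule sum_mono)
    fix p assume "p \<in> ?P"
    then have p: "prime p" "p \<le> y" "real p > 0" "ln (real p) \<ge> 0" by (auto simp: prime_gt_0_nat Suc_le_eq)
    define x where "x = \<eta> * ln (real p)"
    have x0: "x \<ge> 0" using \<eta> p by (simp add: x_def)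
    have "x \<le> \<eta> * ln (real y)" unfolding x_def using p \<eta> by (intro mult_left_mono) auto
    also have "\<dots> = B" using ly by (simp add: \<eta>_def)
    finally have xB: "x \<le> B" .
    have "1 + (- x) \<le> exp (- x)" by (rule exp_ge_add_one_self)
    then have "(1 - x) * exp x \<le> exp (- x) * exp x" by (intro mult_right_mono) auto
    then have "exp x \<le> 1 + x * exp x" by (simp add: algebra_simps flip: exp_add)
    also have "\<dots> \<le> 1 + x * exp B" using x0 xB by (intro add_left_mono mult_left_mono) auto
    finally have ex: "exp x \<le> 1 + x * exp B" .
    have "real p powr (\<eta> - 1) = exp x / real p" using p by (simp add: powr_diff) (simp add: powr_def x_def)
    also have "\<dots> \<le> (1 + x * exp B) / real p" using ex p by (intro divide_right_mono) auto
    also have "\<dots> = 1 / real p + \<eta> * exp B * (ln (real p) / real p)"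
      by (simp add: x_def add_divide_distrib)
    finally have "f h p * real p powr (\<eta> - 1) \<le> f h p * (1 / real p + \<eta> * exp B * (ln (real p) / real p))"
      by (intro mult_left_mono f_nonneg)
    also have "\<dots> = f h p / real p + f h p * (\<eta> * exp B * (ln (real p) / real p))" by (simp add: distrib_left)
    also have "f h p * (\<eta> * exp B * (ln (real p) / real p)) \<le> 2 * (\<eta> * exp B * (ln (real p) / real p))"
      using \<eta> p f_prime_bound[OF assms(1) p(1)] by (intro mult_right_mono) auto
    finally show "f h p * real p powr (\<eta> - 1) \<le> f h p / real p + 2 * \<eta> * exp B * (ln (real p) / real p)" by simp
  qed
  also have "\<dots> = (\<Sum>p\<in>?P. f h p / real p) + 2 * \<eta> * exp B * (\<Sum>p\<in>?P. ln (real p) / real p)"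
    by (simp only: sum.distrib sum_distrib_left)
  also have "2 * \<eta> * exp B * (\<Sum>p\<in>?P. ln (real p) / real p) \<le> 2 * \<eta> * exp B * (2 * ln y)"
    using \<eta> assms by (intro mult_left_mono sum_ln_prime_over_prime) auto
  also have "\<dots> = 4 * B * exp B" using ly by (simp add: \<eta>_def)
  finally show ?thesis by (simp add: \<eta>_def)
qed

lemma exp_sum_f_over_primes_le:
  shows "\<exists>K>0. \<forall>h (y::nat). 4 dvd h \<longrightarrow> h > 0 \<longrightarrow> y \<ge> 3 \<longrightarrow>
    exp (\<Sum>p | prime p \<and> p \<le> y. f h p / real p) \<le> K * ln y powr (3/4) * (1 + ln (2 * real h)) powr (1/4)"
proof (intro exI[of _ "(8 * exp 1) powr (3/4) * (66 * exp 1) powr (1/4) * exp 4"] conjI allI impI)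
  fix h y :: nat assume a: "4 dvd h" "h > 0" "y \<ge> 3"
  have ly: "ln (real y) > 0" using a by simp
  have lh: "1 + ln (2 * real h) > 0" 
  proof -
    have "ln (2 * real h) \<ge> 0" by (rule ln_ge_zero) (use a in simp)
    then show ?thesis by linarith
  qed
  have E: "exp (c * ln x) = x powr c" if "x > 0" for c x :: real using that by (simp add: powr_def)
  have "exp (\<Sum>p | prime p \<and> p \<le> y. f h p / real p)
     \<le> exp (3/4 * ln (8 * exp 1 * ln y) + 1/4 * ln (66 * exp 1 * (1 + ln (2 * real h))) + 4)"
    using sum_f_over_primes[OF a] by simp
  also have "\<dots> = (8 * exp 1 * ln y) powr (3/4) * (66 * exp 1 * (1 + ln (2 * real h))) powr (1/4) * exp 4"
    unfolding exp_add using ly lh by (subst (1 2) E) (auto intro!: mult_pos_pos)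
  also have "\<dots> = (8 * exp 1) powr (3/4) * (66 * exp 1) powr (1/4) * exp 4 * ln y powr (3/4) * (1 + ln (2 * real h)) powr (1/4)"
    using ly lh by (simp add: powr_mult)
  finally show "exp (\<Sum>p | prime p \<and> p \<le> y. f h p / real p)
     \<le> (8 * exp 1) powr (3/4) * (66 * exp 1) powr (1/4) * exp 4 * ln y powr (3/4) * (1 + ln (2 * real h)) powr (1/4)" .
qed auto

lemma sum_ln_prime_factors_le:
  assumes "n > 0"
  shows "(\<Sum>q\<in>prime_factors n. ln (real q)) \<le> ln (real n)"
proof -
  have "\<Prod>(prime_factors n) dvd n"
    using prod_dvd_of_coprime[of "prime_factors n" "\<lambda>q. q" n]
    by (auto simp: in_prime_factors_iff primes_coprime)
  then have "\<Prod>(prime_factors n) \<le> n" using assms by (rule dvd_imp_le)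
  then have le: "real (\<Prod>(prime_factors n)) \<le> real n" by (rule of_nat_mono)
  have pos: "real q > 0" if "q \<in> prime_factors n" for q
    using that by (auto simp: in_prime_factors_iff prime_gt_0_nat)
  have "(\<Sum>q\<in>prime_factors n. ln (real q)) = ln (\<Prod>q\<in>prime_factors n. real q)"
    using pos by (subst ln_prod) auto
  also have "\<dots> \<le> ln (real n)"
    using le pos assms by (subst ln_le_cancel_iff) (auto intro!: prod_pos)
  finally show ?thesis .
qed

text \<open>
  The logarithm of the left-hand side is at most 4 times the sum of \<open>1 / q\<close> over primes
  \<open>q\<close> dividing \<open>N\<close>. Those up to a constant \<open>K\<close> contribute
  \<open>O(1)\<close>. Those from \<open>K\<close> to \<open>L = ln N\<close> contribute at most
  \<open>2 ln L / ln K\<close>, a small multiple of \<open>ln L\<close>. Those beyond \<open>L\<close> are at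
  most \<open>L / ln 2\<close> in number and contribute \<open>O(1)\<close>.
\<close>

lemma totient_ratio_sq_le:
  assumes "\<delta> > 0"
  shows "\<exists>C>0. \<forall>N::nat. N \<ge> 3 \<longrightarrow> totient_ratio_sq N \<le> C * ln N powr \<delta>"
proof (intro exI[of _ "exp (4 * exp (8 / \<delta>) + 8)"] conjI allI impI)
  fix N :: nat assume N: "N \<ge> 3"
  \<comment> \<open>This \<open>K\<close> makes the coefficient of \<open>ln L\<close> equal to
    \<open>\<delta>\<close>.\<close>
  define K where "K = exp (8 / \<delta>)"
  define L where "L = ln (real N)"
  define y where "y = nat \<lfloor>L\<rfloor>"
  have "exp 1 \<le> (3 :: real)" by (rule exp_le)
  then have "exp 1 \<le> real N" using N by linarith
  then have L1: "L \<ge> 1" unfolding L_def using N by (subst ln_ge_iff) auto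
  have y: "y \<ge> 1" "real y \<le> L" using L1 by (auto simp: y_def le_nat_iff le_floor_iff)
  have K: "K > 1" "ln K = 8 / \<delta>" using assms by (auto simp: K_def)
  let ?A = "prime_factors N"
  have "(\<Sum>q\<in>?A. 1 / real q) \<le> (\<Sum>q\<in>?A. (if real q \<le> K then 1 else 0)
      + (if q \<le> y then 1 / ln K * (ln (real q) / real q) else 0) + 1 / (L * ln 2) * ln (real q))"
  proof (rule sum_mono)
    fix q assume "q \<in> ?A"
    then have q: "q \<ge> 2" "real q \<ge> 2" "ln (real q) \<ge> ln 2" by (auto simp: in_prime_factors_iff prime_ge_2_nat)
    have lnq: "ln (real q) \<ge> 0" using q by simp
    consider "real q \<le> K" | "real q > K" "q \<le> y" | "q > y" by linarith
    then show "1 / real q \<le> (if real q \<le> K then 1 else 0)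
      + (if q \<le> y then 1 / ln K * (ln (real q) / real q) else 0) + 1 / (L * ln 2) * ln (real q)"
    proof cases
      case 1
      have "1 / real q \<le> 1" using q by simp
      moreover have "0 \<le> (if q \<le> y then 1 / ln K * (ln (real q) / real q) else 0)" "0 \<le> 1 / (L * ln 2) * ln (real q)"
        using K lnq L1 assms by auto
      ultimately show ?thesis using 1 by simp
    next
      case 2
      have "ln K \<le> ln (real q)" using 2 K by (subst ln_le_cancel_iff) auto
      then have "1 \<le> ln (real q) / ln K" using K(1) by (simp add: le_divide_eq)
      then have "1 / real q \<le> ln (real q) / ln K / real q" using q by (intro divide_right_mono) auto
      moreover have "0 \<le> 1 / (L * ln 2) * ln (real q)" using lnq L1 by auto
      ultimately show ?thesis using 2 by simp
    next
      case 3
      then have "real q > L" using L1 unfolding y_def by linarith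
      then have "1 / real q \<le> 1 / L * 1" using L1 by (simp add: frac_le)
      also have "\<dots> \<le> 1 / L * (ln (real q) / ln 2)" using q L1 by (intro mult_left_mono) (auto simp: le_divide_eq)
      finally show ?thesis using 3 by simp
    qed
  qed
  also have "\<dots> = (\<Sum>q\<in>?A. if real q \<le> K then 1 else 0)
      + (\<Sum>q\<in>?A. if q \<le> y then 1 / ln K * (ln (real q) / real q) else 0) + 1 / (L * ln 2) * (\<Sum>q\<in>?A. ln (real q))"
    by (simp only: sum.distrib sum_distrib_left)
  also have "(\<Sum>q\<in>?A. if real q \<le> K then 1 else (0::real)) \<le> K"
  proof -
    have "(\<Sum>q\<in>?A. if real q \<le> K then 1 else (0::real)) = real (card {q \<in> ?A. real q \<le> K})"
      by (simp add: sum.inter_filter[symmetric])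
    also have "card {q \<in> ?A. real q \<le> K} \<le> card {1..nat \<lfloor>K\<rfloor>}"
      by (intro card_mono) (auto simp: in_prime_factors_iff prime_gt_0_nat Suc_le_eq le_nat_floor)
    also have "real (card {1..nat \<lfloor>K\<rfloor>}) \<le> K" using K by simp
    finally show ?thesis by simp
  qed
  also have "(\<Sum>q\<in>?A. if q \<le> y then 1 / ln K * (ln (real q) / real q) else 0) \<le> 1 / ln K * (2 * ln L)"
  proof -
    have "(\<Sum>q\<in>?A. if q \<le> y then 1 / ln K * (ln (real q) / real q) else 0) = (\<Sum>q\<in>{q \<in> ?A. q \<le> y}. 1 / ln K * (ln (real q) / real q))"
      by (simp add: sum.inter_filter[symmetric])
    also have "\<dots> \<le> (\<Sum>q | prime q \<and> q \<le> y. 1 / ln K * (ln (real q) / real q))"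
      using K assms by (intro sum_mono2) (auto simp: in_prime_factors_iff prime_gt_0_nat Suc_le_eq)
    also have "\<dots> = 1 / ln K * (\<Sum>q | prime q \<and> q \<le> y. ln (real q) / real q)" by (simp add: sum_distrib_left)
    also have "\<dots> \<le> 1 / ln K * (2 * ln y)" using K y assms by (intro mult_left_mono sum_ln_prime_over_prime) auto
    also have "\<dots> \<le> 1 / ln K * (2 * ln L)" using K y assms by (intro mult_left_mono) auto
    finally show ?thesis .
  qed
  also have "1 / (L * ln 2) * (\<Sum>q\<in>?A. ln (real q)) \<le> 1 / (L * ln 2) * L"
    using L1 sum_ln_prime_factors_le[of N] N unfolding L_def by (intro mult_left_mono) auto
  also have "1 / (L * ln 2) * L = 1 / ln 2" using L1 by simp
  also have "1 / ln 2 \<le> (2 :: real)" using ln2_ge_two_thirds by (simp add: divide_le_eq)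
  also have "1 / ln K * (2 * ln L) = \<delta> / 4 * ln L" using assms K by simp
  finally have S: "(\<Sum>q\<in>?A. 1 / real q) \<le> K + \<delta> / 4 * ln L + 2" by simp
  have "totient_ratio_sq N \<le> (\<Prod>q\<in>?A. exp (4 * (1 / real q)))"
    unfolding totient_ratio_sq_def
  proof (intro prod_mono conjI)
    fix q assume "q \<in> ?A"
    then have q: "real q \<ge> 2" by (auto simp: in_prime_factors_iff dest: prime_ge_2_nat)
    have "real q / (real q - 1) = 1 + 1 / (real q - 1)" using q by (simp add: field_simps)
    also have "\<dots> \<le> 1 + 2 / real q" using q by (simp add: field_simps)
    also have "\<dots> \<le> exp (2 / real q)" by (rule exp_ge_add_one_self)
    finally have "(real q / (real q - 1))\<^sup>2 \<le> (exp (2 / real q))\<^sup>2" using q by (intro power_mono) auto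
    also have "\<dots> = exp (4 * (1 / real q))" by (simp add: power2_eq_square flip: exp_add)
    finally show "(real q / (real q - 1))\<^sup>2 \<le> exp (4 * (1 / real q))" .
  qed simp
  also have "\<dots> = exp (4 * (\<Sum>q\<in>?A. 1 / real q))" by (simp add: exp_sum sum_distrib_left)
  also have "\<dots> \<le> exp (4 * (K + \<delta> / 4 * ln L + 2))" using S by simp
  also have "\<dots> = exp (4 * K + 8) * L powr \<delta>"
    using L1 by (simp add: powr_def algebra_simps flip: exp_add)
  finally show "totient_ratio_sq N \<le> exp (4 * exp (8 / \<delta>) + 8) * ln N powr \<delta>"
    by (simp add: K_def L_def)
qed simp

text \<open>
  An integer whose prime factors all exceed \<open>y\<close> has at most \<open>ln b / ln y\<close> of them, and
  \<open>f h (q ^ j) \<le> j + 1 \<le> 2 ^ j\<close>.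
\<close>

lemma f_rough_le:
  assumes "4 dvd h" "y \<ge> 2" "b > 0" "\<And>q. prime q \<Longrightarrow> q dvd b \<Longrightarrow> q > (y::nat)"
  shows "f h b \<le> 2 powr (ln b / ln y)"
  using assms(3,4)
proof (induction b rule: less_induct)
  case (less b)
  show ?case
  proof (cases "b = 1")
    case True
    then show ?thesis using f_1[OF assms(1)] by simp
  next
    case False
    then obtain q where q: "prime q" "q dvd b" using prime_factor_nat by blast
    define j where "j = multiplicity q b"
    obtain m where m: "b = q ^ j * m" "\<not> q dvd m"
      using multiplicity_decompose'[of b q] q less.prems by (metis j_def neq0_conv not_prime_unit)
    have m0: "m > 0" using less.prems m by (cases m) auto
    have "j > 0" using m q by (cases j) auto
    have qy: "q > y" using less.prems q by blast
    have "m < b"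
      using m(1) m0 \<open>j > 0\<close> prime_gt_1_nat[OF q(1)] by (metis mult_less_cancel2 mult_1 one_less_power)
    have ly: "ln (real y) > 0" using assms by simp
    have "f h b = f h (q ^ j) * f h m"
      using f_mult_prime_power[OF assms(1) q(1) m0 m(2)] m(1) by simp
    also have "\<dots> \<le> 2 ^ j * 2 powr (ln m / ln y)"
    proof (intro mult_mono)
      have "f h (q ^ j) \<le> real j + 1" by (rule f_prime_power_le[OF assms(1) q(1)])
      also have "\<dots> = real (Suc j)" by simp
      also have "\<dots> \<le> real (2 ^ j)" by (intro of_nat_mono Suc_leI less_exp)
      finally show "f h (q ^ j) \<le> 2 ^ j" by simp
      show "f h m \<le> 2 powr (ln m / ln y)"
        using less.IH[OF \<open>m < b\<close> m0] less.prems m(1) by simp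
    qed (auto simp: f_nonneg)
    also have "\<dots> = 2 powr (real j + ln m / ln y)" by (simp add: powr_add powr_realpow)
    also have "\<dots> \<le> 2 powr (ln b / ln y)"
    proof (intro powr_mono)
      have "ln (real b) = real j * ln (real q) + ln (real m)"
        using m0 q(1) unfolding m(1) by (simp add: ln_mult_pos ln_realpow prime_gt_0_nat)
      moreover have "real j * ln (real q) \<ge> real j * ln (real y)"
        using qy assms(2) by (intro mult_left_mono) auto
      ultimately have "real j * ln (real y) + ln (real m) \<le> ln (real b)" by linarith
      then have "(real j * ln (real y) + ln (real m)) / ln y \<le> ln b / ln y"
        using ly by (intro divide_right_mono) auto
      then show "real j + ln m / ln y \<le> ln b / ln y"
        using ly by (simp add: add_divide_distrib)
    qed simp
    finally show ?thesis .
  qed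
qed

lemma smooth_rough_decomposition:
  fixes n :: nat
  assumes "n > 0"
  shows "\<exists>a b. n = a * b \<and> a > 0 \<and> b > 0 \<and> prime_factors a \<subseteq> P \<and> (\<forall>q. prime q \<longrightarrow> q dvd b \<longrightarrow> q \<notin> P)"
  using assms
proof (induction n rule: less_induct)
  case (less n)
  show ?case
  proof (cases "n = 1")
    case True
    then show ?thesis by (intro exI[of _ 1]) auto
  next
    case False
    then obtain q where q: "prime q" "q dvd n" using prime_factor_nat by blast
    then obtain m where m: "n = q * m" by auto
    have m0: "m > 0" using m less.prems by (cases m) auto
    have "m < n" using m m0 prime_gt_1_nat[OF q(1)] by simp
    from less.IH[OF this m0] obtain a b where ab: "m = a * b" "a > 0" "b > 0" "prime_factors a \<subseteq> P"
      "\<forall>q. prime q \<longrightarrow> q dvd b \<longrightarrow> q \<notin> P" by blast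
    have q0: "q > 0" using q prime_gt_0_nat by blast
    show ?thesis
    proof (cases "q \<in> P")
      case True
      have "prime_factors (q * a) \<subseteq> P"
        using True ab q0 q(1) by (subst prime_factors_product) (auto simp: prime_prime_factors)
      then show ?thesis using m ab q0 by (intro exI[of _ "q * a"] exI[of _ b]) auto
    next
      case False
      have "\<forall>r. prime r \<longrightarrow> r dvd q * b \<longrightarrow> r \<notin> P"
        using False ab(5) q(1) by (metis prime_dvd_mult_iff primes_dvd_imp_eq)
      then show ?thesis using m ab q0 by (intro exI[of _ a] exI[of _ "q * b"]) auto
    qed
  qed
qed

lemma card_bad_residues:
  fixes a N q :: nat
  assumes "prime q" "\<not> q dvd a" "\<not> q dvd N"
  shows "card {r. r < q \<and> (int q dvd int r \<or> int q dvd int N - int a * int r)} = 2"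
proof -
  have q0: "q > 0" using assms prime_gt_0_nat by blast
  have cop: "coprime (int a) (int q)"
    using prime_imp_coprime[OF assms(1,2)] by (simp add: coprime_commute)
  obtain u v where uv: "u * int a + v * int q = 1"
    using bezout_int[of "int a" "int q"] cop by (auto simp: coprime_iff_gcd_eq_1)
  \<comment> \<open>The nonzero bad class is \<open>N\<close> times the inverse \<open>u\<close> of
    \<open>a\<close> modulo \<open>q\<close>.\<close>
  define r0 where "r0 = nat ((u * int N) mod int q)"
  have r0: "r0 < q" "int r0 = (u * int N) mod int q"
    using q0 by (auto simp: r0_def nat_less_iff)
  have dv: "int q dvd int N - int a * int r0"
  proof -
    have "int q dvd u * int N - int r0" unfolding r0(2) by (simp add: dvd_minus_mod)
    then have "int q dvd int a * (u * int N - int r0)" by simp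
    moreover have "int N - int a * int r0 = int a * (u * int N - int r0) + int q * (v * int N)"
    proof -
      have "int N = (u * int a + v * int q) * int N" using uv by simp
      then show ?thesis by (simp add: algebra_simps)
    qed
    ultimately show ?thesis by simp
  qed
  have "r0 \<noteq> 0" using dv assms(3) by (intro notI) simp
  have "{r. r < q \<and> (int q dvd int r \<or> int q dvd int N - int a * int r)} = {0, r0}"
  proof (intro equalityI subsetI)
    fix r assume r: "r \<in> {r. r < q \<and> (int q dvd int r \<or> int q dvd int N - int a * int r)}"
    then consider "int q dvd int r" | "int q dvd int N - int a * int r" by auto
    then show "r \<in> {0, r0}"
    proof cases
      case 1
      then have "q dvd r" by simp
      then show ?thesis using r by (auto dest: dvd_imp_le)
    next
      case 2
      then have "int q dvd (int N - int a * int r0) - (int N - int a * int r)" using dv by (rule dvd_diff[rotated])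
      then have "int q dvd int a * (int r - int r0)" by (simp add: algebra_simps)
      then have "int q dvd int r - int r0"
        using cop by (simp add: coprime_dvd_mult_right_iff coprime_commute)
      then have "int r mod int q = int r0 mod int q" by (simp add: mod_eq_dvd_iff)
      then show ?thesis using r r0(1) by simp
    qed
  next
    fix r assume "r \<in> {0, r0}"
    then show "r \<in> {r. r < q \<and> (int q dvd int r \<or> int q dvd int N - int a * int r)}"
      using dv r0 q0 by auto
  qed
  then show ?thesis using \<open>r0 \<noteq> 0\<close> by simp
qed

lemma prod_union_le:
  fixes F :: "nat \<Rightarrow> real"
  assumes "finite A" "finite B" "\<And>x. x \<in> A \<union> B \<Longrightarrow> F x \<ge> 1"
  shows "prod F (A \<union> B) \<le> prod F A * prod F B"
proof -
  have "prod F (A \<union> B) * 1 \<le> prod F (A \<union> B) * prod F (A \<inter> B)"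
    using assms by (intro mult_left_mono prod_ge_1 prod_nonneg) (auto intro: order.trans[OF zero_le_one])
  also have "\<dots> = prod F A * prod F B" using assms by (intro prod.union_inter)
  finally show ?thesis by simp
qed

text \<open>
  Only the primes that do not divide \<open>2 a N\<close> are sifted, since each of these removes exactly two
  classes. The omitted primes cost the factors \<open>totient_ratio_sq\<close>.
\<close>

lemma card_sieved_le:
  fixes a N y :: nat
  assumes "y \<ge> 3" "a > 0" "a \<le> N"
    and S: "\<And>b. b \<in> S \<Longrightarrow> a * b \<le> N" "\<And>b q. b \<in> S \<Longrightarrow> prime q \<Longrightarrow> q \<le> y \<Longrightarrow> \<not> q dvd b"
      "\<And>b q. b \<in> S \<Longrightarrow> prime q \<Longrightarrow> q \<le> y \<Longrightarrow> \<not> q dvd N - a * b"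
  shows "real (card S) \<le> 8 * real N * totient_ratio_sq N / (ln y)\<^sup>2 * (totient_ratio_sq a / real a) + 4 * real y ^ 8"
proof -
  define P where "P = {p. prime p \<and> p \<le> y}"
  define good where "good = (\<lambda>q. q \<noteq> 2 \<and> \<not> q dvd a \<and> \<not> q dvd N)"
  define Q where "Q = {q \<in> P. good q}"
  define bad where "bad = (\<lambda>q m. int q dvd int m \<or> int q dvd int N - int a * int m)"
  define M where "M = N div a + 1"
  let ?G = "selberg_sum Q ((real y)\<^sup>2)"
  have P: "finite P" "\<And>q. q \<in> P \<Longrightarrow> prime q" by (auto simp: P_def)
  have Q3: "q \<ge> 3" if "q \<in> P" "good q" for q
  proof -
    have "q \<ge> 2" using P that prime_ge_2_nat by blast
    then show ?thesis using that(2) by (auto simp: good_def)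
  qed
  have Q: "finite Q" "\<And>q. q \<in> Q \<Longrightarrow> prime q" "\<And>q. q \<in> Q \<Longrightarrow> q \<ge> 3"
    using P Q3 by (auto simp: Q_def)
  have y1: "real y \<ge> 1" "(real y)\<^sup>2 \<ge> 1" using assms by (auto intro!: one_le_power)
  have ly: "ln (real y) > 0" using assms by simp
  have "real (card S) * ?G\<^sup>2 \<le> real M * ?G + 4 * ((real y)\<^sup>2) ^ 4"
  proof (rule selberg_sieve_two_classes[where bad = bad, OF Q])
    fix q m assume "q \<in> Q"
    have "int q dvd int (m mod q) \<longleftrightarrow> int q dvd int m"
      by (simp add: dvd_mod_iff)
    moreover have "int q dvd int N - int a * int (m mod q) \<longleftrightarrow> int q dvd int N - int a * int m"
    proof -
      have "(int N - int a * int (m mod q)) mod int q = (int N - int a * int m) mod int q"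
        unfolding of_nat_mod by (metis mod_diff_right_eq mod_mult_right_eq)
      then show ?thesis by (simp add: dvd_eq_mod_eq_0)
    qed
    ultimately show "bad q (m mod q) = bad q m" by (simp add: bad_def)
  next
    fix q assume "q \<in> Q"
    then show "card {r. r < q \<and> bad q r} = 2"
      unfolding bad_def using Q by (intro card_bad_residues) (auto simp: Q_def good_def)
  next
    show "S \<subseteq> {..<M}"
    proof
      fix b assume "b \<in> S"
      then have "a * b div a \<le> N div a" using S(1) by (intro div_le_mono) auto
      then show "b \<in> {..<M}" using assms(2) by (simp add: M_def)
    qed
  next
    fix b q assume b: "b \<in> S" and q: "q \<in> Q"
    then have q': "prime q" "q \<le> y" by (auto simp: Q_def P_def)
    have "int N - int a * int b = int (N - a * b)" using S(1)[OF b] by (simp add: of_nat_diff)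
    then have "int q dvd int N - int a * int b \<longleftrightarrow> q dvd N - a * b" by (simp only: of_nat_dvd_iff)
    then show "\<not> bad q b" using S(2,3)[OF b q'] by (simp add: bad_def)
  qed (use y1 in auto)
  moreover have G1: "?G \<ge> 1"
  proof -
    have "(\<Sum>D\<in>{{}}. \<Prod>q\<in>D. selberg_weight q) \<le> ?G"
      unfolding selberg_sum_def using Q y1
      by (intro sum_mono2) (auto intro!: prod_nonneg selberg_weight_nonneg)
    then show ?thesis by simp
  qed
  ultimately have "(real (card S) * ?G) * ?G \<le> (real M + 4 * real y ^ 8) * ?G"
  proof -
    assume a: "real (card S) * ?G\<^sup>2 \<le> real M * ?G + 4 * ((real y)\<^sup>2) ^ 4"
    have "4 * real y ^ 8 * 1 \<le> 4 * real y ^ 8 * ?G" using G1 by (intro mult_left_mono) auto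
    moreover have "((real y)\<^sup>2) ^ 4 = real y ^ 8" by (simp flip: power_mult)
    ultimately show ?thesis using a by (simp add: power2_eq_square algebra_simps)
  qed
  then have "real (card S) * ?G \<le> real M + 4 * real y ^ 8" using G1 by (subst (asm) mult_le_cancel_right_pos) auto
  then have cS: "real (card S) \<le> real M / ?G + 4 * real y ^ 8 / ?G"
    using G1 by (simp add: le_divide_eq add_divide_distrib[symmetric])
  define K where "K = (\<Prod>q\<in>{q \<in> P. \<not> good q}. (real q / (real q - 1))\<^sup>2)"
  have ge1: "1 \<le> (real q / (real q - 1))\<^sup>2" if "prime q" for q
    using that by (intro ratio_sq_ge_1) (simp add: prime_ge_2_nat)
  have K0: "K > 0" unfolding K_def
  proof (rule prod_pos, goal_cases)
    case (1 q)
    then have "1 \<le> (real q / (real q - 1))\<^sup>2" using P by (intro ge1) auto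
    then show ?case by linarith
  qed
  have N0: "N > 0" using assms by simp
  have "K \<le> (\<Prod>q\<in>({2} \<union> prime_factors a) \<union> prime_factors N. (real q / (real q - 1))\<^sup>2)"
    unfolding K_def
  proof (rule prod_mono2)
    show "{q \<in> P. \<not> good q} \<subseteq> ({2} \<union> prime_factors a) \<union> prime_factors N"
      using P(2) assms(2) N0 by (auto simp: good_def in_prime_factors_iff)
    show "1 \<le> (real b / (real b - 1))\<^sup>2" if "b \<in> ({2} \<union> prime_factors a) \<union> prime_factors N - {q \<in> P. \<not> good q}" for b
      using that by (intro ge1) (auto simp: in_prime_factors_iff)
  qed auto
  also have "\<dots> \<le> (\<Prod>q\<in>{2} \<union> prime_factors a. (real q / (real q - 1))\<^sup>2) * totient_ratio_sq N"
    unfolding totient_ratio_sq_def by (intro prod_union_le) (auto simp: in_prime_factors_iff intro!: ge1)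
  also have "\<dots> \<le> ((\<Prod>q\<in>{2}. (real q / (real q - 1))\<^sup>2) * totient_ratio_sq a) * totient_ratio_sq N"
    using totient_ratio_sq_ge_1[of N] unfolding totient_ratio_sq_def[of a]
    by (intro mult_right_mono prod_union_le) (auto simp: in_prime_factors_iff intro!: ge1)
  also have "\<dots> = 4 * totient_ratio_sq a * totient_ratio_sq N" by simp
  finally have K4: "K \<le> 4 * totient_ratio_sq a * totient_ratio_sq N" .
  have "ln (real y) \<le> smooth_harmonic P (real y)"
    using smooth_harmonic_ge_ln[OF y1(1)] by (simp add: P_def)
  then have "(ln (real y))\<^sup>2 \<le> smooth_harmonic P (real y) * smooth_harmonic P (real y)"
    unfolding power2_eq_square using ly by (intro mult_mono smooth_harmonic_nonneg) auto
  also have "\<dots> \<le> K * selberg_sum {q \<in> P. good q} (real y * real y)"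
    unfolding K_def using P Q3 by (intro smooth_harmonic_product_le) auto
  also have "\<dots> = K * ?G" by (simp add: Q_def power2_eq_square)
  finally have "1 / ?G \<le> K / (ln (real y))\<^sup>2" using G1 ly by (simp add: field_simps)
  then have "real M * (1 / ?G) \<le> real M * (K / (ln (real y))\<^sup>2)" by (intro mult_left_mono) auto
  also have "real M \<le> 2 * real N / real a"
  proof -
    have "N div a \<ge> 1" using assms by (simp add: Suc_le_eq div_greater_zero_iff)
    then have "real M \<le> 2 * real (N div a)" by (simp add: M_def)
    also have "real (N div a) \<le> real N / real a" by (rule of_nat_div_le_of_nat)
    finally show ?thesis by simp
  qed
  then have "real M * (K / (ln (real y))\<^sup>2) \<le> 2 * real N / real a * (4 * totient_ratio_sq a * totient_ratio_sq N / (ln (real y))\<^sup>2)"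
    using K4 K0 by (intro mult_mono divide_right_mono) auto
  finally have "real M / ?G \<le> 8 * real N * totient_ratio_sq N / (ln y)\<^sup>2 * (totient_ratio_sq a / real a)"
    by (simp add: mult_ac)
  moreover have "4 * real y ^ 8 / ?G \<le> 4 * real y ^ 8 / 1"
    using G1 by (intro divide_left_mono) auto
  ultimately show ?thesis using cS by simp
qed

section \<open>Sums over shifted primes\<close>

text \<open>
  The three terms belong to the primes \<open>p \<le> y\<close>, to the integers \<open>N - p\<close> whose
  \<open>y\<close>-smooth part exceeds \<open>\<surd>N\<close>, and to the remaining ones.
\<close>

lemma sum_shifted_primes_le:
  fixes N y h :: nat and B :: real
  assumes h: "4 dvd h" "h > 0" and y: "3 \<le> y" "y \<le> N" and B: "B \<ge> 0" "B / ln y \<le> 1 / 4"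
  defines "E \<equiv> (\<Sum>p | prime p \<and> p \<le> y. f h p / real p)"
  shows "(\<Sum>p | prime p \<and> p < N. f h (N - p)) \<le> 2 * real y * sqrt N
    + 3 * real N * (real N powr (- (B / ln y) / 2)) * exp (E + 4 * B * exp B + 45)
    + 2 powr (ln N / ln y) * (8 * real N * totient_ratio_sq N / (ln y)\<^sup>2 * exp (E + 76) + 12 * real y ^ 8 * sqrt N)"
proof -
  define P where "P = {p. prime p \<and> p \<le> y}"
  define \<eta> where "\<eta> = B / ln y"
  define W where "W = 2 powr (ln (real N) / ln (real y))"
  have ly: "ln (real y) > 0" using y by simp
  have \<eta>: "0 \<le> \<eta>" "\<eta> \<le> 1 / 4" using B ly by (auto simp: \<eta>_def)
  have N1: "real N \<ge> 1" "sqrt (real N) \<ge> 1" using y by auto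
  define splits where "splits = (\<lambda>n z. n = fst z * snd z \<and> fst z > 0 \<and> snd z > 0 \<and> prime_factors (fst z) \<subseteq> P
      \<and> (\<forall>q. prime q \<longrightarrow> q dvd snd z \<longrightarrow> q \<notin> P))"
  have "\<exists>z. splits n z" if pos: "n > 0" for n
  proof -
    obtain a b where "n = a * b \<and> a > 0 \<and> b > 0 \<and> prime_factors a \<subseteq> P \<and> (\<forall>q. prime q \<longrightarrow> q dvd b \<longrightarrow> q \<notin> P)"
      using smooth_rough_decomposition[OF pos, of P] by blast
    then have "splits n (a, b)" by (simp add: splits_def)
    then show ?thesis ..
  qed
  then have "\<forall>n\<in>{0<..}. \<exists>z. splits n z" by simp
  then obtain d where d: "\<forall>n\<in>{0<..}. splits n (d n)" by (rule bchoice[THEN exE])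
  define sm rg where "sm = (\<lambda>n. fst (d n))" and "rg = (\<lambda>n. snd (d n))"
  have "splits n (sm n, rg n)" if "n > 0" for n
    using d that by (simp add: sm_def rg_def)
  then have dec: "\<And>n. n > 0 \<Longrightarrow> n = sm n * rg n" "\<And>n. n > 0 \<Longrightarrow> sm n > 0" "\<And>n. n > 0 \<Longrightarrow> rg n > 0"
      "\<And>n. n > 0 \<Longrightarrow> prime_factors (sm n) \<subseteq> P" "\<And>n q. n > 0 \<Longrightarrow> prime q \<Longrightarrow> q dvd rg n \<Longrightarrow> q \<notin> P"
    by (simp_all add: splits_def)
  define a where "a = (\<lambda>p. sm (N - p))"
  define b where "b = (\<lambda>p. rg (N - p))"
  define Pr where "Pr = {p. prime p \<and> p < N}"
  have finPr: "finite Pr" by (simp add: Pr_def)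
  have ab: "N - p = a p * b p" "a p > 0" "b p > 0" "prime_factors (a p) \<subseteq> P" if "p \<in> Pr" for p
    using dec[of "N - p"] that by (auto simp: Pr_def a_def b_def)
  have brough: "q > y" if "p \<in> Pr" "prime q" "q dvd b p" for p q
    using dec(5)[of "N - p" q] that by (auto simp: Pr_def b_def P_def)
  have ale: "a p \<le> N" "b p \<le> N" if "p \<in> Pr" for p
  proof -
    have "a p \<le> a p * b p" "b p \<le> a p * b p" using ab[OF that] by auto
    then show "a p \<le> N" "b p \<le> N" using ab(1)[OF that] by linarith+
  qed
  have fab: "f h (N - p) = f h (a p) * f h (b p)" if p: "p \<in> Pr" for p
  proof -
    have "coprime (a p) (b p)"
    proof (rule ccontr)
      assume "\<not> coprime (a p) (b p)"
      then have "gcd (a p) (b p) \<noteq> 1" by (simp add: coprime_iff_gcd_eq_1)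
      then obtain q where q: "prime q" "q dvd gcd (a p) (b p)" using prime_factor_nat by blast
      then have "q \<in> prime_factors (a p)" using ab(2)[OF p] by (auto simp: in_prime_factors_iff)
      then have "q \<le> y" using ab(4)[OF p] by (auto simp: P_def)
      then show False using brough[OF p q(1)] q(2) by simp
    qed
    then show ?thesis using f_mult_coprime[OF h(1)] ab[OF p] by simp
  qed
  have binj: "inj_on b {p \<in> A. a p = c}" if "A \<subseteq> Pr" for A c
  proof (rule inj_onI)
    fix p q assume pq: "p \<in> {p \<in> A. a p = c}" "q \<in> {p \<in> A. a p = c}" "b p = b q"
    then have "p \<in> Pr" "q \<in> Pr" using that by auto
    then have "N - p = N - q" "p < N" "q < N" using ab(1)[of p] ab(1)[of q] pq by (auto simp: Pr_def)
    then show "p = q" by linarith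
  qed
  define A1 where "A1 = {p \<in> Pr. p \<le> y}"
  define A2 where "A2 = {p \<in> Pr. p > y \<and> real (a p) > sqrt N}"
  define A3 where "A3 = {p \<in> Pr. p > y \<and> real (a p) \<le> sqrt N}"
  have fin: "finite A1" "finite A2" "finite A3" using finPr by (auto simp: A1_def A2_def A3_def)
  have sub: "A1 \<subseteq> Pr" "A2 \<subseteq> Pr" "A3 \<subseteq> Pr" by (auto simp: A1_def A2_def A3_def)
  have part: "Pr = A1 \<union> A2 \<union> A3" by (auto simp: A1_def A2_def A3_def)
  have disj: "A1 \<inter> A2 = {}" "(A1 \<union> A2) \<inter> A3 = {}" by (auto simp: A1_def A2_def A3_def)
  have total: "(\<Sum>p\<in>Pr. f h (N - p)) = (\<Sum>p\<in>A1. f h (N - p)) + (\<Sum>p\<in>A2. f h (N - p)) + (\<Sum>p\<in>A3. f h (N - p))"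
    unfolding part using fin disj by (simp only: sum.union_disjoint finite_Un)
  have S1: "(\<Sum>p\<in>A1. f h (N - p)) \<le> 2 * real y * sqrt N"
  proof -
    have "(\<Sum>p\<in>A1. f h (N - p)) \<le> real (card A1) * (2 * sqrt N)"
    proof (rule sum_bounded_above)
      fix p assume "p \<in> A1"
      then have "N - p > 0" by (auto simp: A1_def Pr_def)
      then have "f h (N - p) \<le> 2 * sqrt (real (N - p))" by (rule f_le_sqrt)
      also have "\<dots> \<le> 2 * sqrt N" by simp
      finally show "f h (N - p) \<le> 2 * sqrt N" .
    qed
    also have "card A1 \<le> card {1..y}" by (rule card_mono) (auto simp: A1_def Pr_def Suc_le_eq prime_gt_0_nat)
    then have "real (card A1) * (2 * sqrt N) \<le> real y * (2 * sqrt N)" by (intro mult_right_mono) auto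
    finally show ?thesis by (simp add: mult_ac)
  qed
  have S2: "(\<Sum>p\<in>A2. f h (N - p)) \<le> 3 * real N * (real N powr (- \<eta> / 2)) * exp (E + 4 * B * exp B + 45)"
  proof -
    define T where "T = {c \<in> smooth_upto P (real N). real c > sqrt N}"
    have T: "finite T" by (simp add: T_def)
    have aT: "a ` A2 \<subseteq> T"
      using sub ab ale by (fastforce simp: T_def A2_def smooth_upto_def)
    have "(\<Sum>p\<in>A2. f h (N - p)) = (\<Sum>c\<in>T. \<Sum>p | p \<in> A2 \<and> a p = c. f h (N - p))"
      by (rule sum.group[symmetric, OF fin(2) T aT])
    also have "\<dots> \<le> (\<Sum>c\<in>T. 3 * real N * (real N powr (- \<eta> / 2)) * (f h c * real c powr (\<eta> - 1)))"
    proof (rule sum_mono)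
      fix c assume c: "c \<in> T"
      then have c0: "c > 0" "real c \<le> real N" "sqrt N < real c" by (auto simp: T_def smooth_upto_def)
      let ?A = "{p \<in> A2. a p = c}"
      have "(\<Sum>p\<in>?A. f h (N - p)) = f h c * (\<Sum>p\<in>?A. f h (b p))"
        unfolding sum_distrib_left by (rule sum.cong) (use fab sub in auto)
      also have "(\<Sum>p\<in>?A. f h (b p)) = (\<Sum>m\<in>b ` ?A. f h m)"
        using binj[OF sub(2), of c] by (simp add: sum.reindex)
      also have "\<dots> \<le> (\<Sum>m | 0 < m \<and> real m \<le> real N / real c. f h m)"
      proof (rule sum_mono2)
        have "{m. 0 < m \<and> real m \<le> real N / real c} \<subseteq> {..nat \<lfloor>real N / real c\<rfloor>}" by (auto simp: le_nat_floor)
        then show "finite {m. 0 < m \<and> real m \<le> real N / real c}" by (rule finite_subset) simp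
        show "b ` ?A \<subseteq> {m. 0 < m \<and> real m \<le> real N / real c}"
        proof
          fix m assume "m \<in> b ` ?A"
          then obtain p where p: "p \<in> Pr" "a p = c" "m = b p" using sub by auto
          then have "c * m \<le> N" using ab(1)[OF p(1)] by (metis diff_le_self)
          then have "real (c * m) \<le> real N" by (rule of_nat_mono)
          then show "m \<in> {m. 0 < m \<and> real m \<le> real N / real c}"
            using c0 ab(3)[OF p(1)] p by (simp add: field_simps)
        qed
      qed (simp add: f_nonneg)
      also have "\<dots> \<le> 3 * (real N / real c)" using c0 by (intro sum_f_le) simp
      finally have "(\<Sum>p\<in>?A. f h (N - p)) \<le> f h c * (3 * (real N / real c))"
        by (simp add: mult_left_mono f_nonneg)
      also have "\<dots> = f h c * 3 * real N * (real c powr (\<eta> - 1) * real c powr - \<eta>)"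
      proof -
        have "real c powr (\<eta> - 1) * real c powr - \<eta> = 1 / real c"
          unfolding powr_add[symmetric] using c0 by (simp add: powr_minus_divide)
        then show ?thesis by simp
      qed
      also have "\<dots> \<le> f h c * 3 * real N * (real c powr (\<eta> - 1) * real N powr (- \<eta> / 2))"
      proof (intro mult_left_mono)
        \<comment> \<open>Rankin's trick: \<open>c > \<surd>N\<close>.\<close>
        have "real c powr - \<eta> \<le> (sqrt N) powr - \<eta>" using c0 N1 \<eta> by (intro powr_mono2') auto
        also have "\<dots> = real N powr (- \<eta> / 2)" by (simp add: powr_half_sqrt[symmetric] powr_powr)
        finally show "real c powr - \<eta> \<le> real N powr (- \<eta> / 2)" .
      qed (auto simp: f_nonneg)
      finally show "(\<Sum>p\<in>?A. f h (N - p)) \<le> 3 * real N * (real N powr (- \<eta> / 2)) * (f h c * real c powr (\<eta> - 1))"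
        by (simp add: mult_ac)
    qed
    also have "\<dots> = 3 * real N * (real N powr (- \<eta> / 2)) * (\<Sum>c\<in>T. f h c * real c powr (\<eta> - 1))"
      by (simp add: sum_distrib_left)
    also have "(\<Sum>c\<in>T. f h c * real c powr (\<eta> - 1)) \<le> (\<Sum>c\<in>smooth_upto P (real N). f h c * real c powr (\<eta> - 1))"
      by (rule sum_mono2) (auto simp: T_def f_nonneg)
    also have "\<dots> \<le> exp ((\<Sum>p\<in>P. f h p * real p powr (\<eta> - 1)) + 45)"
      unfolding P_def by (rule sum_smooth_f_rankin_le[OF h(1) \<eta>])
    also have "\<dots> \<le> exp (E + 4 * B * exp B + 45)"
      using sum_f_primes_shift_le[OF h(1) _ B(1), of y] y by (simp add: P_def E_def \<eta>_def)
    finally show ?thesis by (simp add: mult_left_mono)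
  qed
  have S3: "(\<Sum>p\<in>A3. f h (N - p)) \<le> W * (8 * real N * totient_ratio_sq N / (ln y)\<^sup>2 * exp (E + 76) + 12 * real y ^ 8 * sqrt N)"
  proof -
    define T where "T = smooth_upto P (sqrt N)"
    define D where "D = 8 * real N * totient_ratio_sq N / (ln y)\<^sup>2"
    have D0: "D \<ge> 0" using totient_ratio_sq_ge_1[of N] by (simp add: D_def)
    have T: "finite T" by (simp add: T_def)
    have aT: "a ` A3 \<subseteq> T"
      using sub ab by (fastforce simp: T_def A3_def smooth_upto_def)
    have "(\<Sum>p\<in>A3. f h (N - p)) = (\<Sum>c\<in>T. \<Sum>p | p \<in> A3 \<and> a p = c. f h (N - p))"
      by (rule sum.group[symmetric, OF fin(3) T aT])
    also have "\<dots> \<le> (\<Sum>c\<in>T. W * (D * (f h c * totient_ratio_sq c / real c) + 4 * real y ^ 8 * f h c))"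
    proof (rule sum_mono)
      fix c assume c: "c \<in> T"
      then have c0: "c > 0" "real c \<le> sqrt N" by (auto simp: T_def smooth_upto_def)
      have "sqrt (real N) * 1 \<le> sqrt (real N) * sqrt (real N)" using N1 by (intro mult_left_mono) auto
      then have "real c \<le> real N" using c0 by simp
      then have cN: "c \<le> N" by simp
      let ?A = "{p \<in> A3. a p = c}"
      have "(\<Sum>p\<in>?A. f h (N - p)) \<le> (\<Sum>p\<in>?A. f h c * W)"
      proof (rule sum_mono)
        fix p assume p: "p \<in> ?A"
        then have pP: "p \<in> Pr" using sub by auto
        have "f h (b p) \<le> 2 powr (ln (b p) / ln y)"
          using y ab(3)[OF pP] brough[OF pP] by (intro f_rough_le[OF h(1)]) auto
        also have "\<dots> \<le> W"
          unfolding W_def using ale(2)[OF pP] ab(3)[OF pP] ly by (intro powr_mono divide_right_mono) auto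
        finally show "f h (N - p) \<le> f h c * W" using fab[OF pP] p by (simp add: mult_left_mono f_nonneg)
      qed
      also have "\<dots> = f h c * W * real (card (b ` ?A))"
        using binj[OF sub(3), of c] by (simp add: card_image mult_ac)
      also have "\<dots> \<le> f h c * W * (8 * real N * totient_ratio_sq N / (ln y)\<^sup>2 * (totient_ratio_sq c / real c) + 4 * real y ^ 8)"
      proof (intro mult_left_mono card_sieved_le[OF y(1) c0(1) cN])
        fix m assume "m \<in> b ` ?A"
        then obtain p where p: "p \<in> Pr" "a p = c" "m = b p" "p > y" using sub by (auto simp: A3_def)
        have eq: "c * m = N - p" using ab(1)[OF p(1)] p by simp
        then show "c * m \<le> N" by simp
        fix q assume q: "prime q" "q \<le> y"
        show "\<not> q dvd m" using brough[OF p(1) q(1)] q p by auto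
        have "N - c * m = p" using eq p(1) by (simp add: Pr_def)
        then show "\<not> q dvd N - c * m" using q p by (auto simp: Pr_def dest: primes_dvd_imp_eq)
      qed (auto simp: W_def f_nonneg)
      finally show "(\<Sum>p\<in>?A. f h (N - p)) \<le> W * (D * (f h c * totient_ratio_sq c / real c) + 4 * real y ^ 8 * f h c)"
        unfolding D_def[symmetric] by (simp add: algebra_simps)
    qed
    also have "\<dots> = W * (D * (\<Sum>c\<in>T. f h c * totient_ratio_sq c / real c) + 4 * real y ^ 8 * (\<Sum>c\<in>T. f h c))"
      by (simp only: sum_distrib_left[symmetric] sum.distrib)
    also have "\<dots> \<le> W * (D * exp (E + 76) + 4 * real y ^ 8 * (3 * sqrt N))"
    proof (intro mult_left_mono add_mono)
      show "(\<Sum>c\<in>T. f h c * totient_ratio_sq c / real c) \<le> exp (E + 76)"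
        unfolding T_def P_def E_def by (rule sum_smooth_f_ratio_le[OF h(1)])
      have "(\<Sum>c\<in>T. f h c) \<le> (\<Sum>m | 0 < m \<and> real m \<le> sqrt N. f h m)"
      proof (rule sum_mono2)
        have "{m. 0 < m \<and> real m \<le> sqrt N} \<subseteq> {..nat \<lfloor>sqrt N\<rfloor>}" by (auto simp: le_nat_floor)
        then show "finite {m. 0 < m \<and> real m \<le> sqrt N}" by (rule finite_subset) simp
      qed (auto simp: T_def smooth_upto_def f_nonneg)
      also have "\<dots> \<le> 3 * sqrt N" by (rule sum_f_le[OF N1(2)])
      finally show "(\<Sum>c\<in>T. f h c) \<le> 3 * sqrt N" .
    qed (use D0 in \<open>auto simp: W_def\<close>)
    finally show ?thesis by (simp add: D_def mult_ac)
  qed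
  show ?thesis
    using total S1 S2 S3 unfolding Pr_def W_def \<eta>_def by linarith
qed

text \<open>
  This settles bounded \<open>N\<close>.
\<close>

lemma sum_shifted_primes_trivial:
  assumes "N > 0"
  shows "(\<Sum>p | prime p \<and> p < N. f h (N - p)) \<le> 2 * real N * sqrt N"
proof -
  have "(\<Sum>p | prime p \<and> p < N. f h (N - p)) \<le> real (card {p. prime p \<and> p < N}) * (2 * sqrt N)"
  proof (rule sum_bounded_above)
    fix p assume "p \<in> {p. prime p \<and> p < N}"
    then have "N - p > 0" by auto
    then have "f h (N - p) \<le> 2 * sqrt (real (N - p))" by (rule f_le_sqrt)
    also have "\<dots> \<le> 2 * sqrt N" by simp
    finally show "f h (N - p) \<le> 2 * sqrt N" .
  qed
  also have "card {p. prime p \<and> p < N} \<le> card {..<N}" by (rule card_mono) auto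
  then have "real (card {p. prime p \<and> p < N}) * (2 * sqrt N) \<le> real N * (2 * sqrt N)"
    by (intro mult_right_mono) auto
  finally show ?thesis by (simp add: mult_ac)
qed

text \<open>
  What it takes for \<open>L = ln N\<close> to be large. The condition on \<open>exp (- L / 4)\<close> disposes
  of the terms that save a power of \<open>N\<close>; the last two conditions serve for the large and for the
  small smooth parts.
\<close>

lemma eventually_log_conditions:
  fixes \<epsilon> M :: real
  assumes "\<epsilon> > 0"
  shows "eventually (\<lambda>L. 2 \<le> L \<and> 256 / \<epsilon> \<le> ln L \<and> 1 \<le> ln L \<and> M \<le> L / (\<epsilon> / 8 * ln L) \<and> exp (- L / 4) \<le> L powr (- 5 / 4)
     \<and> L powr (- 3) * L powr (3/4) * (2 + ln L) powr (1/4) \<le> L powr (- 5 / 4)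
     \<and> (ln L)\<^sup>2 * (2 + ln L) powr (1/4) \<le> L powr (\<epsilon> / 4)) at_top"
proof (intro eventually_conj)
  show "eventually (\<lambda>L::real. 2 \<le> L) at_top" by (rule eventually_ge_at_top)
  have ln: "filterlim (ln :: real \<Rightarrow> real) at_top at_top" by (rule ln_at_top)
  show "eventually (\<lambda>L. 256 / \<epsilon> \<le> ln L) at_top" using ln by (simp add: filterlim_at_top)
  show "eventually (\<lambda>L::real. 1 \<le> ln L) at_top" using ln by (simp add: filterlim_at_top)
  have "filterlim (\<lambda>L::real. L / (\<epsilon> / 8 * ln L)) at_top at_top" using assms by real_asymp
  then show "eventually (\<lambda>L. M \<le> L / (\<epsilon> / 8 * ln L)) at_top" by (simp add: filterlim_at_top)
  show "eventually (\<lambda>L::real. exp (- L / 4) \<le> L powr (- 5 / 4)) at_top" by real_asymp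
  show "eventually (\<lambda>L::real. L powr (- 3) * L powr (3/4) * (2 + ln L) powr (1/4) \<le> L powr (- 5 / 4)) at_top"
    by real_asymp
  show "eventually (\<lambda>L::real. (ln L)\<^sup>2 * (2 + ln L) powr (1/4) \<le> L powr (\<epsilon> / 4)) at_top"
    using assms by real_asymp
qed

text \<open>
  The choice of parameters. With \<open>y = exp (L / (D ln L))\<close> the factor
  \<open>2 powr (L / ln y)\<close> is a power \<open>L powr O(D)\<close>, and Rankin's trick saves
  \<open>L powr (B D / 2)\<close>; \<open>D\<close> is a small multiple of \<open>\<epsilon>\<close>, and
  \<open>B D = 6\<close> makes the saving \<open>L powr 3\<close>. The other powers of \<open>L\<close> are
  \<open>\<epsilon>/4\<close> from \<open>(N / \<phi>(N))\<^sup>2\<close> and \<open>\<epsilon>/4\<close> from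
  powers of \<open>ln L\<close>.
\<close>

lemma sum_shifted_primes_large:
  fixes \<epsilon> :: real
  assumes \<epsilon>: "\<epsilon> > 0"
  shows "\<exists>C L0. C \<ge> 0 \<and> (\<forall>N h :: nat. 4 dvd h \<longrightarrow> h > 0 \<longrightarrow> real h \<le> ln (real N) \<longrightarrow> N > 0 \<longrightarrow> L0 \<le> ln (real N) \<longrightarrow>
     (\<Sum>p | prime p \<and> p < N. f h (N - p)) \<le> C * real N * ln (real N) powr (- 5 / 4 + \<epsilon>))"
proof -
  define D where "D = \<epsilon> / 8"
  define B where "B = 6 / D"
  have D: "D > 0" using \<epsilon> by (simp add: D_def)
  have B: "B > 0" using D by (simp add: B_def)
  obtain K where K: "K > 0" "\<And>h (y::nat). 4 dvd h \<Longrightarrow> h > 0 \<Longrightarrow> y \<ge> 3 \<Longrightarrow>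
    exp (\<Sum>p | prime p \<and> p \<le> y. f h p / real p) \<le> K * ln y powr (3/4) * (1 + ln (2 * real h)) powr (1/4)"
    using exp_sum_f_over_primes_le by blast
  obtain Cw where Cw: "Cw > 0" "\<And>N::nat. N \<ge> 3 \<Longrightarrow> totient_ratio_sq N \<le> Cw * ln N powr (\<epsilon> / 4)"
    using totient_ratio_sq_le[of "\<epsilon> / 4"] \<epsilon> by auto
  obtain L0 where L0: "\<And>L. L \<ge> L0 \<Longrightarrow> 2 \<le> L \<and> 256 / \<epsilon> \<le> ln L \<and> 1 \<le> ln L \<and> max 2 (8 * B) \<le> L / (\<epsilon> / 8 * ln L) \<and> exp (- L / 4) \<le> L powr (- 5 / 4)
     \<and> L powr (- 3) * L powr (3/4) * (2 + ln L) powr (1/4) \<le> L powr (- 5 / 4)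
     \<and> (ln L)\<^sup>2 * (2 + ln L) powr (1/4) \<le> L powr (\<epsilon> / 4)"
    using eventually_log_conditions[OF \<epsilon>, of "max 2 (8 * B)"] unfolding eventually_at_top_linorder by blast
  define C2 where "C2 = 3 * exp (4 * B * exp B + 45) * K"
  define C3 where "C3 = 8 * Cw * (4 * D\<^sup>2) * exp 76 * K"
  have C: "C2 \<ge> 0" "C3 \<ge> 0" using K Cw by (auto simp: C2_def C3_def)
  show ?thesis
  proof (rule exI[of _ "2 + C2 + C3 + 12"], rule exI[of _ L0], intro conjI allI impI)
    show "0 \<le> 2 + C2 + C3 + 12" using C by simp
    fix N h :: nat
    assume h: "4 dvd h" "h > 0" "real h \<le> ln (real N)" and N0: "N > 0" and LN: "L0 \<le> ln (real N)"
    define L where "L = ln (real N)"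
    define l where "l = ln L"
    define u where "u = L / (D * l)"
    define y where "y = nat \<lfloor>exp u\<rfloor>"
    define X where "X = L powr (- 5 / 4 + \<epsilon>)"
    note facts = L0[OF LN, folded L_def, folded D_def, folded l_def, folded u_def]
    have L: "L \<ge> 2" "l \<ge> 1" "l \<ge> 256 / \<epsilon>" using facts by auto
    have u: "u \<ge> 2" "u \<ge> 8 * B" using facts by auto
    have Dl: "D * l \<ge> 32" using L(3) \<epsilon> by (simp add: D_def field_simps)
    then have Dl0: "D * l \<noteq> 0" by linarith
    have expL: "exp L = real N" using N0 by (simp add: L_def)
    have uL: "u * 32 \<le> L"
    proof -
      have "u * 32 \<le> u * (D * l)" using Dl u by (intro mult_left_mono) auto
      also have "\<dots> = L" using Dl0 by (simp add: u_def)
      finally show ?thesis .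
    qed
    have "2 \<le> exp (1::real)" using exp_ge_add_one_self[of 1] by simp
    then have "2 * 2 \<le> exp 1 * exp (1::real)" by (intro mult_mono) auto
    then have e4: "exp u \<ge> 4" using u by (smt (verit) exp_add exp_le_cancel_iff)
    have y: "real y \<le> exp u" "real y \<ge> exp u / 2" "y \<ge> 3"
    proof -
      show "real y \<le> exp u" by (simp add: y_def)
      have "real y > exp u - 1" 
      proof -
        have "real y = of_int \<lfloor>exp u\<rfloor>" by (simp add: y_def)
        then show ?thesis by linarith
      qed
      then show "real y \<ge> exp u / 2" "y \<ge> 3" using e4 by linarith+
    qed
    have y0: "real y > 0" using y by simp
    have lnyu: "ln (real y) \<le> u" 
    proof -
      have "ln (real y) \<le> ln (exp u)" using y(1) y0 by (subst ln_le_cancel_iff) auto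
      then show ?thesis by simp
    qed
    have lny2: "ln (real y) \<ge> u / 2"
    proof -
      have "u / 2 \<le> u - ln 2" using u ln_2_less_1 by linarith
      also have "\<dots> = ln (exp u / 2)" by (simp add: ln_div)
      also have "\<dots> \<le> ln (real y)" using y y0 by (subst ln_le_cancel_iff) auto
      finally show ?thesis .
    qed
    have ly0: "ln (real y) > 0" using lny2 u by linarith
    have lnyL: "ln (real y) \<le> L" using lnyu uL u by linarith
    have yN: "y \<le> N"
    proof -
      have "real y \<le> exp L" using y(1) uL u by (smt (verit) exp_le_cancel_iff)
      then show ?thesis using expL by simp
    qed
    have N3: "N \<ge> 3" using yN y by simp
    have X0: "X > 0" using L by (simp add: X_def)
    have X54: "L powr (- 5 / 4) \<le> X" unfolding X_def using L \<epsilon> by (intro powr_mono) auto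
    define V where "V = (2 + l) powr (1/4)"
    define E where "E = (\<Sum>p | prime p \<and> p \<le> y. f h p / real p)"
    have EK: "exp E \<le> K * (L powr (3/4) * V)"
    proof -
      have "exp E \<le> K * ln y powr (3/4) * (1 + ln (2 * real h)) powr (1/4)"
        unfolding E_def by (rule K(2)[OF h(1,2) y(3)])
      also have "\<dots> \<le> K * L powr (3/4) * (2 + l) powr (1/4)"
      proof (intro mult_mono powr_mono2 mult_left_mono)
        have "ln (2 * real h) = ln 2 + ln (real h)" using h by (simp add: ln_mult_pos)
        moreover have "ln (real h) \<le> l" unfolding l_def L_def using h by (subst ln_le_cancel_iff) auto
        ultimately show "1 + ln (2 * real h) \<le> 2 + l" using ln_2_less_1 by linarith
        have "ln (2 * real h) \<ge> 0" by (rule ln_ge_zero) (use h in simp)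
        then show "0 \<le> 1 + ln (2 * real h)" by linarith
      qed (use K L ly0 lnyL in auto)
      finally show ?thesis by (simp add: V_def mult.assoc)
    qed
    have sq: "sqrt (real N) = exp (L / 2)"
      by (rule real_sqrt_unique) (auto simp: power2_eq_square expL simp flip: exp_add)
    have small: "real y ^ 8 * sqrt N \<le> real N * L powr (- 5 / 4)"
    proof -
      have "real y ^ 8 \<le> exp u ^ 8" using y(1) by (intro power_mono) auto
      also have "\<dots> = exp (8 * u)" by (simp flip: exp_of_nat_mult)
      also have "\<dots> \<le> exp (L / 4)" using uL by simp
      finally have "real y ^ 8 * sqrt N \<le> exp (L / 4) * exp (L / 2)"
        unfolding sq by (intro mult_right_mono) auto
      also have "\<dots> = exp L * exp (- L / 4)" by (simp flip: exp_add)
      also have "\<dots> \<le> exp L * L powr (- 5 / 4)" using facts by (intro mult_left_mono) auto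
      finally show ?thesis by (simp add: expL)
    qed
    have t1: "2 * real y * sqrt N \<le> 2 * real N * X"
    proof -
      have "real y ^ 1 \<le> real y ^ 8" using y by (intro power_increasing) auto
      then have "real y * sqrt N \<le> real y ^ 8 * sqrt N" by (intro mult_right_mono) auto
      also have "\<dots> \<le> real N * L powr (- 5 / 4)" by (rule small)
      also have "\<dots> \<le> real N * X" using X54 by (intro mult_left_mono) auto
      finally show ?thesis by simp
    qed
    have t2: "3 * real N * (real N powr (- (B / ln y) / 2)) * exp (E + 4 * B * exp B + 45) \<le> C2 * real N * X"
    proof -
      have "real N powr (- (B / ln y) / 2) = exp (- (B / ln y) / 2 * L)"
        using N0 by (simp add: powr_def L_def)
      also have "\<dots> \<le> exp (- 3 * l)"
      proof -
        have "u * (D * l) = L" using Dl0 by (simp add: u_def)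
        have "L = D * l * u" using Dl0 by (simp add: u_def)
        then have "3 * l * ln (real y) \<le> B / 2 * L"
          using mult_left_mono[OF lnyu, of "3 * l"] L D by (simp add: B_def)
        then have "3 * l \<le> B / 2 * L / ln (real y)" using ly0 by (simp add: le_divide_eq)
        then show ?thesis by simp
      qed
      also have "\<dots> = L powr (- 3)" using L by (simp add: powr_def l_def)
      finally have "real N powr (- (B / ln y) / 2) * exp E \<le> L powr (- 3) * (K * (L powr (3/4) * V))"
        using EK by (intro mult_mono) auto
      also have "\<dots> = K * (L powr (- 3) * L powr (3/4) * V)" by simp
      also have "\<dots> \<le> K * X"
        using facts X54 K unfolding V_def by (intro mult_left_mono) auto
      finally have "3 * real N * exp (4 * B * exp B + 45) * (real N powr (- (B / ln y) / 2) * exp E) \<le> 3 * real N * exp (4 * B * exp B + 45) * (K * X)"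
        by (intro mult_left_mono) auto
      then show ?thesis by (simp add: C2_def exp_add mult_ac)
    qed
    have t3: "2 powr (ln N / ln y) * (8 * real N * totient_ratio_sq N / (ln y)\<^sup>2 * exp (E + 76) + 12 * real y ^ 8 * sqrt N) \<le> (C3 + 12) * real N * X"
    proof -
      have W: "2 powr (ln N / ln y) \<le> L powr (\<epsilon> / 4)"
      proof -
        have "L \<le> 2 * D * l * ln (real y)"
        proof -
          have "L = 2 * D * l * (u / 2)" using Dl0 by (simp add: u_def)
          also have "\<dots> \<le> 2 * D * l * ln (real y)" using lny2 D L by (intro mult_left_mono) auto
          finally show ?thesis .
        qed
        then have "L / ln (real y) \<le> 2 * D * l" using ly0 by (simp add: divide_le_eq)
        then have "2 powr (L / ln y) \<le> 2 powr (2 * D * l)" by (intro powr_mono) auto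
        also have "\<dots> = exp (2 * D * l * ln 2)" by (simp add: powr_def)
        also have "\<dots> \<le> exp (2 * D * l * 1)" using ln_2_less_1 D L by (subst exp_le_cancel_iff, intro mult_left_mono) auto
        also have "\<dots> = L powr (\<epsilon> / 4)" using L by (simp add: powr_def l_def D_def)
        finally show ?thesis by (simp add: L_def)
      qed
      have inv: "1 / (ln y)\<^sup>2 \<le> 4 * D\<^sup>2 * l\<^sup>2 * L powr (- 2)"
      proof -
        have "1 / (ln y)\<^sup>2 \<le> 1 / (u / 2)\<^sup>2" using lny2 u by (intro frac_le power_mono) auto
        also have "\<dots> = 4 * D\<^sup>2 * l\<^sup>2 * L powr (- 2)"
          using L by (simp add: u_def power_mult_distrib power_divide powr_minus_divide)
        finally show ?thesis .
      qed
      have "8 * real N * totient_ratio_sq N / (ln y)\<^sup>2 * exp (E + 76)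
         = 8 * real N * exp 76 * (totient_ratio_sq N * (1 / (ln y)\<^sup>2) * exp E)"
        by (simp add: exp_add mult_ac)
      also have "\<dots> \<le> 8 * real N * exp 76 * ((Cw * L powr (\<epsilon> / 4)) * (4 * D\<^sup>2 * l\<^sup>2 * L powr (- 2)) * (K * (L powr (3/4) * V)))"
        using Cw(2)[OF N3] inv EK totient_ratio_sq_ge_1[of N] Cw(1) D
        by (intro mult_left_mono mult_mono) (auto simp: L_def)
      also have "\<dots> = C3 * real N * (L powr (\<epsilon> / 4) * (L powr (- 2) * L powr (3/4)) * (l\<^sup>2 * V))"
        by (simp add: C3_def mult_ac)
      also have "\<dots> \<le> C3 * real N * (L powr (\<epsilon> / 4) * (L powr (- 2) * L powr (3/4)) * L powr (\<epsilon> / 4))"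
        using facts C unfolding V_def by (intro mult_left_mono) auto
      also have "\<dots> = C3 * real N * L powr (- 5 / 4 + \<epsilon> / 2)"
        by (simp add: algebra_simps flip: powr_add)
      finally have main: "8 * real N * totient_ratio_sq N / (ln y)\<^sup>2 * exp (E + 76) \<le> C3 * real N * L powr (- 5 / 4 + \<epsilon> / 2)" .
      have "L powr (- 5 / 4) \<le> L powr (- 5 / 4 + \<epsilon> / 2)" using L \<epsilon> by (intro powr_mono) auto
      then have "12 * (real y ^ 8 * sqrt N) \<le> 12 * (real N * L powr (- 5 / 4 + \<epsilon> / 2))"
        using small mult_left_mono[of "L powr (- 5 / 4)" "L powr (- 5 / 4 + \<epsilon> / 2)" "real N"] by linarith
      with main have "8 * real N * totient_ratio_sq N / (ln y)\<^sup>2 * exp (E + 76) + 12 * real y ^ 8 * sqrt N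
         \<le> (C3 + 12) * real N * L powr (- 5 / 4 + \<epsilon> / 2)"
        by (simp add: distrib_right)
      then have "2 powr (ln N / ln y) * (8 * real N * totient_ratio_sq N / (ln y)\<^sup>2 * exp (E + 76) + 12 * real y ^ 8 * sqrt N)
        \<le> L powr (\<epsilon> / 4) * ((C3 + 12) * real N * L powr (- 5 / 4 + \<epsilon> / 2))"
        using totient_ratio_sq_ge_1[of N] by (intro mult_mono W) (auto intro!: add_nonneg_nonneg)
      also have "\<dots> = (C3 + 12) * real N * L powr (- 5 / 4 + \<epsilon> * 3 / 4)"
        by (simp add: algebra_simps flip: powr_add)
      also have "\<dots> \<le> (C3 + 12) * real N * X"
        unfolding X_def using L \<epsilon> C by (intro mult_left_mono powr_mono) auto
      finally show ?thesis .
    qed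
    have "B / ln y \<le> 1 / 4"
    proof -
      have "4 * B \<le> ln (real y)" using u lny2 by linarith
      then show ?thesis using ly0 by (simp add: divide_le_eq)
    qed
    then have "(\<Sum>p | prime p \<and> p < N. f h (N - p)) \<le> 2 * real y * sqrt N
      + 3 * real N * (real N powr (- (B / ln y) / 2)) * exp (E + 4 * B * exp B + 45)
      + 2 powr (ln N / ln y) * (8 * real N * totient_ratio_sq N / (ln y)\<^sup>2 * exp (E + 76) + 12 * real y ^ 8 * sqrt N)"
      unfolding E_def using B by (intro sum_shifted_primes_le h y(3) yN) auto
    also have "\<dots> \<le> 2 * real N * X + C2 * real N * X + (C3 + 12) * real N * X"
      by (intro add_mono t1 t2 t3)
    also have "\<dots> = (2 + C2 + C3 + 12) * real N * X" by (simp add: algebra_simps)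
    finally show "(\<Sum>p | prime p \<and> p < N. f h (N - p)) \<le> (2 + C2 + C3 + 12) * real N * ln (real N) powr (- 5 / 4 + \<epsilon>)"
      by (simp add: X_def L_def)
  qed
qed

theorem theorem1p2:
  fixes \<epsilon> :: real
  assumes "\<epsilon> > 0"
  shows "\<exists>C :: real. \<forall>N h :: nat. N > 0 \<longrightarrow> 1 \<le> h \<longrightarrow> real h \<le> ln (real N) \<longrightarrow>
           (\<Sum>p | prime p \<and> p < N. f h (N - p))
             \<le> C * real N * ln (real N) powr (- 5 / 4 + \<epsilon>)"
proof -
  obtain C1 L1 where C1: "C1 \<ge> 0" "\<And>N h :: nat. 4 dvd h \<Longrightarrow> h > 0 \<Longrightarrow> real h \<le> ln (real N) \<Longrightarrow> N > 0 \<Longrightarrow> L1 \<le> ln (real N) \<Longrightarrow>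
     (\<Sum>p | prime p \<and> p < N. f h (N - p)) \<le> C1 * real N * ln (real N) powr (- 5 / 4 + \<epsilon>)"
    using sum_shifted_primes_large[OF assms] by blast
  define L0 where "L0 = max L1 1"
  \<comment> \<open>For \<open>ln N < L0\<close> the trivial bound \<open>2 N \<surd>N\<close> suffices, since
    \<open>\<surd>N \<le> exp (L0 / 2)\<close>.\<close>
  define C0 where "C0 = 2 * exp (L0 / 2) * L0 powr (5 / 4)"
  have C0: "C0 \<ge> 0" by (simp add: C0_def)
  show ?thesis
  proof (intro exI[of _ "C1 + C0"] allI impI)
    fix N h :: nat
    assume N: "N > 0" and h: "1 \<le> h" "real h \<le> ln (real N)"
    define X where "X = ln (real N) powr (- 5 / 4 + \<epsilon>)"
    have L: "ln (real N) \<ge> 1" using h by linarith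
    have NX: "real N * X \<ge> 0" by (simp add: X_def)
    have "(\<Sum>p | prime p \<and> p < N. f h (N - p)) \<le> (C1 + C0) * (real N * X)"
    proof (cases "4 dvd h")
      case False
      then have "(\<Sum>p | prime p \<and> p < N. f h (N - p)) = 0" by (simp add: f_def g_eq_0)
      then show ?thesis using C1(1) C0 NX by simp
    next
      case True
      show ?thesis
      proof (cases "L0 \<le> ln (real N)")
        case True
        then have "(\<Sum>p | prime p \<and> p < N. f h (N - p)) \<le> C1 * real N * ln (real N) powr (- 5 / 4 + \<epsilon>)"
          using \<open>4 dvd h\<close> h N by (intro C1(2)) (auto simp: L0_def)
        also have "\<dots> = C1 * (real N * X)" by (simp add: X_def)
        also have "\<dots> \<le> (C1 + C0) * (real N * X)" using C0 NX by (intro mult_right_mono) auto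
        finally show ?thesis .
      next
        case False
        have "real N = exp (ln (real N))" using N by simp
        also have "\<dots> \<le> exp L0" using False by simp
        finally have "sqrt (real N) \<le> sqrt (exp L0)" by simp
        also have "sqrt (exp L0) = exp (L0 / 2)"
          by (rule real_sqrt_unique) (auto simp: power2_eq_square simp flip: exp_add)
        finally have s: "sqrt (real N) \<le> exp (L0 / 2)" .
        have "1 = L0 powr (5 / 4) * L0 powr (- 5 / 4)" by (simp add: L0_def flip: powr_add)
        also have "\<dots> \<le> L0 powr (5 / 4) * X"
        proof (intro mult_left_mono)
          have "L0 powr (- 5 / 4) \<le> ln (real N) powr (- 5 / 4)" using False L by (intro powr_mono2') auto
          also have "\<dots> \<le> X" unfolding X_def using L assms by (intro powr_mono) auto
          finally show "L0 powr (- 5 / 4) \<le> X" .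
        qed simp
        finally have X1: "1 \<le> L0 powr (5 / 4) * X" .
        have "(\<Sum>p | prime p \<and> p < N. f h (N - p)) \<le> 2 * real N * sqrt N"
          by (rule sum_shifted_primes_trivial[OF N])
        also have "\<dots> \<le> 2 * real N * exp (L0 / 2) * 1" using s by (simp add: mult_left_mono)
        also have "\<dots> \<le> 2 * real N * exp (L0 / 2) * (L0 powr (5 / 4) * X)"
          using X1 by (intro mult_left_mono) auto
        also have "\<dots> = C0 * (real N * X)" by (simp add: C0_def mult_ac)
        also have "\<dots> \<le> (C1 + C0) * (real N * X)" using C1(1) NX by (intro mult_right_mono) auto
        finally show ?thesis .
      qed
    qed
    then show "(\<Sum>p | prime p \<and> p < N. f h (N - p)) \<le> (C1 + C0) * real N * ln (real N) powr (- 5 / 4 + \<epsilon>)"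
      by (simp add: X_def mult.assoc)
  qed
qed

end
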